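(* In the setting and notation of the context, assume that admissible contours exist for both $l=+1$ and $l=-1$. Let $l\in\{+1,-1\}$ and let $\Gamma_l$ be an admissible contour. For $\varkappa=\triangleright$ and $\varkappa=\triangleleft$ let $X_\varkappa^{(l)}\in\mathcal B(\mathcal H_A)$ be the solution of $$X=V^\varkappa_{\Gamma_l}(\widetilde A+X)$$ with $\|X_\varkappa^{(l)}\|\le r_0^{(l)}(K)$, and put $Z_\varkappa^{(l)}=\widetilde A+X_\varkappa^{(l)}$. Then for every $z\in\mathbb C\setminus\Gamma_l$ $$M_{\Gamma_l}(z)=W^{\triangleright}_{\Gamma_l}(z)\,(Z^{(l)}_{\triangleright}-z)=(Z^{(l)}_{\triangleleft}-z)\,W^{\triangleleft}_{\Gamma_l}(z),$$ where $W^{\triangleright}_{\Gamma_l}(z)$, $W^{\triangleleft}_{\Gamma_l}(z)$ are the bounded operators in $\mathcal H_A$ given by $$W^{\triangleright}_{\Gamma_l}(z)=I_A-\int_{\Gamma_l}d\mu\,K'(\mu)(Z^{(l)}_{\triangleright}-\mu)^{-1}+z\int_{\Gamma_l}d\mu\,K'(\mu)(z-\mu)^{-1}(Z^{(l)}_{\triangleright}-\mu)^{-1},$$ $$W^{\triangleleft}_{\Gamma_l}(z)=I_A-\int_{\Gamma_l}(Z^{(l)}_{\triangleleft}-\mu)^{-1}K'(\mu)\,d\mu+z\int_{\Gamma_l}(z-\mu)^{-1}(Z^{(l)}_{\triangleleft}-\mu)^{-1}K'(\mu)\,d\mu .$$ If, in addition, $$\operatorname{dist}\big(z,\nu(\widetilde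 A)\big)\le \tfrac12\, d(\Gamma_l)\,[1-\operatorname{Var}_{\widetilde A}(K,\Gamma_l)],$$ then $\|W^{\varkappa}_{\Gamma_l}(z)-I_A\|<1$ for $\varkappa=\triangleright$ and $\varkappa=\triangleleft$, and the operator $W^{\varkappa}_{\Gamma_l}(z)$ is boundedly invertible.
   Context: **Operators.** $\mathcal H_A,\mathcal H_C$ are separable Hilbert spaces; $\mathcal B(\cdot)$ denotes bounded operators, $I_A$ the identity of $\mathcal H_A$. $C$ is a (possibly unbounded) self-adjoint operator in $\mathcal H_C$ with $C\ge\lambda_C>0$, whose spectrum is absolutely continuous and equals $[\lambda_C,+\infty)$. $A\in\mathcal B(\mathcal H_A)$ is not necessarily self-adjoint. $D$ is a densely defined closable operator from $\operatorname{dom}(D)\subset\mathcal H_A$ to $\mathcal H_C$ such that $C^{-1/2}D$ extends to a bounded operator $\widetilde D=\overline{C^{-1/2}D}\in\mathcal B(\mathcal H_A,\mathcal H_C)$. $B$ is a densely defined closable operator from $\operatorname{dom}(B)\subset\mathcal H_C$ to $\mathcal H_A$ with $\operatorname{dom}(B)\supset\operatorname{dom}(C^{1/2})$; then $\widetilde B=BC^{-1/2}\in\mathcal B(\mathcal H_C,\mathcal H_A)$. Put $\widetilde A=A-\widetilde B\widetilde D$. **Numerical range.** $\nu(\widetilde A)=\overline{\{\langle\widetilde Ax,x\rangle: x\in\mathcal H_A,\ \|x\|=1\}}$ is assumed to lie in $\mathcal O_\eta([\alpha_1,\alpha_2])=\{z\in\mathbb C:\operatorname{dist}(z,[\alpha_1,\alpha_2])\le\eta\}$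 for some $\eta>0$ and real $\alpha_1<\alpha_2$ with $\alpha_1-\eta>\lambda_C$. **The function $K$.** Let $\{E_C(\mu)\}_{\mu\in\mathbb R}$ be the spectral family of $C$ and $K(\mu)=\widetilde BE_C(\mu)\widetilde D$. It is assumed that $K$ is continuously differentiable on $(\lambda_C,+\infty)$ in the operator norm topology and that it admits an analytic continuation (again denoted $K$, with derivative $K'$) from $(\lambda_C,\beta)$, where $\beta>\alpha_2+\eta$, to a simply connected domain $\mathcal D\subset\mathbb C$ with $\mathcal D\supset\mathcal O_\eta([\alpha_1,\alpha_2])$; that at the points $\lambda=\lambda_C$ and $\lambda=\beta$ it satisfies $\|K'(\mu)\|\le c|\mu-\lambda|^\gamma$, $\mu\in\mathcal D$, with some $c>0$, $\gamma\in(-1,0]$; and that $\int_\beta^\infty(1+|\mu|)^{-1}\|K'(\mu)\|\,d\mu<\infty$. **Contours.** $\mathcal D^{(\pm1)}=\mathcal D\cap\mathbb C^{\pm}$ (open upper/lower half-planes). For $l=\pm1$ we consider contours $\Gamma_l=\widetilde\Gamma_l\cup[\beta,+\infty)$, where $\widetilde\Gamma_l$ is a rectifiable Jordan curve in $\mathcal D^{(l)}$ resulting from continuous deformation of the interval $(\lambda_C,\beta)$ with the end points kept fixed; $\Gamma_l$ is traversed from $\lambda_C$ to $+\infty$. **Transfer function.** $M_{\Gamma_l}(z)=\widetilde A-z+V_{\Gamma_l}(z)$, $V_{\Gamma_l}(z)=\int_{\Gamma_l}d\mu\,K'(\mu)\frac{z}{z-\mu}$, for $z\in\mathbb C\setminus\Gamma_l$.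 **Transformations.** For $Z\in\mathcal B(\mathcal H_A)$ with spectrum satisfying $\operatorname{dist}(\sigma(Z),\Gamma_l)>0$, $$V^{\triangleright}_{\Gamma_l}(Z)=\int_{\Gamma_l}d\mu\,K'(\mu)Z(Z-\mu)^{-1},\qquad V^{\triangleleft}_{\Gamma_l}(Z)=\int_{\Gamma_l}Z(Z-\mu)^{-1}K'(\mu)\,d\mu.$$ **Admissible contours.** Put $d(\Gamma_l)=\operatorname{dist}(\nu(\widetilde A),\Gamma_l)$ and $\operatorname{Var}_{\widetilde A}(K,\Gamma_l)=\int_{\Gamma_l}|d\mu|\frac{\|K'(\mu)\|}{\operatorname{dist}(\mu,\nu(\widetilde A))}$. A contour $\Gamma_l=\widetilde\Gamma_l\cup[\beta,+\infty)$, with $\widetilde\Gamma_l$ a rectifiable Jordan curve in $\mathcal D^{(l)}$ resulting from continuous deformation of $(\lambda_C,\beta)$ with the end points kept fixed, is admissible if $d(\Gamma_l)>0$, $\operatorname{Var}_{\widetilde A}(K,\Gamma_l)<1$ and $\operatorname{Var}_{\widetilde A}(K,\Gamma_l)\|\widetilde A\|<\frac14d(\Gamma_l)[1-\operatorname{Var}_{\widetilde A}(K,\Gamma_l)]^2$. **Radii.** For admissible $\Gamma_l$, $$r_{\min}(\Gamma_l)=\tfrac12d(\Gamma_l)[1-\operatorname{Var}_{\widetilde A}(K,\Gamma_l)]-\sqrt{\tfrac14d(\Gamma_l)^2[1-\operatorname{Var}_{\widetilde A}(K,\Gamma_l)]^2-d(\Gamma_l)\operatorname{Var}_{\widetilde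 A}(K,\Gamma_l)\|\widetilde A\|},$$ and $r_0^{(l)}(K)=\inf\{r_{\min}(\Gamma_l):\Gamma_l\text{ admissible}\}$. The solution of $X=V^\varkappa_{\Gamma_l}(\widetilde A+X)$ with $\|X\|\le r_0^{(l)}(K)$ is unique and is the same for all admissible contours $\Gamma_l$ with the given $l$. *)

theory Defs
  imports "HOL-Analysis.Analysis"
begin

section \<open>Complex Hilbert spaces\<close>

class scaleC = scaleR +
  fixes scaleC :: "complex \<Rightarrow> 'a \<Rightarrow> 'a" (infixr \<open>*\<^sub>C\<close> 75)

class complex_vector = real_vector + scaleC +
  assumes scaleC_add_right: "c *\<^sub>C (x + y) = c *\<^sub>C x + c *\<^sub>C y"
    and scaleC_add_left: "(c + d) *\<^sub>C x = c *\<^sub>C x + d *\<^sub>C x"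
    and scaleC_scaleC: "c *\<^sub>C d *\<^sub>C x = (c * d) *\<^sub>C x"
    and scaleR_scaleC: "r *\<^sub>R x = complex_of_real r *\<^sub>C x"

class complex_normed_vector = complex_vector + real_normed_vector +
  assumes norm_scaleC: "norm (c *\<^sub>C x) = cmod c * norm x"

text \<open>The scalar product is linear in the first argument. Its real part is the real inner
  product of the library, so positivity and the norm are those of \<^class>\<open>real_inner\<close>.\<close>

class complex_inner = complex_vector + real_inner +
  fixes cinner :: "'a \<Rightarrow> 'a \<Rightarrow> complex"
  assumes cinner_commute: "cinner x y = cnj (cinner y x)"
    and cinner_add_left: "cinner (x + y) z = cinner x z + cinner y z"
    and cinner_scaleC_left: "cinner (c *\<^sub>C x) y = c * cinner x y"
    and Re_cinner: "Re (cinner x y) = inner x y"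

class complex_hilbert = complex_inner + complete_space

lemma cinner_self: "cinner x x = complex_of_real ((norm (x::'a::complex_inner))\<^sup>2)"
proof (rule complex_eqI)
  show "Re (cinner x x) = Re (complex_of_real ((norm x)\<^sup>2))"
    by (simp add: Re_cinner power2_norm_eq_inner)
  show "Im (cinner x x) = Im (complex_of_real ((norm x)\<^sup>2))"
    using arg_cong[OF cinner_commute[of x x], of Im] by simp
qed

instance complex_inner \<subseteq> complex_normed_vector
proof
  fix c :: complex and x :: 'a
  have "cinner (c *\<^sub>C x) (c *\<^sub>C x) = c * cnj (c * cinner x x)"
    by (metis cinner_commute cinner_scaleC_left)
  also have "\<dots> = complex_of_real ((cmod c * norm x)\<^sup>2)"
    by (simp add: cinner_self complex_norm_square power_mult_distrib del: of_real_power)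
  finally have "complex_of_real ((norm (c *\<^sub>C x))\<^sup>2) = complex_of_real ((cmod c * norm x)\<^sup>2)"
    by (simp add: cinner_self)
  then show "norm (c *\<^sub>C x) = cmod c * norm x"
    by (simp del: of_real_power)
qed

instance complex_hilbert \<subseteq> banach ..


section \<open>Bounded operators\<close>

typedef (overloaded) ('a, 'b) cblinfun (\<open>(_ \<Rightarrow>\<^sub>C\<^sub>L /_)\<close> [22, 21] 21) =
  "{f :: 'a::complex_normed_vector \<Rightarrow> 'b::complex_normed_vector.
      bounded_linear f \<and> (\<forall>c x. f (c *\<^sub>C x) = c *\<^sub>C f x)}"
  morphisms cblinfun_apply CBlinfun
proof -
  have "(0::'b) = c *\<^sub>C 0" for c
    using norm_scaleC[of c "0::'b"] by simp
  then show ?thesis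
    by (intro exI[of _ "\<lambda>_. 0"]) auto
qed

setup_lifting type_definition_cblinfun

lemma bounded_linear_cblinfun_apply: "bounded_linear (cblinfun_apply T)"
  using cblinfun_apply[of T] by simp

lemma scaleC_zero_right: "c *\<^sub>C (0::'a::complex_normed_vector) = 0"
  using norm_scaleC[of c "0::'a"] by simp

lemma scaleC_minus_right: "c *\<^sub>C (- x::'a::complex_normed_vector) = - (c *\<^sub>C x)"
  using scaleC_add_right[of c x "- x"] by (simp add: scaleC_zero_right add_eq_0_iff)

lemma scaleC_diff_right: "c *\<^sub>C (x - y::'a::complex_normed_vector) = c *\<^sub>C x - c *\<^sub>C y"
  using scaleC_add_right[of c x "- y"] by (simp add: scaleC_minus_right)

lemma bounded_linear_scaleC: "bounded_linear (\<lambda>x::'a::complex_normed_vector. c *\<^sub>C x)"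
proof (rule bounded_linear_intro[where K = "cmod c"])
  show "c *\<^sub>C r *\<^sub>R x = r *\<^sub>R c *\<^sub>C x" for r and x :: 'a
    by (simp add: scaleR_scaleC scaleC_scaleC mult.commute)
qed (simp_all add: scaleC_add_right norm_scaleC mult.commute)

instantiation cblinfun :: (complex_normed_vector, complex_normed_vector) complex_normed_vector
begin

lift_definition norm_cblinfun :: "'a \<Rightarrow>\<^sub>C\<^sub>L 'b \<Rightarrow> real" is onorm .

lift_definition zero_cblinfun :: "'a \<Rightarrow>\<^sub>C\<^sub>L 'b" is "\<lambda>x. 0"
  by (simp add: scaleC_zero_right)

lift_definition plus_cblinfun :: "'a \<Rightarrow>\<^sub>C\<^sub>L 'b \<Rightarrow> 'a \<Rightarrow>\<^sub>C\<^sub>L 'b \<Rightarrow> 'a \<Rightarrow>\<^sub>C\<^sub>L 'b"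
  is "\<lambda>f g x. f x + g x"
  by (simp add: bounded_linear_add scaleC_add_right)

lift_definition minus_cblinfun :: "'a \<Rightarrow>\<^sub>C\<^sub>L 'b \<Rightarrow> 'a \<Rightarrow>\<^sub>C\<^sub>L 'b \<Rightarrow> 'a \<Rightarrow>\<^sub>C\<^sub>L 'b"
  is "\<lambda>f g x. f x - g x"
  by (simp add: bounded_linear_sub scaleC_diff_right)

lift_definition uminus_cblinfun :: "'a \<Rightarrow>\<^sub>C\<^sub>L 'b \<Rightarrow> 'a \<Rightarrow>\<^sub>C\<^sub>L 'b" is "\<lambda>f x. - f x"
  by (simp add: bounded_linear_minus scaleC_minus_right)

lift_definition scaleC_cblinfun :: "complex \<Rightarrow> 'a \<Rightarrow>\<^sub>C\<^sub>L 'b \<Rightarrow> 'a \<Rightarrow>\<^sub>C\<^sub>L 'b" is "\<lambda>c f x. c *\<^sub>C f x"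
  by (simp add: bounded_linear_compose[OF bounded_linear_scaleC] scaleC_scaleC mult.commute)

lift_definition scaleR_cblinfun :: "real \<Rightarrow> 'a \<Rightarrow>\<^sub>C\<^sub>L 'b \<Rightarrow> 'a \<Rightarrow>\<^sub>C\<^sub>L 'b" is "\<lambda>r f x. r *\<^sub>R f x"
  by (simp add: bounded_linear_compose[OF bounded_linear_scaleC] scaleR_scaleC
      scaleC_scaleC mult.commute)

definition dist_cblinfun :: "'a \<Rightarrow>\<^sub>C\<^sub>L 'b \<Rightarrow> 'a \<Rightarrow>\<^sub>C\<^sub>L 'b \<Rightarrow> real"
  where "dist_cblinfun S T = norm (S - T)"

definition [code del]:
  "(uniformity :: (('a \<Rightarrow>\<^sub>C\<^sub>L 'b) \<times> ('a \<Rightarrow>\<^sub>C\<^sub>L 'b)) filter) =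
     (INF e\<in>{0 <..}. principal {(S, T). dist S T < e})"

definition open_cblinfun :: "('a \<Rightarrow>\<^sub>C\<^sub>L 'b) set \<Rightarrow> bool"
  where [code del]: "open_cblinfun U = (\<forall>S\<in>U. \<forall>\<^sub>F (S', T) in uniformity. S' = S \<longrightarrow> T \<in> U)"

definition sgn_cblinfun :: "'a \<Rightarrow>\<^sub>C\<^sub>L 'b \<Rightarrow> 'a \<Rightarrow>\<^sub>C\<^sub>L 'b"
  where "sgn_cblinfun T = inverse (norm T) *\<^sub>R T"

instance
proof
  fix S T U :: "'a \<Rightarrow>\<^sub>C\<^sub>L 'b" and c d :: complex and r s :: real and \<U> :: "('a \<Rightarrow>\<^sub>C\<^sub>L 'b) set"
  show "dist S T = norm (S - T)"
    by (fact dist_cblinfun_def)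
  show "sgn T = inverse (norm T) *\<^sub>R T"
    by (fact sgn_cblinfun_def)
  show "(uniformity :: (('a \<Rightarrow>\<^sub>C\<^sub>L 'b) \<times> ('a \<Rightarrow>\<^sub>C\<^sub>L 'b)) filter) =
     (INF e\<in>{0 <..}. principal {(S, T). dist S T < e})"
    by (fact uniformity_cblinfun_def)
  show "open \<U> = (\<forall>S\<in>\<U>. \<forall>\<^sub>F (S', T) in uniformity. S' = S \<longrightarrow> T \<in> \<U>)"
    by (fact open_cblinfun_def)
  show "norm (S + T) \<le> norm S + norm T"
    by transfer (simp add: onorm_triangle)
  show "norm (r *\<^sub>R T) = \<bar>r\<bar> * norm T"
    by transfer (simp add: onorm_scaleR)
  show "norm T = 0 \<longleftrightarrow> T = 0"
    by transfer (simp add: onorm_eq_0 fun_eq_iff)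
  show "r *\<^sub>R T = complex_of_real r *\<^sub>C T"
    by transfer (simp add: scaleR_scaleC)
  then show "norm (c *\<^sub>C T) = cmod c * norm T"
  proof transfer
    fix c and f :: "'a \<Rightarrow> 'b"
    assume f: "bounded_linear f \<and> (\<forall>c x. f (c *\<^sub>C x) = c *\<^sub>C f x)"
    have "onorm (\<lambda>x. c *\<^sub>C f x) = (SUP x. cmod c * (norm (f x) / norm x))"
      by (simp add: onorm_def norm_scaleC)
    also have "\<dots> = onorm (\<lambda>x. cmod c *\<^sub>R f x)"
      by (simp add: onorm_def)
    also have "\<dots> = cmod c * onorm f"
      using f by (simp add: onorm_scaleR)
    finally show "onorm (\<lambda>x. c *\<^sub>C f x) = cmod c * onorm f" .
  qed
qed (transfer; simp add: algebra_simps scaleC_add_right scaleC_add_left scaleC_scaleC)+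

end

lemma norm_cblinfun_apply: "norm (cblinfun_apply T x) \<le> norm T * norm x"
  by transfer (simp add: onorm)

lemma norm_cblinfun_bound:
  "0 \<le> b \<Longrightarrow> (\<And>x. norm (cblinfun_apply T x) \<le> b * norm x) \<Longrightarrow> norm T \<le> b"
  by transfer (simp add: onorm_bound)

instance cblinfun :: (complex_normed_vector, "{complex_normed_vector, banach}") banach
proof
  fix X :: "nat \<Rightarrow> 'a \<Rightarrow>\<^sub>C\<^sub>L 'b"
  assume X: "Cauchy X"
  define Y where "Y n = Blinfun (cblinfun_apply (X n))" for n
  have Y: "blinfun_apply (Y n) = cblinfun_apply (X n)" for n
    by (simp add: Y_def bounded_linear_Blinfun_apply bounded_linear_cblinfun_apply)
  have norm_Y: "norm (Y m - Y n) = norm (X m - X n)" for m n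
  proof -
    have "blinfun_apply (Y m - Y n) = cblinfun_apply (X m - X n)"
      by (simp add: fun_eq_iff blinfun.diff_left minus_cblinfun.rep_eq Y)
    then show ?thesis
      by (simp add: norm_blinfun.rep_eq norm_cblinfun.rep_eq)
  qed
  have "Cauchy Y"
    using X by (simp add: Cauchy_iff norm_Y)
  then obtain L where L: "Y \<longlonglongrightarrow> L"
    using Cauchy_convergent convergent_def by blast
  have pointwise: "(\<lambda>n. cblinfun_apply (X n) x) \<longlonglongrightarrow> blinfun_apply L x" for x
    using blinfun.tendsto[OF L tendsto_const[of x]] by (simp add: Y)
  have "blinfun_apply L (c *\<^sub>C x) = c *\<^sub>C blinfun_apply L x" for c x
  proof (rule LIMSEQ_unique[OF pointwise])
    have "cblinfun_apply (X n) (c *\<^sub>C x) = c *\<^sub>C cblinfun_apply (X n) x" for n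
      using cblinfun_apply[of "X n"] by simp
    then show "(\<lambda>n. cblinfun_apply (X n) (c *\<^sub>C x)) \<longlonglongrightarrow> c *\<^sub>C blinfun_apply L x"
      using bounded_linear.tendsto[OF bounded_linear_scaleC pointwise] by simp
  qed
  then have L': "cblinfun_apply (CBlinfun (blinfun_apply L)) = blinfun_apply L"
    by (simp add: CBlinfun_inverse blinfun.bounded_linear_right)
  have "norm (X n - CBlinfun (blinfun_apply L)) = norm (Y n - L)" for n
  proof -
    have "cblinfun_apply (X n - CBlinfun (blinfun_apply L)) = blinfun_apply (Y n - L)"
      by (simp add: fun_eq_iff blinfun.diff_left minus_cblinfun.rep_eq Y L')
    then show ?thesis
      by (simp add: norm_blinfun.rep_eq norm_cblinfun.rep_eq)
  qed
  then have "X \<longlonglongrightarrow> CBlinfun (blinfun_apply L)"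
    using L by (simp add: LIMSEQ_iff)
  then show "convergent X"
    by (rule convergentI)
qed

lift_definition id_cblinfun :: "'a::complex_normed_vector \<Rightarrow>\<^sub>C\<^sub>L 'a" is "\<lambda>x. x"
  by simp

lift_definition cblinfun_compose ::
  "'b::complex_normed_vector \<Rightarrow>\<^sub>C\<^sub>L 'c::complex_normed_vector \<Rightarrow>
   'a::complex_normed_vector \<Rightarrow>\<^sub>C\<^sub>L 'b \<Rightarrow> 'a \<Rightarrow>\<^sub>C\<^sub>L 'c" (infixl \<open>o\<^sub>C\<^sub>L\<close> 67) is "\<lambda>f g x. f (g x)"
  by (simp add: bounded_linear_compose)

definition is_cblinfun_inverse :: "'a::complex_normed_vector \<Rightarrow>\<^sub>C\<^sub>L 'a \<Rightarrow> 'a \<Rightarrow>\<^sub>C\<^sub>L 'a \<Rightarrow> bool" where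
  "is_cblinfun_inverse T S \<longleftrightarrow> T o\<^sub>C\<^sub>L S = id_cblinfun \<and> S o\<^sub>C\<^sub>L T = id_cblinfun"

definition boundedly_invertible :: "'a::complex_normed_vector \<Rightarrow>\<^sub>C\<^sub>L 'a \<Rightarrow> bool" where
  "boundedly_invertible T \<longleftrightarrow> (\<exists>S. is_cblinfun_inverse T S)"

text \<open>Unspecified unless the operator is boundedly invertible.\<close>

definition cblinfun_inv :: "'a::complex_normed_vector \<Rightarrow>\<^sub>C\<^sub>L 'a \<Rightarrow> 'a \<Rightarrow>\<^sub>C\<^sub>L 'a" where
  "cblinfun_inv T = (THE S. is_cblinfun_inverse T S)"

definition numerical_range_closure :: "'a::complex_inner \<Rightarrow>\<^sub>C\<^sub>L 'a \<Rightarrow> complex set" where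
  "numerical_range_closure T = closure {cinner (cblinfun_apply T x) x | x. norm x = 1}"


section \<open>Unbounded operators\<close>

text \<open>An unbounded operator is given by its domain and a function whose values outside the domain
  are irrelevant.\<close>

definition linear_operator_on ::
  "'a::complex_inner set \<Rightarrow> ('a \<Rightarrow> 'b::complex_inner) \<Rightarrow> bool" where
  "linear_operator_on dm T \<longleftrightarrow>
     0 \<in> dm \<and> (\<forall>x\<in>dm. \<forall>y\<in>dm. x + y \<in> dm \<and> T (x + y) = T x + T y) \<and>
     (\<forall>c. \<forall>x\<in>dm. c *\<^sub>C x \<in> dm \<and> T (c *\<^sub>C x) = c *\<^sub>C T x)"

definition densely_defined_closable ::
  "'a::complex_inner set \<Rightarrow> ('a \<Rightarrow> 'b::complex_inner) \<Rightarrow> bool" where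
  "densely_defined_closable dm T \<longleftrightarrow>
     linear_operator_on dm T \<and> closure dm = UNIV \<and>
     (\<forall>y. (0, y) \<in> closure ((\<lambda>x. (x, T x)) ` dm) \<longrightarrow> y = 0)"

text \<open>The right-hand side of the equivalence says that \<open>(y, w)\<close> is in the graph of the adjoint.\<close>

definition self_adjoint :: "'a::complex_inner set \<Rightarrow> ('a \<Rightarrow> 'a) \<Rightarrow> bool" where
  "self_adjoint dm T \<longleftrightarrow>
     linear_operator_on dm T \<and> closure dm = UNIV \<and>
     (\<forall>y w. y \<in> dm \<and> w = T y \<longleftrightarrow> (\<forall>x\<in>dm. cinner (T x) y = cinner x w))"

text \<open>The scalar products below are real for a self-adjoint operator.\<close>

definition bounded_below_by :: "'a::complex_inner set \<Rightarrow> ('a \<Rightarrow> 'a) \<Rightarrow> real \<Rightarrow> bool" where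
  "bounded_below_by dm T a \<longleftrightarrow> (\<forall>x\<in>dm. a * (norm x)\<^sup>2 \<le> Re (cinner (T x) x))"

definition op_spectrum :: "'a::complex_inner set \<Rightarrow> ('a \<Rightarrow> 'a) \<Rightarrow> complex set" where
  "op_spectrum dm T = - {z. \<exists>R :: 'a \<Rightarrow>\<^sub>C\<^sub>L 'a.
     (\<forall>y. cblinfun_apply R y \<in> dm \<and> T (cblinfun_apply R y) - z *\<^sub>C cblinfun_apply R y = y) \<and>
     (\<forall>x\<in>dm. cblinfun_apply R (T x - z *\<^sub>C x) = x)}"

definition spectral_measure ::
  "(real \<Rightarrow> 'a::complex_inner \<Rightarrow>\<^sub>C\<^sub>L 'a) \<Rightarrow> 'a \<Rightarrow> real measure" where
  "spectral_measure E x = interval_measure (\<lambda>\<mu>. (norm (cblinfun_apply (E \<mu>) x))\<^sup>2)"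

text \<open>The last two conditions express \<open>T = \<integral> \<mu> dE(\<mu>)\<close>; by polarization the quadratic form
  determines \<open>T\<close> on its domain.\<close>

definition spectral_family_of ::
  "(real \<Rightarrow> 'a::complex_inner \<Rightarrow>\<^sub>C\<^sub>L 'a) \<Rightarrow> 'a set \<Rightarrow> ('a \<Rightarrow> 'a) \<Rightarrow> bool" where
  "spectral_family_of E dm T \<longleftrightarrow>
     (\<forall>\<mu> x y. cinner (cblinfun_apply (E \<mu>) x) y = cinner x (cblinfun_apply (E \<mu>) y)) \<and>
     (\<forall>\<mu> \<nu>. E \<mu> o\<^sub>C\<^sub>L E \<nu> = E (min \<mu> \<nu>)) \<and>
     (\<forall>\<mu> x. ((\<lambda>\<nu>. cblinfun_apply (E \<nu>) x) \<longlongrightarrow> cblinfun_apply (E \<mu>) x) (at_right \<mu>)) \<and>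
     (\<forall>x. ((\<lambda>\<nu>. cblinfun_apply (E \<nu>) x) \<longlongrightarrow> 0) at_bot) \<and>
     (\<forall>x. ((\<lambda>\<nu>. cblinfun_apply (E \<nu>) x) \<longlongrightarrow> x) at_top) \<and>
     dm = {x. (\<integral>\<^sup>+\<mu>. ennreal (\<mu>\<^sup>2) \<partial>spectral_measure E x) < \<infinity>} \<and>
     (\<forall>x\<in>dm. cinner (T x) x = complex_of_real (LINT \<mu>|spectral_measure E x. \<mu>))"

definition absolutely_continuous_spectrum ::
  "(real \<Rightarrow> 'a::complex_inner \<Rightarrow>\<^sub>C\<^sub>L 'a) \<Rightarrow> bool" where
  "absolutely_continuous_spectrum E \<longleftrightarrow>
     (\<forall>x. absolutely_continuous lborel (spectral_measure E x))"

text \<open>\<open>S\<close> is the square root of \<open>T\<close>, that is, the nonnegative self-adjoint operator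
  with \<open>S\<^sup>2 = T\<close>, domains included.\<close>

definition is_sqrt_of ::
  "'a::complex_inner set \<Rightarrow> ('a \<Rightarrow> 'a) \<Rightarrow> 'a set \<Rightarrow> ('a \<Rightarrow> 'a) \<Rightarrow> bool" where
  "is_sqrt_of domS S dm T \<longleftrightarrow>
     self_adjoint domS S \<and> bounded_below_by domS S 0 \<and>
     dm = {x \<in> domS. S x \<in> domS} \<and> (\<forall>x\<in>dm. T x = S (S x))"

definition is_bounded_inverse_of ::
  "'a::complex_inner \<Rightarrow>\<^sub>C\<^sub>L 'a \<Rightarrow> 'a set \<Rightarrow> ('a \<Rightarrow> 'a) \<Rightarrow> bool" where
  "is_bounded_inverse_of R dm S \<longleftrightarrow>
     (\<forall>x\<in>dm. cblinfun_apply R (S x) = x) \<and>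
     (\<forall>y. cblinfun_apply R y \<in> dm \<and> S (cblinfun_apply R y) = y)"


section \<open>Rectifiable curves and contour integrals\<close>

definition curve_length :: "(real \<Rightarrow> complex) \<Rightarrow> real set \<Rightarrow> ennreal" where
  "curve_length g I = (SUP d\<in>{d. d division_of I}. \<Sum>k\<in>d. ennreal (dist (g (Inf k)) (g (Sup k))))"

definition rectifiable_arc :: "(real \<Rightarrow> complex) \<Rightarrow> bool" where
  "rectifiable_arc g \<longleftrightarrow> arc g \<and> curve_length g {0..1} < \<infinity>"

text \<open>The measure \<open>|d\<mu>|\<close> along a rectifiable curve, as a measure on the parameter.\<close>

definition arclength_measure :: "(real \<Rightarrow> complex) \<Rightarrow> real measure" where
  "arclength_measure g = interval_measure (\<lambda>t. enn2real (curve_length g {0..min t 1}))"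

text \<open>The curves are only rectifiable, so \<open>\<integral> F(\<mu>) d\<mu>\<close> is a Stieltjes integral: its sums are
  \<open>\<Sum> (g(t\<^sub>i) - g(t\<^sub>i\<^sub>-\<^sub>1)) F(g(\<tau>\<^sub>i))\<close>. As in the library's \<^const>\<open>has_integral\<close> the limit is taken
  along gauges; this covers integrands that are unbounded at the end points, and for a
  continuous curve the value of the integrand at an end point is irrelevant.\<close>

definition has_curve_integral ::
  "(complex \<Rightarrow> 'b::complex_normed_vector) \<Rightarrow> 'b \<Rightarrow> (real \<Rightarrow> complex) \<Rightarrow> bool" where
  "has_curve_integral F I g \<longleftrightarrow>
     (\<forall>e>0. \<exists>\<gamma>. gauge \<gamma> \<and>
        (\<forall>p. p tagged_division_of {0..1} \<and> \<gamma> fine p \<longrightarrow>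
           norm ((\<Sum>(t, k)\<in>p. (g (Sup k) - g (Inf k)) *\<^sub>C F (g t)) - I) < e))"

definition curve_integral ::
  "(real \<Rightarrow> complex) \<Rightarrow> (complex \<Rightarrow> 'b::complex_normed_vector) \<Rightarrow> 'b" where
  "curve_integral g F = (THE I. has_curve_integral F I g)"

text \<open>A contour is the curve \<open>g\<close> from \<open>\<lambda>\<^sub>C\<close> to \<open>\<beta>\<close> followed by the ray \<open>[\<beta>, \<infinity>)\<close>.\<close>

definition contour_set :: "(real \<Rightarrow> complex) \<Rightarrow> real \<Rightarrow> complex set" where
  "contour_set g \<beta> = path_image g \<union> complex_of_real ` {\<beta>..}"

definition contour_integrable ::
  "(real \<Rightarrow> complex) \<Rightarrow> real \<Rightarrow> (complex \<Rightarrow> 'b::complex_normed_vector) \<Rightarrow> bool" where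
  "contour_integrable g \<beta> F \<longleftrightarrow>
     (\<exists>I. has_curve_integral F I g) \<and> (\<lambda>\<mu>. F (complex_of_real \<mu>)) integrable_on {\<beta>..}"

definition contour_int ::
  "(real \<Rightarrow> complex) \<Rightarrow> real \<Rightarrow> (complex \<Rightarrow> 'b::complex_normed_vector) \<Rightarrow> 'b" where
  "contour_int g \<beta> F = curve_integral g F + integral {\<beta>..} (\<lambda>\<mu>. F (complex_of_real \<mu>))"

text \<open>The deformation takes place in \<open>\<D>\<close>, with the end points kept fixed.\<close>

definition is_contour ::
  "real \<Rightarrow> real \<Rightarrow> complex set \<Rightarrow> int \<Rightarrow> (real \<Rightarrow> complex) \<Rightarrow> bool" where
  "is_contour lamC \<beta> \<D> l g \<longleftrightarrow>
     rectifiable_arc g \<and> pathstart g = complex_of_real lamC \<and> pathfinish g = complex_of_real \<beta> \<and>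
     g ` {0<..<1} \<subseteq> \<D> \<inter> {z. of_int l * Im z > 0} \<and>
     homotopic_with_canon
       (\<lambda>h. pathstart h = complex_of_real lamC \<and> pathfinish h = complex_of_real \<beta> \<and>
            h ` {0<..<1} \<subseteq> \<D>)
       {0..1} UNIV (linepath (complex_of_real lamC) (complex_of_real \<beta>)) g"


section \<open>Transfer function, admissible contours\<close>

text \<open>In this section \<open>K'\<close> is the operator function of \<open>\<mu>\<close> along the contours.\<close>

definition V_fun ::
  "(complex \<Rightarrow> 'a::complex_hilbert \<Rightarrow>\<^sub>C\<^sub>L 'a) \<Rightarrow> real \<Rightarrow> (real \<Rightarrow> complex) \<Rightarrow> complex \<Rightarrow> 'a \<Rightarrow>\<^sub>C\<^sub>L 'a" where
  "V_fun K' \<beta> g z = contour_int g \<beta> (\<lambda>\<mu>. (z / (z - \<mu>)) *\<^sub>C K' \<mu>)"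

definition M_fun ::
  "'a::complex_hilbert \<Rightarrow>\<^sub>C\<^sub>L 'a \<Rightarrow> (complex \<Rightarrow> 'a \<Rightarrow>\<^sub>C\<^sub>L 'a) \<Rightarrow> real \<Rightarrow> (real \<Rightarrow> complex) \<Rightarrow> complex \<Rightarrow>
   'a \<Rightarrow>\<^sub>C\<^sub>L 'a" where
  "M_fun At K' \<beta> g z = At - z *\<^sub>C id_cblinfun + V_fun K' \<beta> g z"

definition V_right ::
  "(complex \<Rightarrow> 'a::complex_hilbert \<Rightarrow>\<^sub>C\<^sub>L 'a) \<Rightarrow> real \<Rightarrow> (real \<Rightarrow> complex) \<Rightarrow> 'a \<Rightarrow>\<^sub>C\<^sub>L 'a \<Rightarrow> 'a \<Rightarrow>\<^sub>C\<^sub>L 'a" where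
  "V_right K' \<beta> g Z =
     contour_int g \<beta> (\<lambda>\<mu>. K' \<mu> o\<^sub>C\<^sub>L Z o\<^sub>C\<^sub>L cblinfun_inv (Z - \<mu> *\<^sub>C id_cblinfun))"

definition V_left ::
  "(complex \<Rightarrow> 'a::complex_hilbert \<Rightarrow>\<^sub>C\<^sub>L 'a) \<Rightarrow> real \<Rightarrow> (real \<Rightarrow> complex) \<Rightarrow> 'a \<Rightarrow>\<^sub>C\<^sub>L 'a \<Rightarrow> 'a \<Rightarrow>\<^sub>C\<^sub>L 'a" where
  "V_left K' \<beta> g Z =
     contour_int g \<beta> (\<lambda>\<mu>. Z o\<^sub>C\<^sub>L cblinfun_inv (Z - \<mu> *\<^sub>C id_cblinfun) o\<^sub>C\<^sub>L K' \<mu>)"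

definition W_right ::
  "(complex \<Rightarrow> 'a::complex_hilbert \<Rightarrow>\<^sub>C\<^sub>L 'a) \<Rightarrow> real \<Rightarrow> (real \<Rightarrow> complex) \<Rightarrow> 'a \<Rightarrow>\<^sub>C\<^sub>L 'a \<Rightarrow> complex \<Rightarrow>
   'a \<Rightarrow>\<^sub>C\<^sub>L 'a" where
  "W_right K' \<beta> g Z z =
     id_cblinfun
     - contour_int g \<beta> (\<lambda>\<mu>. K' \<mu> o\<^sub>C\<^sub>L cblinfun_inv (Z - \<mu> *\<^sub>C id_cblinfun))
     + z *\<^sub>C contour_int g \<beta>
         (\<lambda>\<mu>. inverse (z - \<mu>) *\<^sub>C (K' \<mu> o\<^sub>C\<^sub>L cblinfun_inv (Z - \<mu> *\<^sub>C id_cblinfun)))"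

definition W_left ::
  "(complex \<Rightarrow> 'a::complex_hilbert \<Rightarrow>\<^sub>C\<^sub>L 'a) \<Rightarrow> real \<Rightarrow> (real \<Rightarrow> complex) \<Rightarrow> 'a \<Rightarrow>\<^sub>C\<^sub>L 'a \<Rightarrow> complex \<Rightarrow>
   'a \<Rightarrow>\<^sub>C\<^sub>L 'a" where
  "W_left K' \<beta> g Z z =
     id_cblinfun
     - contour_int g \<beta> (\<lambda>\<mu>. cblinfun_inv (Z - \<mu> *\<^sub>C id_cblinfun) o\<^sub>C\<^sub>L K' \<mu>)
     + z *\<^sub>C contour_int g \<beta>
         (\<lambda>\<mu>. inverse (z - \<mu>) *\<^sub>C (cblinfun_inv (Z - \<mu> *\<^sub>C id_cblinfun) o\<^sub>C\<^sub>L K' \<mu>))"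

definition contour_dist :: "'a::complex_hilbert \<Rightarrow>\<^sub>C\<^sub>L 'a \<Rightarrow> real \<Rightarrow> (real \<Rightarrow> complex) \<Rightarrow> real" where
  "contour_dist At \<beta> g = setdist (numerical_range_closure At) (contour_set g \<beta>)"

text \<open>The variation is an extended nonnegative number, infinite when the integral diverges.\<close>

definition Var_K ::
  "'a::complex_hilbert \<Rightarrow>\<^sub>C\<^sub>L 'a \<Rightarrow> (complex \<Rightarrow> 'a \<Rightarrow>\<^sub>C\<^sub>L 'a) \<Rightarrow> real \<Rightarrow> (real \<Rightarrow> complex) \<Rightarrow> ennreal" where
  "Var_K At K' \<beta> g =
     (\<integral>\<^sup>+t\<in>{0..1}. ennreal (norm (K' (g t)) / infdist (g t) (numerical_range_closure At))
        \<partial>arclength_measure g)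
     + (\<integral>\<^sup>+\<mu>\<in>{\<beta>..}. ennreal (norm (K' (complex_of_real \<mu>))
            / infdist (complex_of_real \<mu>) (numerical_range_closure At)) \<partial>lborel)"

definition admissible_contour ::
  "'a::complex_hilbert \<Rightarrow>\<^sub>C\<^sub>L 'a \<Rightarrow> (complex \<Rightarrow> 'a \<Rightarrow>\<^sub>C\<^sub>L 'a) \<Rightarrow> real \<Rightarrow> real \<Rightarrow> complex set \<Rightarrow> int \<Rightarrow>
   (real \<Rightarrow> complex) \<Rightarrow> bool" where
  "admissible_contour At K' lamC \<beta> \<D> l g \<longleftrightarrow>
     is_contour lamC \<beta> \<D> l g \<and> contour_dist At \<beta> g > 0 \<and> Var_K At K' \<beta> g < 1 \<and>
     enn2real (Var_K At K' \<beta> g) * norm At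
       < 1/4 * contour_dist At \<beta> g * (1 - enn2real (Var_K At K' \<beta> g))\<^sup>2"

definition r_min ::
  "'a::complex_hilbert \<Rightarrow>\<^sub>C\<^sub>L 'a \<Rightarrow> (complex \<Rightarrow> 'a \<Rightarrow>\<^sub>C\<^sub>L 'a) \<Rightarrow> real \<Rightarrow> (real \<Rightarrow> complex) \<Rightarrow> real" where
  "r_min At K' \<beta> g =
     (let d = contour_dist At \<beta> g; v = enn2real (Var_K At K' \<beta> g)
      in 1/2 * d * (1 - v) - sqrt (1/4 * d\<^sup>2 * (1 - v)\<^sup>2 - d * v * norm At))"

definition r_zero ::
  "'a::complex_hilbert \<Rightarrow>\<^sub>C\<^sub>L 'a \<Rightarrow> (complex \<Rightarrow> 'a \<Rightarrow>\<^sub>C\<^sub>L 'a) \<Rightarrow> real \<Rightarrow> real \<Rightarrow> complex set \<Rightarrow> int \<Rightarrow> real" where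
  "r_zero At K' lamC \<beta> \<D> l =
     Inf (r_min At K' \<beta> ` {g. admissible_contour At K' lamC \<beta> \<D> l g})"

end

theory Submission
  imports Defs "HOL-Complex_Analysis.Cauchy_Integral_Formula" "HOL-Probability.Distribution_Functions"
begin

text \<open>With \<open>R(\<mu>) = (Z - \<mu>)\<^sup>-\<^sup>1\<close> the factorizations follow from \<open>R(\<mu>) Z - \<mu> R(\<mu>) = I\<close> and
  \<open>z / (z - \<mu>) - 1 = \<mu> / (z - \<mu>)\<close> by linearity of the integral, since the basic equation says that
  \<open>X\<close> is the integral of \<open>K'(\<mu>) R(\<mu>) Z\<close>. The resolvent satisfies
  \<open>\<parallel>R(\<mu>)\<parallel> \<le> 1 / (dist(\<mu>, \<nu>(At)) - \<parallel>X\<parallel>)\<close>, by continuation from infinity along the contour, and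
  \<open>\<parallel>X\<parallel> \<le> d (1 - Var) / 2\<close>, hence \<open>\<parallel>W - I\<parallel> \<le> 4 Var (1 + \<parallel>At\<parallel> / d) / (1 + Var)\<^sup>2\<close>, and the
  right-hand side is below \<open>1\<close> by admissibility.

  The curves being only rectifiable, the integrals over them are constructed from interval functions
  \<open>\<Psi>\<close> that agree locally with \<open>(g s - g u) f(t)\<close> up to the increments of a function \<open>m\<close> of small
  total variation: the Riemann sums telescope against such a \<open>\<Psi>\<close>.\<close>

text \<open>The obstacle is integration. \<open>curve_integral\<close> is a definite description
  over operator-valued gauge sums, so existence must precede every algebraic step; the curve need
  not have a derivative that would reduce it to a parameter integral, and \<open>K'\<close> may be
  unbounded near the ends of the curve. The control used there is finiteness of
  \<open>Var_K\<close>: its integrand serves as a weight \<open>w\<close>, and every integrand is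
  compared with a multiple of \<open>w\<close>. This single comparison yields both existence of the
  integral and a norm bound by the total weight, which is how \<open>Var_K\<close> enters the final
  estimate. The comparison asks for integrands continuous along the contour. Only complex
  differentiability of \<open>Kc\<close> is given, so continuity of the derivative in operator norm
  is itself derived, from Cauchy's inequality.\<close>

lemma scaleC_zero_left [simp]: "0 *\<^sub>C (x::'a::complex_normed_vector) = 0"
  using norm_scaleC[of 0 x] by simp

lemma scaleC_one [simp]: "1 *\<^sub>C (x::'a::complex_normed_vector) = x"
  using scaleR_scaleC[of 1 x] by simp

lemma scaleC_minus_left: "(- c) *\<^sub>C (x::'a::complex_normed_vector) = - (c *\<^sub>C x)"
  using scaleC_add_left[of c "- c" x] by (simp add: add_eq_0_iff)

lemma scaleC_diff_left: "(c - d) *\<^sub>C (x::'a::complex_normed_vector) = c *\<^sub>C x - d *\<^sub>C x"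
  using scaleC_add_left[of c "- d" x] by (simp add: scaleC_minus_left)

lemma bounded_bilinear_scaleC:
  "bounded_bilinear (\<lambda>c (x::'a::complex_normed_vector). c *\<^sub>C x)"
proof
  show "(r *\<^sub>R c) *\<^sub>C x = r *\<^sub>R c *\<^sub>C x" for r c and x :: 'a
    by (simp add: scaleR_scaleC scaleC_scaleC scaleR_conv_of_real)
  show "c *\<^sub>C r *\<^sub>R x = r *\<^sub>R c *\<^sub>C x" for r c and x :: 'a
    by (simp add: scaleR_scaleC scaleC_scaleC mult.commute)
  show "\<exists>K. \<forall>c (x::'a). norm (c *\<^sub>C x) \<le> norm c * norm x * K"
    by (intro exI[of _ 1]) (simp add: norm_scaleC)
qed (simp_all add: scaleC_add_left scaleC_add_right)

lemmas continuous_on_scaleC = bounded_bilinear.continuous_on[OF bounded_bilinear_scaleC]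

section \<open>Stieltjes integrals along rectifiable curves\<close>

text \<open>\<open>\<Psi>\<close> is an approximate primitive of \<open>f dg\<close>, and \<open>m\<close> bounds the error. Only intervals
  containing the tag \<open>t\<close> are tested, so that primitives on adjacent intervals can be joined.\<close>

definition straddle ::
  "(real \<Rightarrow> complex) \<Rightarrow> (real \<Rightarrow> 'b::complex_normed_vector) \<Rightarrow> real \<Rightarrow> real \<Rightarrow> (real \<Rightarrow> 'b) \<Rightarrow> (real \<Rightarrow> real) \<Rightarrow> bool"
  where "straddle g f a b \<Psi> m \<longleftrightarrow>
    (\<forall>t\<in>{a..b}. \<exists>d>0. \<forall>u s. a \<le> u \<and> u \<le> t \<and> t \<le> s \<and> s \<le> b \<and> s - u < d \<longrightarrow>
       norm (\<Psi> s - \<Psi> u - (g s - g u) *\<^sub>C f t) \<le> m s - m u)"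

definition curve_sum ::
  "(real \<Rightarrow> complex) \<Rightarrow> (real \<Rightarrow> 'b::complex_normed_vector) \<Rightarrow> (real \<times> real set) set \<Rightarrow> 'b"
  where "curve_sum g f p = (\<Sum>(t, k)\<in>p. (g (Sup k) - g (Inf k)) *\<^sub>C f t)"

lemma has_curve_integral_alt:
  "has_curve_integral F I g \<longleftrightarrow>
     (\<forall>e>0. \<exists>\<gamma>. gauge \<gamma> \<and>
        (\<forall>p. p tagged_division_of {0..1} \<and> \<gamma> fine p \<longrightarrow> norm (curve_sum g (\<lambda>t. F (g t)) p - I) < e))"
  by (simp add: has_curve_integral_def curve_sum_def)

text \<open>On a fine tagged division each interval contributes the increment of
  \<open>\<Psi>\<close> up to the increment of \<open>m\<close>, and both families of increments
  telescope over \<open>{0..1}\<close>.\<close>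

lemma straddle_curve_sum:
  assumes st: "straddle g f 0 1 \<Psi> m"
  obtains \<gamma> where "gauge \<gamma>"
    "\<And>p. p tagged_division_of {0..1} \<Longrightarrow> \<gamma> fine p \<Longrightarrow>
       norm (curve_sum g f p - (\<Psi> 1 - \<Psi> 0)) \<le> m 1 - m 0"
proof -
  obtain d where d: "\<And>t. t \<in> {0..1} \<Longrightarrow> d t > 0"
    "\<And>t u s. t \<in> {0..1} \<Longrightarrow> 0 \<le> u \<Longrightarrow> u \<le> t \<Longrightarrow> t \<le> s \<Longrightarrow> s \<le> 1 \<Longrightarrow> s - u < d t \<Longrightarrow>
       norm (\<Psi> s - \<Psi> u - (g s - g u) *\<^sub>C f t) \<le> m s - m u"
    using st unfolding straddle_def by metis
  \<comment> \<open>Half of \<open>d t\<close>: both ends of a fine interval lie in the ball, so its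
    length stays below \<open>d t\<close>. The radius outside \<open>{0..1}\<close> is arbitrary, a
    gauge being defined everywhere.\<close>
  define \<gamma> where "\<gamma> t = ball t (if t \<in> {0..1} then d t / 2 else 1)" for t :: real
  show thesis
  proof (rule that[of \<gamma>])
    show "gauge \<gamma>"
      using d(1) by (auto simp: gauge_def \<gamma>_def)
    fix p :: "(real \<times> real set) set"
    assume p: "p tagged_division_of {0..1}" and fine: "\<gamma> fine p"
    have 1: "norm (case x of (t, k) \<Rightarrow> (g (Sup k) - g (Inf k)) *\<^sub>C f t - (\<Psi> (Sup k) - \<Psi> (Inf k)))
        \<le> (case x of (t, k) \<Rightarrow> m (Sup k) - m (Inf k))" if x: "x \<in> p" for x
    proof -
      obtain t k where tk: "x = (t, k)" by fastforce
      with x p have t: "t \<in> k" and k: "k \<subseteq> {0..1}" "\<exists>a b. k = cbox a b"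
        by (meson tagged_division_ofD)+
      then obtain u s where us: "k = {u..s}" by auto
      have "k \<subseteq> \<gamma> t" using fine x tk by (auto simp: fine_def)
      moreover have us': "u \<le> t" "t \<le> s" "0 \<le> u" "s \<le> 1" "t \<in> {0..1}" using us t k by auto
      ultimately have "u \<in> \<gamma> t" "s \<in> \<gamma> t" using us by auto
      then have "s - u < d t"
        using us' by (simp add: \<gamma>_def dist_real_def)
      then have "norm (\<Psi> s - \<Psi> u - (g s - g u) *\<^sub>C f t) \<le> m s - m u"
        using d(2)[of t u s] us' by auto
      then show ?thesis
        using us' by (simp add: tk us norm_minus_commute)
    qed
    have "curve_sum g f p - (\<Psi> 1 - \<Psi> 0) = curve_sum g f p - (\<Sum>(t, k)\<in>p. \<Psi> (Sup k) - \<Psi> (Inf k))"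
      using additive_tagged_division_1[OF _ p, of \<Psi>] by simp
    also have "\<dots> = (\<Sum>(t, k)\<in>p. (g (Sup k) - g (Inf k)) *\<^sub>C f t - (\<Psi> (Sup k) - \<Psi> (Inf k)))"
      by (simp add: curve_sum_def sum_subtractf split_def)
    finally have "norm (curve_sum g f p - (\<Psi> 1 - \<Psi> 0)) \<le> (\<Sum>(t, k)\<in>p. m (Sup k) - m (Inf k))"
      using sum_norm_le[of p, OF 1] by (simp add: split_def)
    then show "norm (curve_sum g f p - (\<Psi> 1 - \<Psi> 0)) \<le> m 1 - m 0"
      using additive_tagged_division_1[OF _ p, of m] by simp
  qed
qed

text \<open>The integral and the increment of \<open>\<Psi>\<close> are compared through the Riemann
  sum of one tagged division that is fine for both gauges. With \<open>\<Psi>\<close> zero this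
  becomes the norm bound for integrals.\<close>

lemma has_curve_integral_straddle:
  assumes I: "has_curve_integral F I g" and st: "straddle g (\<lambda>t. F (g t)) 0 1 \<Psi> m"
  shows "norm (I - (\<Psi> 1 - \<Psi> 0)) \<le> m 1 - m 0"
proof (rule field_le_epsilon)
  fix e :: real assume "e > 0"
  then obtain \<gamma>1 where 1: "gauge \<gamma>1" "\<And>p. p tagged_division_of {0..1} \<Longrightarrow> \<gamma>1 fine p \<Longrightarrow>
      norm (curve_sum g (\<lambda>t. F (g t)) p - I) < e"
    using I unfolding has_curve_integral_alt by meson
  obtain \<gamma>2 where 2: "gauge \<gamma>2" "\<And>p. p tagged_division_of {0..1} \<Longrightarrow> \<gamma>2 fine p \<Longrightarrow>
      norm (curve_sum g (\<lambda>t. F (g t)) p - (\<Psi> 1 - \<Psi> 0)) \<le> m 1 - m 0"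
    using straddle_curve_sum[OF st] by blast
  obtain p where p: "p tagged_division_of {0..1::real}" "(\<lambda>x. \<gamma>1 x \<inter> \<gamma>2 x) fine p"
    using fine_division_exists_real[OF gauge_Int[OF 1(1) 2(1)]] by metis
  then show "norm (I - (\<Psi> 1 - \<Psi> 0)) \<le> m 1 - m 0 + e"
    using 1(2)[of p] 2(2)[of p]
      norm_triangle_ineq4[of "curve_sum g (\<lambda>t. F (g t)) p - (\<Psi> 1 - \<Psi> 0)" "curve_sum g (\<lambda>t. F (g t)) p - I"]
    by (simp add: fine_Int algebra_simps)
qed

lemma has_curve_integral_unique:
  assumes I: "has_curve_integral F I g" and J: "has_curve_integral F J g"
  shows "I = J"
proof -
  have "norm (I - J) \<le> e" if "e > 0" for e
  proof -
    obtain \<gamma>1 where 1: "gauge \<gamma>1" "\<And>p. p tagged_division_of {0..1} \<Longrightarrow> \<gamma>1 fine p \<Longrightarrow>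
        norm (curve_sum g (\<lambda>t. F (g t)) p - I) < e / 2"
      using I \<open>e > 0\<close> unfolding has_curve_integral_alt by (meson half_gt_zero)
    obtain \<gamma>2 where 2: "gauge \<gamma>2" "\<And>p. p tagged_division_of {0..1} \<Longrightarrow> \<gamma>2 fine p \<Longrightarrow>
        norm (curve_sum g (\<lambda>t. F (g t)) p - J) < e / 2"
      using J \<open>e > 0\<close> unfolding has_curve_integral_alt by (meson half_gt_zero)
    obtain p where p: "p tagged_division_of {0..1::real}" "(\<lambda>x. \<gamma>1 x \<inter> \<gamma>2 x) fine p"
      using fine_division_exists_real[OF gauge_Int[OF 1(1) 2(1)]] by metis
    then show "norm (I - J) \<le> e"
      using 1(2)[of p] 2(2)[of p]
        norm_triangle_ineq4[of "curve_sum g (\<lambda>t. F (g t)) p - J" "curve_sum g (\<lambda>t. F (g t)) p - I"]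
      by (simp add: fine_Int algebra_simps)
  qed
  then show ?thesis
    using dense_le[of 0 "norm (I - J)"] by (metis eq_iff_diff_eq_0 field_le_epsilon norm_le_zero_iff add_0)
qed

lemma curve_integral_eq: "has_curve_integral F I g \<Longrightarrow> curve_integral g F = I"
  unfolding curve_integral_def by (rule the_equality) (auto intro: has_curve_integral_unique)

text \<open>The increments of primitives with errors \<open>1/(n+1)\<close> approximate the same
  Riemann sum on a common fine division. They therefore form a Cauchy sequence, and completeness
  provides the integral as its limit.\<close>

lemma has_curve_integral_exists:
  fixes F :: "complex \<Rightarrow> 'b::{complex_normed_vector, banach}"
  assumes "\<And>e. e > 0 \<Longrightarrow> \<exists>\<Psi> m. straddle g (\<lambda>t. F (g t)) 0 1 \<Psi> m \<and> m 1 - m 0 \<le> e"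
  shows "\<exists>I. has_curve_integral F I g"
proof -
  have "\<forall>n. \<exists>\<Psi> m. straddle g (\<lambda>t. F (g t)) 0 1 \<Psi> m \<and> m 1 - m 0 \<le> inverse (real (Suc n))"
    using assms by simp
  then obtain \<Psi> m where st: "\<And>n. straddle g (\<lambda>t. F (g t)) 0 1 (\<Psi> n) (m n)"
    and m: "\<And>n. m n 1 - m n 0 \<le> inverse (real (Suc n))"
    by metis
  define J where "J n = \<Psi> n 1 - \<Psi> n 0" for n
  have "\<exists>\<gamma>. \<forall>n. gauge (\<gamma> n) \<and> (\<forall>p. p tagged_division_of {0..1} \<longrightarrow> \<gamma> n fine p \<longrightarrow>
       norm (curve_sum g (\<lambda>t. F (g t)) p - J n) \<le> inverse (real (Suc n)))"
    using straddle_curve_sum[OF st] m unfolding J_def by (intro choice allI) (metis order_trans)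
  then obtain \<gamma> where \<gamma>: "\<And>n. gauge (\<gamma> n)" "\<And>n p. p tagged_division_of {0..1} \<Longrightarrow> \<gamma> n fine p \<Longrightarrow>
       norm (curve_sum g (\<lambda>t. F (g t)) p - J n) \<le> inverse (real (Suc n))"
    by blast
  have J: "norm (J n - J k) \<le> inverse (real (Suc n)) + inverse (real (Suc k))" for n k
  proof -
    obtain p where p: "p tagged_division_of {0..1::real}" "(\<lambda>x. \<gamma> n x \<inter> \<gamma> k x) fine p"
      using fine_division_exists_real[OF gauge_Int[OF \<gamma>(1) \<gamma>(1)]] by metis
    then show ?thesis
      using \<gamma>(2)[of p n] \<gamma>(2)[of p k]
        norm_triangle_ineq4[of "curve_sum g (\<lambda>t. F (g t)) p - J k" "curve_sum g (\<lambda>t. F (g t)) p - J n"]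
      by (simp add: fine_Int algebra_simps)
  qed
  have inv0: "(\<lambda>n. inverse (real (Suc n))) \<longlonglongrightarrow> 0"
    by (rule LIMSEQ_inverse_real_of_nat)
  have "Cauchy J"
  proof (rule metric_CauchyI)
    fix e :: real assume "e > 0"
    then obtain N where N: "\<And>n. n \<ge> N \<Longrightarrow> inverse (real (Suc n)) < e / 2"
      using order_tendstoD(2)[OF inv0, of "e/2"] by (auto simp: eventually_sequentially)
    show "\<exists>M. \<forall>m\<ge>M. \<forall>n\<ge>M. dist (J m) (J n) < e"
    proof (intro exI[of _ N] allI impI)
      fix m n assume "m \<ge> N" "n \<ge> N"
      then show "dist (J m) (J n) < e"
        using J[of m n] N[of m] N[of n] by (simp add: dist_norm)
    qed
  qed
  then obtain I where I: "J \<longlonglongrightarrow> I"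
    using Cauchy_convergent convergent_def by blast
  have "has_curve_integral F I g"
    unfolding has_curve_integral_alt
  proof (intro allI impI)
    fix e :: real assume "e > 0"
    have "\<forall>\<^sub>F n in sequentially. inverse (real (Suc n)) < e / 2" "\<forall>\<^sub>F n in sequentially. dist (J n) I < e / 2"
      using order_tendstoD(2)[OF inv0, of "e/2"] tendstoD[OF I, of "e/2"] \<open>e > 0\<close> by simp_all
    then have "\<forall>\<^sub>F n in sequentially. inverse (real (Suc n)) < e / 2 \<and> dist (J n) I < e / 2"
      by eventually_elim simp
    then obtain n where n: "inverse (real (Suc n)) < e / 2" "norm (J n - I) < e / 2"
      unfolding eventually_sequentially dist_norm by blast
    show "\<exists>\<gamma>. gauge \<gamma> \<and> (\<forall>p. p tagged_division_of {0..1} \<and> \<gamma> fine p \<longrightarrow>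
        norm (curve_sum g (\<lambda>t. F (g t)) p - I) < e)"
    proof (intro exI[of _ "\<gamma> n"] conjI allI impI \<gamma>(1))
      fix p :: "(real \<times> real set) set"
      assume "p tagged_division_of {0..1} \<and> \<gamma> n fine p"
      then show "norm (curve_sum g (\<lambda>t. F (g t)) p - I) < e"
        using \<gamma>(2)[of p n] n norm_triangle_ineq[of "curve_sum g (\<lambda>t. F (g t)) p - J n" "J n - I"] by simp
    qed
  qed
  then show ?thesis ..
qed

lemma straddle_join:
  assumes 1: "straddle g f a b \<Psi>1 m1" and 2: "straddle g f b c \<Psi>2 m2" and "a \<le> b" "b \<le> c"
  shows "straddle g f a c (\<lambda>s. if s \<le> b then \<Psi>1 s else \<Psi>2 s - \<Psi>2 b + \<Psi>1 b)
           (\<lambda>s. if s \<le> b then m1 s else m2 s - m2 b + m1 b)"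
  unfolding straddle_def
proof
  let ?\<Psi> = "\<lambda>s. if s \<le> b then \<Psi>1 s else \<Psi>2 s - \<Psi>2 b + \<Psi>1 b"
  let ?m = "\<lambda>s. if s \<le> b then m1 s else m2 s - m2 b + m1 b"
  fix t assume t: "t \<in> {a..c}"
  have R: "?\<Psi> s - ?\<Psi> u = \<Psi>2 s - \<Psi>2 u" "?m s - ?m u = m2 s - m2 u" if "b \<le> u" "u \<le> s" for u s
  proof -
    have "s = b \<and> u = b" if "s \<le> b" using that \<open>b \<le> u\<close> \<open>u \<le> s\<close> by linarith
    moreover have "u = b" if "u \<le> b" using that \<open>b \<le> u\<close> by linarith
    ultimately show "?\<Psi> s - ?\<Psi> u = \<Psi>2 s - \<Psi>2 u" "?m s - ?m u = m2 s - m2 u"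
      by (cases "s \<le> b"; cases "u \<le> b"; simp)+
  qed
  have L: "?\<Psi> s - ?\<Psi> u = \<Psi>1 s - \<Psi>1 u" "?m s - ?m u = m1 s - m1 u" if "s \<le> b" "u \<le> s" for u s
    using that by auto
  consider "t < b" | "t = b" | "b < t" by linarith
  then show "\<exists>d>0. \<forall>u s. a \<le> u \<and> u \<le> t \<and> t \<le> s \<and> s \<le> c \<and> s - u < d \<longrightarrow>
       norm (?\<Psi> s - ?\<Psi> u - (g s - g u) *\<^sub>C f t) \<le> ?m s - ?m u"
  proof cases
    case 1
    then obtain d where d: "d > 0" "\<And>u s. a \<le> u \<Longrightarrow> u \<le> t \<Longrightarrow> t \<le> s \<Longrightarrow> s \<le> b \<Longrightarrow> s - u < d \<Longrightarrow>
        norm (\<Psi>1 s - \<Psi>1 u - (g s - g u) *\<^sub>C f t) \<le> m1 s - m1 u"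
      using t assms(1) unfolding straddle_def by (meson atLeastAtMost_iff less_imp_le)
    show ?thesis
    proof (intro exI[of _ "min d (b - t)"] conjI allI impI)
      show "min d (b - t) > 0" using d 1 by simp
      fix u s assume *: "a \<le> u \<and> u \<le> t \<and> t \<le> s \<and> s \<le> c \<and> s - u < min d (b - t)"
      then have "s \<le> b" "u \<le> s" by auto
      from L[OF this] show "norm (?\<Psi> s - ?\<Psi> u - (g s - g u) *\<^sub>C f t) \<le> ?m s - ?m u"
        using d(2)[of u s] * \<open>s \<le> b\<close> by simp
    qed
  next
    case 3
    then obtain d where d: "d > 0" "\<And>u s. b \<le> u \<Longrightarrow> u \<le> t \<Longrightarrow> t \<le> s \<Longrightarrow> s \<le> c \<Longrightarrow> s - u < d \<Longrightarrow>
        norm (\<Psi>2 s - \<Psi>2 u - (g s - g u) *\<^sub>C f t) \<le> m2 s - m2 u"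
      using t assms(2) unfolding straddle_def by (meson atLeastAtMost_iff less_imp_le)
    show ?thesis
    proof (intro exI[of _ "min d (t - b)"] conjI allI impI)
      show "min d (t - b) > 0" using d 3 by simp
      fix u s assume *: "a \<le> u \<and> u \<le> t \<and> t \<le> s \<and> s \<le> c \<and> s - u < min d (t - b)"
      then have "b \<le> u" "u \<le> s" by auto
      from R[OF this] show "norm (?\<Psi> s - ?\<Psi> u - (g s - g u) *\<^sub>C f t) \<le> ?m s - ?m u"
        using d(2)[of u s] * \<open>b \<le> u\<close> by simp
    qed
  next
    case 2
    then obtain d1 where d1: "d1 > 0" "\<And>u s. a \<le> u \<Longrightarrow> u \<le> t \<Longrightarrow> t \<le> s \<Longrightarrow> s \<le> b \<Longrightarrow> s - u < d1 \<Longrightarrow>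
        norm (\<Psi>1 s - \<Psi>1 u - (g s - g u) *\<^sub>C f t) \<le> m1 s - m1 u"
      using assms(1,3) unfolding straddle_def by (meson atLeastAtMost_iff order_refl)
    from 2 obtain d2 where d2: "d2 > 0" "\<And>u s. b \<le> u \<Longrightarrow> u \<le> t \<Longrightarrow> t \<le> s \<Longrightarrow> s \<le> c \<Longrightarrow> s - u < d2 \<Longrightarrow>
        norm (\<Psi>2 s - \<Psi>2 u - (g s - g u) *\<^sub>C f t) \<le> m2 s - m2 u"
      using assms(2,4) unfolding straddle_def by (meson atLeastAtMost_iff order_refl)
    show ?thesis
    proof (intro exI[of _ "min d1 d2"] conjI allI impI)
      show "min d1 d2 > 0" using d1 d2 by simp
      fix u s assume *: "a \<le> u \<and> u \<le> t \<and> t \<le> s \<and> s \<le> c \<and> s - u < min d1 d2"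
      then have us: "u \<le> b" "b \<le> s" using 2 by auto
      \<comment> \<open>An interval across the joint has \<open>b\<close> itself as its tag. Split
        at \<open>b\<close>, both halves still contain the tag, and the two errors add up.\<close>
      have "norm ((\<Psi>1 b - \<Psi>1 u - (g b - g u) *\<^sub>C f t) + (\<Psi>2 s - \<Psi>2 b - (g s - g b) *\<^sub>C f t))
          \<le> (m1 b - m1 u) + (m2 s - m2 b)"
        using * 2 us by (intro norm_triangle_le add_mono d1(2) d2(2)) auto
      also have "(\<Psi>1 b - \<Psi>1 u - (g b - g u) *\<^sub>C f t) + (\<Psi>2 s - \<Psi>2 b - (g s - g b) *\<^sub>C f t)
          = (\<Psi>2 s - \<Psi>2 b + \<Psi>1 b) - \<Psi>1 u - (g s - g u) *\<^sub>C f t"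
        by (simp add: scaleC_diff_left)
      finally show "norm (?\<Psi> s - ?\<Psi> u - (g s - g u) *\<^sub>C f t) \<le> ?m s - ?m u"
        using us by (auto simp: not_less not_le)
    qed
  qed
qed

text \<open>Near a point \<open>x\<close> the function \<open>f\<close> is within \<open>e\<close>
  of the constant \<open>f x\<close>, which has the exact primitive
  \<open>g s *\<^sub>C f x\<close>. Joining makes the existence of such a primitive additive in the
  interval, so bisection makes it global. \<open>L\<close> will be the arc length.\<close>

lemma straddle_continuous:
  assumes cont: "continuous_on {a..b} f" and "a \<le> b" and "e > 0"
    and gL: "\<And>u s. a \<le> u \<Longrightarrow> u \<le> s \<Longrightarrow> s \<le> b \<Longrightarrow> cmod (g s - g u) \<le> L s - L u"
  shows "\<exists>\<Psi> m. straddle g f a b \<Psi> m \<and> m b - m a = e * (L b - L a)"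
proof -
  define P where "P x y \<longleftrightarrow> (a \<le> x \<longrightarrow> y \<le> b \<longrightarrow> (\<exists>\<Psi> m. straddle g f x y \<Psi> m \<and> m y - m x = e * (L y - L x)))" for x y
  have "P a b"
  proof (induction rule: Bolzano[OF \<open>a \<le> b\<close>])
    case (1 x y z)
    show ?case
      unfolding P_def
    proof (intro impI)
      assume "a \<le> x" "z \<le> b"
      have "y \<le> b" "a \<le> y" using 1(3,4) \<open>a \<le> x\<close> \<open>z \<le> b\<close> by linarith+
      with 1(1,2)[unfolded P_def] \<open>a \<le> x\<close> \<open>z \<le> b\<close> obtain \<Psi>1 m1 \<Psi>2 m2 where *: "straddle g f x y \<Psi>1 m1" "m1 y - m1 x = e * (L y - L x)"
        "straddle g f y z \<Psi>2 m2" "m2 z - m2 y = e * (L z - L y)"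
        by blast
      have "m2 z - m2 y + m1 y - m1 x = e * (L z - L x)"
        using *(2,4) by (simp add: algebra_simps)
      moreover have "z = y \<Longrightarrow> m1 y - m1 x = e * (L y - L x)"
        using *(2) by simp
      ultimately have "(if z \<le> y then m1 z else m2 z - m2 y + m1 y) - (if x \<le> y then m1 x else m2 x - m2 y + m1 y)
          = e * (L z - L x)"
        using 1(3,4) by auto
      with straddle_join[OF *(1,3) 1(3,4)]
      show "\<exists>\<Psi> m. straddle g f x z \<Psi> m \<and> m z - m x = e * (L z - L x)"
        by blast
    qed
  next
    case (2 x)
    then obtain d where d: "d > 0" "\<And>t. t \<in> {a..b} \<Longrightarrow> dist t x < d \<Longrightarrow> dist (f t) (f x) < e"
      using cont \<open>e > 0\<close> unfolding continuous_on_iff by (meson atLeastAtMost_iff)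
    show ?case
    proof (unfold P_def, intro exI[of _ d] conjI allI impI d(1))
      fix y z assume yz: "y \<le> x \<and> x \<le> z \<and> z - y < d" "a \<le> y" "z \<le> b"
      have "straddle g f y z (\<lambda>s. g s *\<^sub>C f x) (\<lambda>s. e * L s)"
        unfolding straddle_def
      proof (intro ballI exI[of _ 1] conjI allI impI)
        fix t u s assume t: "t \<in> {y..z}" and us: "y \<le> u \<and> u \<le> t \<and> t \<le> s \<and> s \<le> z \<and> s - u < 1"
        have "dist (f t) (f x) < e"
          using t yz by (intro d(2)) (auto simp: dist_real_def)
        then have "norm (f x - f t) \<le> e" by (simp add: dist_norm norm_minus_commute)
        moreover have "cmod (g s - g u) \<le> L s - L u" using us yz by (intro gL) auto
        moreover from this have "0 \<le> L s - L u" using norm_ge_zero order_trans by blast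
        ultimately have "cmod (g s - g u) * norm (f x - f t) \<le> (L s - L u) * e"
          by (intro mult_mono) auto
        moreover have "g s *\<^sub>C f x - g u *\<^sub>C f x - (g s - g u) *\<^sub>C f t = (g s - g u) *\<^sub>C (f x - f t)"
          by (simp add: scaleC_diff_left scaleC_diff_right)
        ultimately show "norm (g s *\<^sub>C f x - g u *\<^sub>C f x - (g s - g u) *\<^sub>C f t) \<le> e * L s - e * L u"
          by (simp add: norm_scaleC algebra_simps)
      qed simp
      then show "\<exists>\<Psi> m. straddle g f y z \<Psi> m \<and> m z - m y = e * (L z - L y)"
        by (intro exI conjI) (assumption, simp add: algebra_simps)
    qed
  qed
  then show ?thesis by (simp add: P_def)
qed

section \<open>Arc length along a rectifiable curve\<close>

lemma additive_division_1:
  fixes f :: "real \<Rightarrow> 'a::real_normed_vector"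
  assumes "a \<le> b" and d: "d division_of {a..b}"
  shows "(\<Sum>k\<in>d. f (Sup k) - f (Inf k)) = f b - f a"
proof -
  let ?p = "(\<lambda>k. (Inf k, k)) ` d"
  have k: "Inf k \<in> k" if "k \<in> d" for k
    using division_ofD(3,4)[OF d that] by fastforce
  have "?p tagged_division_of {a..b}"
  proof (rule tagged_division_ofI)
    show "finite ?p" using division_ofD(1)[OF d] by simp
    show "\<Union>{K. \<exists>x. (x, K) \<in> ?p} = {a..b}"
      using division_ofD(6)[OF d] by (simp add: image_iff)
    fix x K assume xK: "(x, K) \<in> ?p"
    then show "x \<in> K" "K \<subseteq> {a..b}" "\<exists>a b. K = cbox a b"
      using k division_ofD(2,4)[OF d] by blast+
    fix x' K' assume "(x', K') \<in> ?p" "(x, K) \<noteq> (x', K')"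
    with xK have "K \<in> d" "K' \<in> d" "K \<noteq> K'" by auto
    then show "interior K \<inter> interior K' = {}"
      by (rule division_ofD(5)[OF d])
  qed
  then have "(\<Sum>(x, k)\<in>?p. f (Sup k) - f (Inf k)) = f b - f a"
    by (rule additive_tagged_division_1[OF \<open>a \<le> b\<close>])
  then show ?thesis
    by (subst (asm) sum.reindex) (auto simp: inj_on_def)
qed

lemma curve_length_empty [simp]: "curve_length g {} = 0"
  by (simp add: curve_length_def)

text \<open>A division of \<open>{0..u}\<close> together with \<open>{u..s}\<close> divides
  \<open>{0..s}\<close>, and adding a constant commutes with a supremum over a nonempty set.\<close>

lemma curve_length_step:
  assumes "0 \<le> u" "u \<le> s"
  shows "curve_length g {0..u} + ennreal (dist (g u) (g s)) \<le> curve_length g {0..s}"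
proof (cases "u = s")
  case False
  have ne: "{d. d division_of {0..u}} \<noteq> {}"
    using division_of_self[of 0 u] assms by auto
  have "(\<Sum>k\<in>d. ennreal (dist (g (Inf k)) (g (Sup k)))) + ennreal (dist (g u) (g s)) \<le> curve_length g {0..s}"
    if d: "d division_of {0..u}" for d
  proof -
    have "{{u..s}} division_of {u..s}"
      using division_of_self[of u s] assms by simp
    then have "(d \<union> {{u..s}}) division_of {0..u} \<union> {u..s}"
      using d by (intro division_disjoint_union) auto
    moreover have "{0..u} \<union> {u..s} = {0..s}" using assms by auto
    ultimately have d': "insert {u..s} d division_of {0..s}" by simp
    have "{u..s} \<notin> d"
      using division_ofD(2)[OF d, of "{u..s}"] False assms by auto
    then have "(\<Sum>k\<in>d. ennreal (dist (g (Inf k)) (g (Sup k)))) + ennreal (dist (g u) (g s))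
        = (\<Sum>k\<in>insert {u..s} d. ennreal (dist (g (Inf k)) (g (Sup k))))"
      using division_ofD(1)[OF d] assms by (simp add: add.commute del: sum_ennreal)
    also have "\<dots> \<le> curve_length g {0..s}"
      unfolding curve_length_def using d' by (intro SUP_upper) simp
    finally show ?thesis .
  qed
  then have "(SUP d\<in>{d. d division_of {0..u}}. (\<Sum>k\<in>d. ennreal (dist (g (Inf k)) (g (Sup k)))) + ennreal (dist (g u) (g s)))
      \<le> curve_length g {0..s}"
    by (intro SUP_least) simp
  then show ?thesis
    unfolding curve_length_def[of g "{0..u}"] ennreal_SUP_add_left[OF ne] .
qed simp

locale rectifiable_path =
  fixes g :: "real \<Rightarrow> complex"
  assumes cont: "continuous_on {0..1} g" and finite_length: "curve_length g {0..1} < \<infinity>"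
begin

text \<open>The distribution function inside \<open>arclength_measure\<close>. It vanishes left of
  the parameter interval, where \<open>{0..t}\<close> is empty, and the truncation makes it constant
  right of \<open>1\<close>.\<close>

definition len :: "real \<Rightarrow> real" where
  "len t = enn2real (curve_length g {0..min t 1})"

lemma curve_length_len: "t \<le> 1 \<Longrightarrow> curve_length g {0..t} = ennreal (len t)"
proof (cases "0 \<le> t")
  case True
  assume "t \<le> 1"
  have "curve_length g {0..t} \<le> curve_length g {0..t} + ennreal (dist (g t) (g 1))"
    by simp
  also have "\<dots> \<le> curve_length g {0..1}"
    by (rule curve_length_step[OF True \<open>t \<le> 1\<close>])
  finally have "curve_length g {0..t} < \<infinity>"
    using finite_length by (rule le_less_trans)
  then show ?thesis
    using \<open>t \<le> 1\<close> by (simp add: len_def min_def)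
qed (simp add: len_def)

lemma len_nonneg: "0 \<le> len t"
  by (simp add: len_def)

lemma len_step:
  assumes "0 \<le> u" "u \<le> s" "s \<le> 1"
  shows "cmod (g s - g u) \<le> len s - len u"
proof -
  have "ennreal (len u + cmod (g s - g u)) \<le> ennreal (len s)"
    using curve_length_step[OF assms(1,2), of g] assms
    by (subst ennreal_plus) (simp_all add: curve_length_len len_nonneg dist_norm norm_minus_commute)
  then show ?thesis
    by (subst (asm) ennreal_le_iff) (simp_all add: len_nonneg)
qed

lemma len_mono: "u \<le> s \<Longrightarrow> len u \<le> len s"
proof -
  assume "u \<le> s"
  have 1: "len u = 0" if "u < 0" for u using that by (simp add: len_def)
  have 2: "len u = len 1" if "u \<ge> 1" for u using that by (simp add: len_def)
  have 3: "len u \<le> len s" if "0 \<le> u" "u \<le> s" "s \<le> 1" for u s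
    using len_step[OF that] norm_ge_zero[of "g s - g u"] by linarith
  show ?thesis
    using 1[of u] 2[of u] 2[of s] 3[of u s] 3[of u 1] \<open>u \<le> s\<close> len_nonneg[of s] by linarith
qed

lemma len_division:
  assumes "e > 0"
  obtains d where "d division_of {0..1}" "(\<Sum>k\<in>d. cmod (g (Sup k) - g (Inf k))) > len 1 - e"
proof (cases "len 1 < e")
  \<comment> \<open>A negative bound cannot be expressed in \<open>ennreal\<close>, so the trivial
    division serves the case of negative \<open>len 1 - e\<close>.\<close>
  case True
  have "{{0..1::real}} division_of {0..1}"
    using division_of_self[of 0 "1::real"] by simp
  then show thesis
    by (rule that) (use True norm_ge_zero[of "g 1 - g 0"] in \<open>simp, linarith\<close>)
next
  case False
  then have "ennreal (len 1 - e) < curve_length g {0..1}"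
    using \<open>e > 0\<close> by (simp add: curve_length_len ennreal_less_iff)
  then obtain d where d: "d division_of {0..1}"
    "ennreal (len 1 - e) < (\<Sum>k\<in>d. ennreal (dist (g (Inf k)) (g (Sup k))))"
    unfolding curve_length_def less_SUP_iff by blast
  have "(\<Sum>k\<in>d. ennreal (dist (g (Inf k)) (g (Sup k)))) = ennreal (\<Sum>k\<in>d. cmod (g (Sup k) - g (Inf k)))"
    by (subst sum_ennreal) (simp_all add: dist_norm norm_minus_commute)
  with d(2) False have "len 1 - e < (\<Sum>k\<in>d. cmod (g (Sup k) - g (Inf k)))"
    by (simp add: ennreal_less_iff)
  with d(1) show thesis by (rule that)
qed

text \<open>A division that almost attains the length loses little on each of its intervals.\<close>

lemma len_diff_le:
  assumes "e > 0"
  obtains d where "d division_of {0..1}"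
    "\<And>k u s. k \<in> d \<Longrightarrow> u \<in> k \<Longrightarrow> s \<in> k \<Longrightarrow> u \<le> s \<Longrightarrow> len s - len u \<le> cmod (g s - g u) + e"
proof -
  obtain d where d: "d division_of {0..1}" "(\<Sum>k\<in>d. cmod (g (Sup k) - g (Inf k))) > len 1 - e"
    using len_division[OF assms] by blast
  show thesis
  proof (rule that[OF d(1)])
    fix k u s assume k: "k \<in> d" and us: "u \<in> k" "s \<in> k" "u \<le> s"
    obtain a b where ab: "k = {a..b}" using division_ofD(4)[OF d(1) k] by auto
    have pos: "0 \<le> len (Sup k') - len (Inf k') - cmod (g (Sup k') - g (Inf k'))" if k': "k' \<in> d" for k'
    proof -
      obtain a b where ab: "k' = {a..b}" using division_ofD(4)[OF d(1) k'] by auto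
      then have "a \<le> b" "0 \<le> a" "b \<le> 1" using division_ofD(2,3)[OF d(1) k'] by auto
      then show ?thesis using len_step[of a b] by (simp add: ab)
    qed
    \<comment> \<open>The excesses of arc over chord are all nonnegative and their sum is at most
      \<open>e\<close>, hence so is each of them.\<close>
    have "len (Sup k) - len (Inf k) - cmod (g (Sup k) - g (Inf k))
        \<le> (\<Sum>k\<in>d. len (Sup k) - len (Inf k) - cmod (g (Sup k) - g (Inf k)))"
      by (rule member_le_sum[OF k _ division_ofD(1)[OF d(1)]]) (use pos in auto)
    also have "\<dots> = len 1 - len 0 - (\<Sum>k\<in>d. cmod (g (Sup k) - g (Inf k)))"
      using additive_division_1[OF _ d(1), of len] by (simp add: sum_subtractf)
    also have "\<dots> \<le> e" using d(2) len_nonneg[of 0] by simp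
    finally have 1: "len b - len a \<le> cmod (g b - g a) + e"
      using us by (simp add: ab)
    have "0 \<le> a" "b \<le> 1" using division_ofD(2)[OF d(1) k] us by (auto simp: ab)
    \<comment> \<open>To pass from \<open>k\<close> to its part between \<open>u\<close> and
      \<open>s\<close>: the arcs cut off at both ends are at least as long as their chords.\<close>
    then have "cmod (g u - g a) \<le> len u - len a" "cmod (g b - g s) \<le> len b - len s"
      using us ab by (auto intro: len_step)
    moreover have "cmod (g b - g a) \<le> cmod (g u - g a) + cmod (g s - g u) + cmod (g b - g s)"
      using norm_triangle_ineq[of "g u - g a + (g s - g u)" "g b - g s"]
        norm_triangle_ineq[of "g u - g a" "g s - g u"] by simp
    ultimately show "len s - len u \<le> cmod (g s - g u) + e" using 1 by linarith
  qed
qed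

text \<open>On an interval of a nearly extremal division the arc exceeds the chord by at most
  \<open>e/2\<close>, and near \<open>t\<close> the chord is shorter than \<open>e/2\<close> by
  continuity of \<open>g\<close>. What remains is to find a division interval that contains a right
  neighbourhood of \<open>t\<close>.\<close>

lemma len_continuous_right:
  assumes "0 \<le> t" "t < 1" "e > 0"
  shows "\<exists>r>t. \<forall>s. t \<le> s \<and> s < r \<longrightarrow> len s - len t < e"
proof -
  have "e / 2 > 0" using assms by simp
  then obtain d where d: "d division_of {0..1}"
    "\<And>k u s. k \<in> d \<Longrightarrow> u \<in> k \<Longrightarrow> s \<in> k \<Longrightarrow> u \<le> s \<Longrightarrow> len s - len u \<le> cmod (g s - g u) + e/2"
    using len_diff_le by blast
  \<comment> \<open>\<open>r\<close> is the first division point after \<open>t\<close>. The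
    interval through the midpoint of \<open>t\<close> and \<open>r\<close> has no end strictly
    between them, so it contains everything from \<open>t\<close> to \<open>r\<close>. The element
    \<open>1\<close> keeps \<open>A\<close> nonempty and \<open>r\<close> inside the parameter
    interval.\<close>
  define A where "A = insert 1 {x \<in> Inf ` d \<union> Sup ` d. x > t}"
  have A: "finite A" "A \<noteq> {}" "\<And>x. x \<in> A \<Longrightarrow> t < x"
    using division_ofD(1)[OF d(1)] assms by (auto simp: A_def)
  have A1: "1 \<in> A" by (simp add: A_def)
  define r where "r = Min A"
  have r: "t < r" "r \<le> 1" "\<And>x. x \<in> A \<Longrightarrow> r \<le> x"
    using A(3)[OF Min_in[OF A(1,2)]] Min_le[OF A(1)] by (simp_all add: r_def A1)
  have "(t + r) / 2 \<in> {0..1}" using r(1,2) assms by auto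
  then obtain k where k: "k \<in> d" "(t + r) / 2 \<in> k"
    using division_ofD(6)[OF d(1)] by blast
  then obtain a b where ab: "k = {a..b}" using division_ofD(4)[OF d(1) k(1)] by auto
  have "a \<in> Inf ` d" "b \<in> Sup ` d" using k ab by force+
  then have "t < a \<Longrightarrow> a \<in> A" "t < b \<Longrightarrow> b \<in> A"
    by (simp_all add: A_def)
  then have "t < a \<Longrightarrow> r \<le> a" "t < b \<Longrightarrow> r \<le> b"
    using r(3) by blast+
  moreover have "a < r" "t < b" using k(2) r(1) by (auto simp: ab)
  ultimately have "a \<le> t" "r \<le> b" by linarith+
  then have kk: "t \<in> k" "\<And>s. t \<le> s \<Longrightarrow> s < r \<Longrightarrow> s \<in> k" using r(1,2) ab by auto
  obtain q where q: "q > 0" "\<And>s. s \<in> {0..1} \<Longrightarrow> dist s t < q \<Longrightarrow> dist (g s) (g t) < e/2"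
    using cont[unfolded continuous_on_iff, rule_format, of t "e/2"] assms by auto
  show ?thesis
  proof (intro exI[of _ "min r (t + q)"] conjI allI impI)
    show "t < min r (t + q)" using r(1,2) q(1) by simp
    fix s assume s: "t \<le> s \<and> s < min r (t + q)"
    then have "cmod (g s - g t) < e / 2"
      using q(2)[of s] r(1,2) assms by (auto simp: dist_norm)
    then show "len s - len t < e" using d(2)[OF k(1) kk(1) kk(2), of s] s by auto
  qed
qed

text \<open>Mirror image of \<open>len_continuous_right\<close>: \<open>r\<close> is now the last
  division point before \<open>t\<close>.\<close>

lemma len_continuous_left:
  assumes "0 < t" "t \<le> 1" "e > 0"
  shows "\<exists>r<t. \<forall>s. r < s \<and> s \<le> t \<longrightarrow> len t - len s < e"
proof -
  have "e / 2 > 0" using assms by simp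
  then obtain d where d: "d division_of {0..1}"
    "\<And>k u s. k \<in> d \<Longrightarrow> u \<in> k \<Longrightarrow> s \<in> k \<Longrightarrow> u \<le> s \<Longrightarrow> len s - len u \<le> cmod (g s - g u) + e/2"
    using len_diff_le by blast
  define A where "A = insert 0 {x \<in> Inf ` d \<union> Sup ` d. x < t}"
  have A: "finite A" "A \<noteq> {}" "\<And>x. x \<in> A \<Longrightarrow> x < t"
    using division_ofD(1)[OF d(1)] assms by (auto simp: A_def)
  have A1: "0 \<in> A" by (simp add: A_def)
  define r where "r = Max A"
  have r: "r < t" "0 \<le> r" "\<And>x. x \<in> A \<Longrightarrow> x \<le> r"
    using A(3)[OF Max_in[OF A(1,2)]] Max_ge[OF A(1)] by (simp_all add: r_def A1)
  have "(t + r) / 2 \<in> {0..1}" using r(1,2) assms by auto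
  then obtain k where k: "k \<in> d" "(t + r) / 2 \<in> k"
    using division_ofD(6)[OF d(1)] by blast
  then obtain a b where ab: "k = {a..b}" using division_ofD(4)[OF d(1) k(1)] by auto
  have "a \<in> Inf ` d" "b \<in> Sup ` d" using k ab by force+
  then have "a < t \<Longrightarrow> a \<in> A" "b < t \<Longrightarrow> b \<in> A"
    by (simp_all add: A_def)
  then have "a < t \<Longrightarrow> a \<le> r" "b < t \<Longrightarrow> b \<le> r"
    using r(3) by blast+
  moreover have "a < t" "r < b" using k(2) r(1) by (auto simp: ab)
  ultimately have "a \<le> r" "t \<le> b" by linarith+
  then have kk: "t \<in> k" "\<And>s. s \<le> t \<Longrightarrow> r < s \<Longrightarrow> s \<in> k" using r(1,2) ab by auto
  obtain q where q: "q > 0" "\<And>s. s \<in> {0..1} \<Longrightarrow> dist s t < q \<Longrightarrow> dist (g s) (g t) < e/2"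
    using cont[unfolded continuous_on_iff, rule_format, of t "e/2"] assms by auto
  show ?thesis
  proof (intro exI[of _ "max r (t - q)"] conjI allI impI)
    show "max r (t - q) < t" using r(1,2) q(1) by simp
    fix s assume s: "max r (t - q) < s \<and> s \<le> t"
    then have "cmod (g t - g s) < e / 2"
      using q(2)[of s] r(1,2) assms by (auto simp: dist_norm norm_minus_commute)
    then show "len t - len s < e" using d(2)[OF k(1) kk(2) kk(1), of s] s by auto
  qed
qed

lemma len_nonpos: "t \<le> 0 \<Longrightarrow> len t = len 0"
proof -
  have "len 0 \<le> 0"
  proof -
    have "(\<Sum>k\<in>d. ennreal (dist (g (Inf k)) (g (Sup k)))) = 0" if d: "d division_of {0..0::real}" for d
    proof (rule sum.neutral, rule ballI)
      fix k assume "k \<in> d"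
      then have "k = {0}" using division_ofD(2,3)[OF d] by auto
      then show "ennreal (dist (g (Inf k)) (g (Sup k))) = 0" by simp
    qed
    then have "curve_length g {0..0} \<le> 0"
      unfolding curve_length_def by (intro SUP_least) simp
    then show ?thesis by (simp add: len_def)
  qed
  then show "t \<le> 0 \<Longrightarrow> len t = len 0"
    using len_mono[of t 0] len_nonneg[of t] by linarith
qed

text \<open>Right continuity is the condition under which \<open>interval_measure\<close> assigns to
  \<open>{u<..s}\<close> the increment of \<open>len\<close>.\<close>

lemma isCont_len_right: "continuous (at_right t) len"
proof -
  have "\<exists>d>0. len (t + d) - len t < e" if e: "e > 0" for e
  proof -
    consider "t < 0" | "0 \<le> t" "t < 1" | "1 \<le> t" by linarith
    then show ?thesis
    proof cases
      case 1
      then show ?thesis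
        using len_nonpos[of t] e by (intro exI[of _ "- t"]) simp
    next
      case 2
      then obtain r where r: "r > t" "\<forall>s. t \<le> s \<and> s < r \<longrightarrow> len s - len t < e"
        using len_continuous_right[OF _ _ e, of t] by blast
      moreover have "t \<le> t + (r - t) / 2 \<and> t + (r - t) / 2 < r"
        using r(1) by (simp add: field_simps)
      ultimately show ?thesis
        using r(1) by (intro exI[of _ "(r - t) / 2"]) simp
    next
      case 3
      then show ?thesis
        using e by (intro exI[of _ 1]) (simp add: len_def)
    qed
  qed
  then show ?thesis
    using continuous_at_right_real_increasing[of len t] len_mono by blast
qed

lemma arclength_measure_len: "arclength_measure g = interval_measure len"
  by (simp add: arclength_measure_def len_def[abs_def])

lemma emeasure_arclength:
  "u \<le> s \<Longrightarrow> emeasure (arclength_measure g) {u<..s} = ennreal (len s - len u)"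
  unfolding arclength_measure_len
  using emeasure_interval_measure_Ioc[of u s len] len_mono isCont_len_right by blast

end

section \<open>Curve integrals of functions dominated by an integrable weight\<close>

lemma obtain_small_factor:
  fixes x y :: real
  assumes "0 \<le> x" "0 < y"
  obtains \<epsilon> where "\<epsilon> > 0" "\<epsilon> * x < y"
proof (rule that[of "y / (x + 1)"])
  show "y / (x + 1) > 0" "y / (x + 1) * x < y"
    using assms by (simp_all add: field_simps)
qed

locale weighted_path = rectifiable_path g for g +
  fixes w :: "real \<Rightarrow> real"
  assumes w_cont: "continuous_on {0<..<1} w" and w_nonneg: "\<And>t. 0 \<le> w t"
    and w_finite: "(\<integral>\<^sup>+t\<in>{0..1}. ennreal (w t) \<partial>arclength_measure g) < \<infinity>"
begin

text \<open>The end points are cut out of the density: continuity of \<open>w\<close>, from which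
  measurability is obtained, is known only inside, and the absence of an atom at \<open>1\<close>
  becomes immediate.\<close>

definition wmeasure :: "real measure" where
  "wmeasure = density (arclength_measure g) (\<lambda>t. ennreal (w t) * indicator {0<..<1} t)"

definition wint :: real where
  "wint = enn2real (\<integral>\<^sup>+t\<in>{0..1}. ennreal (w t) \<partial>arclength_measure g)"

lemma w_measurable: "(\<lambda>t. ennreal (w t) * indicator {0<..<1} t) \<in> borel_measurable (arclength_measure g)"
proof -
  have "(\<lambda>t. indicator {0<..<1} t *\<^sub>R w t) \<in> borel_measurable borel"
    using w_cont by (intro borel_measurable_continuous_on_indicator) auto
  then have "(\<lambda>t. ennreal (indicator {0<..<1} t *\<^sub>R w t)) \<in> borel_measurable borel"
    by measurable
  also have "(\<lambda>t. ennreal (indicator {0<..<1} t *\<^sub>R w t)) = (\<lambda>t. ennreal (w t) * indicator {0<..<1} t)"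
    by (auto simp: indicator_def)
  finally show ?thesis
    by (simp add: arclength_measure_len)
qed

lemma emeasure_wmeasure:
  assumes "A \<in> sets borel"
  shows "emeasure wmeasure A = (\<integral>\<^sup>+t. ennreal (w t) * indicator {0<..<1} t * indicator A t \<partial>arclength_measure g)"
  unfolding wmeasure_def
  by (rule emeasure_density[OF w_measurable]) (use assms in \<open>simp add: arclength_measure_len\<close>)

lemma emeasure_wmeasure_le:
  assumes "A \<in> sets borel"
  shows "emeasure wmeasure A \<le> ennreal wint"
proof -
  have "emeasure wmeasure A \<le> (\<integral>\<^sup>+t\<in>{0..1}. ennreal (w t) \<partial>arclength_measure g)"
    unfolding emeasure_wmeasure[OF assms] by (intro nn_integral_mono) (auto simp: indicator_def)
  also have "\<dots> = ennreal wint"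
    using w_finite by (simp add: wint_def)
  finally show ?thesis .
qed

sublocale W: finite_borel_measure wmeasure
proof (intro finite_borel_measure.intro finite_measureI finite_borel_measure_axioms.intro)
  have sp: "space wmeasure = UNIV" by (simp add: wmeasure_def arclength_measure_len)
  show "emeasure wmeasure (space wmeasure) \<noteq> \<infinity>"
    using emeasure_wmeasure_le[of UNIV] by (auto simp: sp top_unique)
  show "sets wmeasure = sets borel" by (simp add: wmeasure_def arclength_measure_len)
qed

text \<open>Weighted arc length; it forms the main part of the error function \<open>m\<close> in
  the estimates below.\<close>

definition cum :: "real \<Rightarrow> real" where "cum = cdf wmeasure"

lemma cum_mono: "u \<le> s \<Longrightarrow> cum u \<le> cum s"
  unfolding cum_def by (rule W.cdf_nondecreasing)

lemma cum_total: "cum 1 - cum 0 \<le> wint"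
proof -
  have "cum 1 - cum 0 = measure wmeasure {0<..1}"
    unfolding cum_def by (rule W.cdf_diff_eq) simp
  also have "\<dots> \<le> wint"
    unfolding measure_def by (rule enn2real_leI) (use emeasure_wmeasure_le in \<open>auto simp: wint_def\<close>)
  finally show ?thesis .
qed

lemma cum_right: "(cum \<longlongrightarrow> cum 0) (at_right 0)"
  using W.cdf_is_right_cont[of 0] by (simp add: cum_def continuous_within)

text \<open>A distribution function is left continuous wherever its measure has no atom.\<close>

lemma cum_left: "(cum \<longlongrightarrow> cum 1) (at_left 1)"
proof -
  have "emeasure wmeasure {1} = 0"
  proof (subst emeasure_wmeasure)
    have "(\<lambda>t. ennreal (w t) * indicator {0<..<1} t * indicator {1} t) = (\<lambda>_. 0)"
      by (auto simp: indicator_def)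
    then show "(\<integral>\<^sup>+t. ennreal (w t) * indicator {0<..<1} t * indicator {1} t \<partial>arclength_measure g) = 0"
      by simp
  qed simp
  moreover have insert_lessThan: "insert 1 {..<1} = {..1::real}" by auto
  ultimately have "cum 1 = measure wmeasure {..<1}"
    unfolding cum_def cdf_def
    using W.finite_measure_Union[of "{..<1}" "{1}"]
    by (simp add: measure_def W.sets_M insert_lessThan)
  then show ?thesis
    using W.cdf_at_left[of 1] by (simp add: cum_def)
qed

lemma cum_ge:
  assumes "0 < u" "u \<le> s" "s < 1" "\<And>t. u \<le> t \<Longrightarrow> t \<le> s \<Longrightarrow> b \<le> w t"
  shows "b * (len s - len u) \<le> cum s - cum u"
proof (cases "b \<le> 0 \<or> u = s")
  case True
  have "b * (len s - len u) \<le> 0"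
    using True len_mono[OF assms(2)] by (auto simp: mult_nonpos_nonneg)
  then show ?thesis using cum_mono[OF assms(2)] by linarith
next
  case False
  have "ennreal (b * (len s - len u)) = ennreal b * emeasure (arclength_measure g) {u<..s}"
    using False assms(2) len_mono[OF assms(2)] by (simp add: emeasure_arclength ennreal_mult)
  also have "\<dots> = (\<integral>\<^sup>+t. ennreal b * indicator {u<..s} t \<partial>arclength_measure g)"
    by (subst nn_integral_cmult_indicator) (simp_all add: arclength_measure_len)
  also have "\<dots> \<le> emeasure wmeasure {u<..s}"
    using assms by (subst emeasure_wmeasure) (auto simp: indicator_def intro!: nn_integral_mono ennreal_leI)
  also have "\<dots> = ennreal (cum s - cum u)"
    unfolding cum_def by (rule W.emeasure_Ioc[OF assms(2)])
  finally show ?thesis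
    using cum_mono[OF assms(2)] by simp
qed

lemma len_diff_nonneg: "u \<le> s \<Longrightarrow> 0 \<le> len s - len u"
  using len_mono by simp

text \<open>The zero function is an approximate primitive of anything dominated by the weight. Near
  an interior tag \<open>t\<close> continuity gives a lower bound \<open>w t - \<epsilon>\<close>
  for \<open>w\<close>, so \<open>w t\<close> times an increment of length is at most the increment
  of \<open>cum\<close> plus \<open>\<epsilon>\<close> times the length, and this loss is absorbed
  by \<open>\<eta>\<close>. At the parameters \<open>0\<close> and \<open>1\<close> no domination is
  assumed; the values there are paid for by \<open>Q\<close> times the length.\<close>

lemma straddle_weight:
  assumes ab: "0 \<le> a" "a \<le> b" "b \<le> 1" and C: "0 \<le> C" and "\<eta> > 0" "Q \<ge> 0"
    and f: "\<And>t. t \<in> {0<..<1} \<Longrightarrow> norm (f t) \<le> C * w t"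
    and Q: "\<And>t. t \<in> {a..b} \<inter> {0,1} \<Longrightarrow> norm (f t) \<le> Q"
  shows "straddle g f a b (\<lambda>_. 0) (\<lambda>t. C * cum t + (\<eta> + Q) * len t)"
  unfolding straddle_def
proof
  fix t assume t: "t \<in> {a..b}"
  show "\<exists>d>0. \<forall>u s. a \<le> u \<and> u \<le> t \<and> t \<le> s \<and> s \<le> b \<and> s - u < d \<longrightarrow>
      norm (0 - 0 - (g s - g u) *\<^sub>C f t)
        \<le> (C * cum s + (\<eta> + Q) * len s) - (C * cum u + (\<eta> + Q) * len u)"
  proof (cases "t = 0 \<or> t = 1")
    case True
    then have fQ: "norm (f t) \<le> Q" using Q t by auto
    show ?thesis
    proof (intro exI[of _ 1] conjI allI impI)
      fix u s assume us: "a \<le> u \<and> u \<le> t \<and> t \<le> s \<and> s \<le> b \<and> s - u < 1"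
      then have "cmod (g s - g u) * norm (f t) \<le> (len s - len u) * Q"
        using fQ ab len_diff_nonneg[of u s] by (intro mult_mono len_step) auto
      moreover have "0 \<le> C * (cum s - cum u)" "0 \<le> \<eta> * (len s - len u)"
        using us C \<open>\<eta> > 0\<close> cum_mono[of u s] len_mono[of u s] by auto
      ultimately show "norm (0 - 0 - (g s - g u) *\<^sub>C f t)
        \<le> (C * cum s + (\<eta> + Q) * len s) - (C * cum u + (\<eta> + Q) * len u)"
        by (simp add: norm_scaleC algebra_simps)
    qed simp
  next
    case False
    then have t01: "t \<in> {0<..<1}" using t ab by auto
      obtain \<epsilon> where "\<epsilon> > 0" "\<epsilon> * C < \<eta>"
      using obtain_small_factor[OF C \<open>\<eta> > 0\<close>] by blast
    then have \<epsilon>: "\<epsilon> > 0" "C * \<epsilon> \<le> \<eta>" by (simp_all add: mult.commute)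
    obtain d where d: "d > 0" "\<And>s. dist s t < d \<Longrightarrow> s \<in> {0<..<1} \<and> dist (w s) (w t) < \<epsilon>"
    proof -
      have "isCont w t"
        using w_cont t01 by (simp add: continuous_on_eq_continuous_at)
      then obtain d1 where d1: "d1 > 0" "\<And>s. dist s t < d1 \<Longrightarrow> dist (w s) (w t) < \<epsilon>"
        using \<epsilon>(1) unfolding continuous_at_eps_delta by (metis dist_real_def)
      obtain d2 where d2: "d2 > 0" "ball t d2 \<subseteq> {0<..<1}"
        using t01 open_contains_ball[of "{0<..<1::real}"] by (meson open_greaterThanLessThan)
      show thesis
        by (rule that[of "min d1 d2"]) (use d1 d2 in \<open>auto simp: subset_iff dist_commute\<close>)
    qed
    show ?thesis
    proof (intro exI[of _ d] conjI allI impI d(1))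
      fix u s assume us: "a \<le> u \<and> u \<le> t \<and> t \<le> s \<and> s \<le> b \<and> s - u < d"
      have dd: "dist r t < d" if "u \<le> r" "r \<le> s" for r
        using that us by (auto simp: dist_real_def)
      have "(w t - \<epsilon>) * (len s - len u) \<le> cum s - cum u"
      proof (rule cum_ge)
        show "w t - \<epsilon> \<le> w r" if "u \<le> r" "r \<le> s" for r
          using d(2)[OF dd[OF that]] by (auto simp: dist_real_def)
      qed (use us d(2)[OF dd[of u]] d(2)[OF dd[of s]] in auto)
      then have "C * (w t * (len s - len u)) \<le> C * (cum s - cum u + \<epsilon> * (len s - len u))"
        using C by (intro mult_left_mono) (auto simp: algebra_simps)
      also have "\<dots> \<le> C * (cum s - cum u) + \<eta> * (len s - len u)"
        using mult_right_mono[OF \<epsilon>(2) len_diff_nonneg[of u s]] us by (simp add: algebra_simps)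
      finally have 1: "C * (w t * (len s - len u)) \<le> C * (cum s - cum u) + \<eta> * (len s - len u)" .
      have "cmod (g s - g u) * norm (f t) \<le> (len s - len u) * (C * w t)"
        using f[OF t01] ab us len_diff_nonneg[of u s] by (intro mult_mono len_step) auto
      moreover have "0 \<le> Q * (len s - len u)" using \<open>Q \<ge> 0\<close> len_diff_nonneg[of u s] us by auto
      ultimately show "norm (0 - 0 - (g s - g u) *\<^sub>C f t)
        \<le> (C * cum s + (\<eta> + Q) * len s) - (C * cum u + (\<eta> + Q) * len u)"
        using 1 by (simp add: norm_scaleC algebra_simps)
    qed
  qed
qed

text \<open>\<open>cum\<close> and \<open>len\<close> are both continuous from inside at
  \<open>0\<close> and at \<open>1\<close>, so short end pieces carry little weight and little
  length.\<close>

lemma ends_small: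
  assumes "e > 0" "C \<ge> 0" "R \<ge> 0"
  obtains a b where "0 < a" "a < b" "b < 1"
    "C * (cum a - cum 0) + R * (len a - len 0) < e" "C * (cum 1 - cum b) + R * (len 1 - len b) < e"
proof -
  obtain e' where "e' > 0" "e' * (C + R) < e"
    using obtain_small_factor[of "C + R" e] assms by auto
  then have e': "e' > 0" "C * e' + R * e' < e"
    by (simp_all add: algebra_simps)
  have "\<forall>\<^sub>F t in at_right 0. cum t < cum 0 + e'"
    using order_tendstoD(2)[OF cum_right, of "cum 0 + e'"] e'(1) by simp
  then obtain a1 where a1: "a1 > 0" "\<And>t. 0 < t \<Longrightarrow> t < a1 \<Longrightarrow> cum t < cum 0 + e'"
    unfolding eventually_at_right_field by auto
  have "\<forall>\<^sub>F t in at_left 1. cum 1 - e' < cum t"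
    using order_tendstoD(1)[OF cum_left, of "cum 1 - e'"] e'(1) by simp
  then obtain b1 where b1: "b1 < 1" "\<And>t. b1 < t \<Longrightarrow> t < 1 \<Longrightarrow> cum 1 - e' < cum t"
    unfolding eventually_at_left_field by auto
  obtain a2 where a2: "a2 > 0" "\<And>t. 0 \<le> t \<Longrightarrow> t < a2 \<Longrightarrow> len t - len 0 < e'"
    using len_continuous_right[of 0 e'] e'(1) by auto
  obtain b2 where b2: "b2 < 1" "\<And>t. b2 < t \<Longrightarrow> t \<le> 1 \<Longrightarrow> len 1 - len t < e'"
    using len_continuous_left[of 1 e'] e'(1) by auto
  define a where "a = min (1/3) (min (a1/2) (a2/2))"
  define b where "b = max (2/3) (max ((b1+1)/2) ((b2+1)/2))"
  have a: "0 < a" "a < a1" "a < a2" "a \<le> 1/3" using a1(1) a2(1) by (auto simp: a_def)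
  have b: "b < 1" "b1 < b" "b2 < b" "2/3 \<le> b" using b1(1) b2(1) by (auto simp: b_def less_max_iff_disj)
  show thesis
  proof (rule that[of a b])
    have "cum a - cum 0 \<le> e'" "len a - len 0 \<le> e'" "cum 1 - cum b \<le> e'" "len 1 - len b \<le> e'"
      using a1(2)[of a] a2(2)[of a] b1(2)[of b] b2(2)[of b] a b by auto
    then have "C * (cum a - cum 0) \<le> C * e'" "R * (len a - len 0) \<le> R * e'"
      "C * (cum 1 - cum b) \<le> C * e'" "R * (len 1 - len b) \<le> R * e'"
      using assms by (auto intro: mult_left_mono)
    then show "C * (cum a - cum 0) + R * (len a - len 0) < e" "C * (cum 1 - cum b) + R * (len 1 - len b) < e"
      using e'(2) by linarith+
  qed (use a b in auto)
qed

text \<open>On short end pieces the zero primitive has a small error because they carry little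
  weight; on the compact middle piece the integrand is continuous. Each of the three pieces receives
  a third of \<open>e\<close>.\<close>

lemma curve_integral_exists:
  fixes F :: "complex \<Rightarrow> 'b::{complex_normed_vector, banach}"
  assumes C: "0 \<le> C" and cont: "continuous_on {0<..<1} (\<lambda>t. F (g t))"
    and bound: "\<And>t. t \<in> {0<..<1} \<Longrightarrow> norm (F (g t)) \<le> C * w t"
  shows "\<exists>I. has_curve_integral F I g"
proof (rule has_curve_integral_exists)
  fix e :: real assume "e > 0"
  let ?f = "\<lambda>t. F (g t)"
  define Q where "Q = norm (?f 0) + norm (?f 1)"
  have Q: "Q \<ge> 0" "norm (?f 0) \<le> Q" "norm (?f 1) \<le> Q" by (auto simp: Q_def)
  obtain a b where ab: "0 < a" "a < b" "b < 1"
    "C * (cum a - cum 0) + (1 + Q) * (len a - len 0) < e/3"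
    "C * (cum 1 - cum b) + (1 + Q) * (len 1 - len b) < e/3"
    using ends_small[of "e/3" C "1 + Q"] \<open>e > 0\<close> C Q(1) by auto
  let ?m = "\<lambda>t. C * cum t + (1 + Q) * len t"
  have s1: "straddle g ?f 0 a (\<lambda>_. 0) ?m" and s3: "straddle g ?f b 1 (\<lambda>_. 0) ?m"
    using ab Q bound C by (auto intro!: straddle_weight)
  have "0 \<le> len b - len a" using len_diff_nonneg[of a b] ab by simp
  then obtain \<epsilon> where \<epsilon>: "\<epsilon> > 0" "\<epsilon> * (len b - len a) < e / 3"
    using obtain_small_factor[of "len b - len a" "e / 3"] \<open>e > 0\<close> by auto
  have "\<exists>\<Psi> m. straddle g ?f a b \<Psi> m \<and> m b - m a = \<epsilon> * (len b - len a)"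
    by (rule straddle_continuous) (use ab \<epsilon>(1) in \<open>auto intro: continuous_on_subset[OF cont] len_step\<close>)
  then obtain \<Psi> m where s2: "straddle g ?f a b \<Psi> m" "m b - m a = \<epsilon> * (len b - len a)" by blast
  have s12: "straddle g ?f 0 b (\<lambda>s. if s \<le> a then 0 else \<Psi> s - \<Psi> a + 0)
      (\<lambda>s. if s \<le> a then ?m s else m s - m a + ?m a)"
    using straddle_join[OF s1 s2(1)] ab by simp
  let ?M = "\<lambda>s. if s \<le> b then (if s \<le> a then ?m s else m s - m a + ?m a)
      else ?m s - ?m b + (if b \<le> a then ?m b else m b - m a + ?m a)"
  have "straddle g ?f 0 1 (\<lambda>s. if s \<le> b then (if s \<le> a then 0 else \<Psi> s - \<Psi> a + 0)
      else 0 - 0 + (if b \<le> a then 0 else \<Psi> b - \<Psi> a + 0)) ?M"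
    using straddle_join[OF s12 s3] ab by simp
  moreover have "?M 1 - ?M 0 \<le> e"
    using ab s2(2) \<epsilon>(2) by (simp add: algebra_simps)
  ultimately show "\<exists>\<Psi> m. straddle g ?f 0 1 \<Psi> m \<and> m 1 - m 0 \<le> e" by blast
qed

text \<open>The zero primitive is used on all three pieces, so its total error bounds the integral
  itself. The middle piece avoids \<open>0\<close> and \<open>1\<close>, which confines the term
  with \<open>Q\<close> to end pieces of small length.\<close>

lemma curve_integral_bound:
  fixes F :: "complex \<Rightarrow> 'b::complex_normed_vector"
  assumes C: "0 \<le> C" and I: "has_curve_integral F I g"
    and bound: "\<And>t. t \<in> {0<..<1} \<Longrightarrow> norm (F (g t)) \<le> C * w t"
  shows "norm I \<le> C * wint"
proof (rule field_le_epsilon)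
  fix e :: real assume "e > 0"
  let ?f = "\<lambda>t. F (g t)"
  define Q where "Q = norm (?f 0) + norm (?f 1)"
  have Q: "Q \<ge> 0" "norm (?f 0) \<le> Q" "norm (?f 1) \<le> Q" by (auto simp: Q_def)
  \<comment> \<open>The weight factor is \<open>0\<close> here: only the length of the end pieces
    has to be small, since their weight belongs to the bound.\<close>
  obtain a b where ab: "0 < a" "a < b" "b < 1"
    "0 * (cum a - cum 0) + Q * (len a - len 0) < e/3"
    "0 * (cum 1 - cum b) + Q * (len 1 - len b) < e/3"
    using ends_small[of "e/3" 0 Q] \<open>e > 0\<close> Q(1) by auto
  have "0 \<le> len 1 - len 0" using len_diff_nonneg[of 0 1] by simp
  then obtain \<eta> where \<eta>: "\<eta> > 0" "\<eta> * (len 1 - len 0) < e / 3"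
    using obtain_small_factor[of "len 1 - len 0" "e / 3"] \<open>e > 0\<close> by auto
  let ?m = "\<lambda>t. C * cum t + (\<eta> + Q) * len t" and ?n = "\<lambda>t. C * cum t + (\<eta> + 0) * len t"
  have s1: "straddle g ?f 0 a (\<lambda>_. 0) ?m" and s2: "straddle g ?f a b (\<lambda>_. 0) ?n"
    and s3: "straddle g ?f b 1 (\<lambda>_. 0) ?m"
    using ab Q bound C \<eta>(1) by (intro straddle_weight; force)+
  have s12: "straddle g ?f 0 b (\<lambda>s. if s \<le> a then 0 else 0 - 0 + 0)
      (\<lambda>s. if s \<le> a then ?m s else ?n s - ?n a + ?m a)"
    using straddle_join[OF s1 s2] ab by simp
  let ?M = "\<lambda>s. if s \<le> b then (if s \<le> a then ?m s else ?n s - ?n a + ?m a)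
      else ?m s - ?m b + (if b \<le> a then ?m b else ?n b - ?n a + ?m a)"
  let ?\<Psi> = "\<lambda>s. if s \<le> b then (if s \<le> a then 0 else 0 - 0 + 0)
      else 0 - 0 + (if b \<le> a then 0 else 0 - 0 + 0)"
  have "straddle g ?f 0 1 ?\<Psi> ?M"
    using straddle_join[OF s12 s3] ab by simp
  from has_curve_integral_straddle[OF I this] have "norm I \<le> ?M 1 - ?M 0"
    by (simp split: if_splits)
  also have "\<dots> = C * (cum 1 - cum 0) + \<eta> * (len 1 - len 0) + Q * (len a - len 0) + Q * (len 1 - len b)"
    using ab by (simp add: algebra_simps)
  also have "\<dots> \<le> C * wint + e"
    using mult_left_mono[OF cum_total C] \<eta>(2) ab(4,5) by simp
  finally show "norm I \<le> C * wint + e" .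
qed

end

text \<open>With \<open>\<Phi>\<close> and \<open>G\<close> the primitives of \<open>F\<close> and
  \<open>w\<close> from \<open>\<beta>\<close>, increments of \<open>\<Phi>\<close> are dominated by
  \<open>C\<close> times those of the bounded increasing function \<open>G\<close>. Hence
  \<open>\<Phi>\<close> converges at infinity, and the limit is the integral over the ray.\<close>

lemma has_integral_ray_bound:
  fixes F :: "real \<Rightarrow> 'b::banach"
  assumes C: "0 \<le> C" and F: "continuous_on {\<beta>..} F" and w: "continuous_on {\<beta>..} w"
    and bound: "\<And>\<mu>. \<beta> \<le> \<mu> \<Longrightarrow> norm (F \<mu>) \<le> C * w \<mu>" and w0: "\<And>\<mu>. 0 \<le> w \<mu>"
    and fin: "(\<integral>\<^sup>+\<mu>\<in>{\<beta>..}. ennreal (w \<mu>) \<partial>lborel) < \<infinity>"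
  shows "\<exists>I. (F has_integral I) {\<beta>..} \<and>
    norm I \<le> C * enn2real (\<integral>\<^sup>+\<mu>\<in>{\<beta>..}. ennreal (w \<mu>) \<partial>lborel)"
proof -
  define W where "W = enn2real (\<integral>\<^sup>+\<mu>\<in>{\<beta>..}. ennreal (w \<mu>) \<partial>lborel)"
  define G where "G b = integral {\<beta>..b} w" for b
  define \<Phi> where "\<Phi> b = integral {\<beta>..b} F" for b
  have iw: "w integrable_on {a..b}" if "\<beta> \<le> a" for a b
    by (rule integrable_continuous_real) (use that in \<open>auto intro: continuous_on_subset[OF w]\<close>)
  have iF: "F integrable_on {a..b}" if "\<beta> \<le> a" for a b
    by (rule integrable_continuous_real) (use that in \<open>auto intro: continuous_on_subset[OF F]\<close>)
  have GW: "G b \<le> W" for b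
  proof -
    have "ennreal (G b) = (\<integral>\<^sup>+\<mu>. ennreal (w \<mu>) * indicator {\<beta>..b} \<mu> \<partial>lborel)"
      unfolding G_def using iw[of \<beta> b] w0
      by (intro nn_integral_has_integral_lebesgue'[symmetric]) auto
    also have "\<dots> \<le> (\<integral>\<^sup>+\<mu>\<in>{\<beta>..}. ennreal (w \<mu>) \<partial>lborel)"
      by (intro nn_integral_mono) (auto simp: indicator_def)
    also have "\<dots> = ennreal W" using fin by (simp add: W_def)
    finally show ?thesis by (simp add: W_def)
  qed
  have G_diff: "G c - G b = integral {b..c} w" and \<Phi>_diff: "\<Phi> c - \<Phi> b = integral {b..c} F"
    if "\<beta> \<le> b" "b \<le> c" for b c
    using Henstock_Kurzweil_Integration.integral_combine[OF that iw[of \<beta> c]]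
      Henstock_Kurzweil_Integration.integral_combine[OF that iF[of \<beta> c]]
    unfolding G_def \<Phi>_def by (simp_all add: algebra_simps)
  have G_mono: "G b \<le> G c" if "\<beta> \<le> b" "b \<le> c" for b c
    using G_diff[OF that] integral_nonneg[OF iw[OF that(1)], of c] w0 by simp
  have \<Phi>G: "norm (\<Phi> c - \<Phi> b) \<le> C * (G c - G b)" if "\<beta> \<le> b" "b \<le> c" for b c
  proof -
    have "norm (integral {b..c} F) \<le> integral {b..c} (\<lambda>\<mu>. C * w \<mu>)"
      using that bound integrable_cmul[OF iw[OF that(1)], of C]
      by (intro integral_norm_bound_integral iF) auto
    then show ?thesis by (simp add: G_diff[OF that] \<Phi>_diff[OF that])
  qed
  define g where "g n = G (\<beta> + real n)" for n
  have "convergent g"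
  proof (rule Bseq_mono_convergent)
    show "\<forall>m n. m \<le> n \<longrightarrow> g m \<le> g n"
      by (auto simp: g_def intro: G_mono)
    have "0 \<le> G (\<beta> + real n)" for n
      unfolding G_def by (rule integral_nonneg[OF iw]) (use w0 in auto)
    then show "Bseq g"
      using GW by (intro BseqI'[of _ W]) (auto simp: g_def)
  qed
  then obtain Gl where Gl: "g \<longlonglongrightarrow> Gl" by (auto simp: convergent_def)
  have "mono g" by (auto simp: g_def mono_def intro: G_mono)
  then have g_le: "g n \<le> Gl" for n
    using Gl by (rule incseq_le)
  have G_le: "G b \<le> Gl" if "\<beta> \<le> b" for b
  proof -
    obtain n where "b - \<beta> \<le> real n" using real_arch_simple by blast
    then have "G b \<le> g n" unfolding g_def using that by (intro G_mono) auto
    then show ?thesis using g_le[of n] by simp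
  qed
  have \<Phi>n: "norm (\<Phi> b - \<Phi> (\<beta> + real n)) \<le> C * (Gl - g n)" if "\<beta> + real n \<le> b" for b n
  proof -
    have "norm (\<Phi> b - \<Phi> (\<beta> + real n)) \<le> C * (G b - g n)"
      unfolding g_def by (rule \<Phi>G) (use that in auto)
    also have "\<dots> \<le> C * (Gl - g n)"
      using G_le[of b] that C by (intro mult_left_mono) auto
    finally show ?thesis .
  qed
  have lim0: "(\<lambda>n. C * (Gl - g n)) \<longlonglongrightarrow> 0"
    using tendsto_mult[OF tendsto_const[of C] tendsto_diff[OF tendsto_const[of Gl] Gl]] by simp
  have "Cauchy (\<lambda>n. \<Phi> (\<beta> + real n))"
  proof (rule CauchyI')
    fix e :: real assume "e > 0"
    then obtain N where N: "\<And>n. n \<ge> N \<Longrightarrow> C * (Gl - g n) < e"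
      using order_tendstoD(2)[OF lim0, of e] by (auto simp: eventually_sequentially)
    show "\<exists>M. \<forall>m\<ge>M. \<forall>n>m. dist (\<Phi> (\<beta> + real m)) (\<Phi> (\<beta> + real n)) < e"
    proof (intro exI[of _ N] allI impI)
      fix m n assume "N \<le> m" "m < n"
      then show "dist (\<Phi> (\<beta> + real m)) (\<Phi> (\<beta> + real n)) < e"
        using N[of m] \<Phi>n[of m "\<beta> + real n"] by (simp add: dist_norm norm_minus_commute)
    qed
  qed
  then obtain I where I: "(\<lambda>n. \<Phi> (\<beta> + real n)) \<longlonglongrightarrow> I"
    using Cauchy_convergent convergent_def by blast
  have "norm (\<Phi> (\<beta> + real n)) \<le> C * W" for n
  proof -
    have "norm (\<Phi> (\<beta> + real n) - \<Phi> \<beta>) \<le> C * (G (\<beta> + real n) - G \<beta>)" by (rule \<Phi>G) auto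
    moreover have "\<Phi> \<beta> = 0" "G \<beta> = 0" by (simp_all add: \<Phi>_def G_def)
    moreover have "C * G (\<beta> + real n) \<le> C * W" using GW C by (intro mult_left_mono)
    ultimately show ?thesis by simp
  qed
  then have "norm I \<le> C * W"
    using LIMSEQ_le_const2[OF tendsto_norm[OF I]] by blast
  moreover have "(F has_integral I) {\<beta>..}"
  proof -
    \<comment> \<open>Over a set that is not a compact interval \<open>has_integral\<close> is
      defined through large boxes; \<open>no\<close> selects this branch of
      \<open>has_integral_alt\<close>.\<close>
    have no: "\<not> (\<exists>a b. {\<beta>..} = cbox a (b::real))"
    proof
      assume "\<exists>a b. {\<beta>..} = cbox a (b::real)"
      then obtain a b where "{\<beta>..} = {a..b}" by auto
      moreover have "max b \<beta> + 1 \<in> {\<beta>..}" by simp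
      ultimately have "max b \<beta> + 1 \<in> {a..b}" by blast
      then show False unfolding atLeastAtMost_iff by linarith
    qed
    have "\<exists>B>0. \<forall>a b. ball 0 B \<subseteq> cbox a b \<longrightarrow>
      (\<exists>z. ((\<lambda>x. if x \<in> {\<beta>..} then F x else 0) has_integral z) (cbox a b) \<and> norm (z - I) < e)"
      if "e > 0" for e
    proof -
      have "\<forall>\<^sub>F n in sequentially. C * (Gl - g n) < e / 2" "\<forall>\<^sub>F n in sequentially. dist (\<Phi> (\<beta> + real n)) I < e / 2"
        using order_tendstoD(2)[OF lim0, of "e/2"] tendstoD[OF I, of "e/2"] that by simp_all
      then have "\<forall>\<^sub>F n in sequentially. C * (Gl - g n) < e / 2 \<and> dist (\<Phi> (\<beta> + real n)) I < e / 2"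
        by eventually_elim simp
      then obtain n where n: "C * (Gl - g n) < e / 2" "norm (\<Phi> (\<beta> + real n) - I) < e / 2"
        unfolding eventually_sequentially dist_norm by blast
      \<comment> \<open>A box containing this ball contains \<open>\<beta>\<close> and
        \<open>\<beta> + n\<close>, so the integral over it is \<open>\<Phi> b\<close> with
        \<open>b\<close> beyond \<open>\<beta> + n\<close>.\<close>
      define B where "B = \<bar>\<beta>\<bar> + real n + 1"
      show ?thesis
      proof (intro exI[of _ B] conjI allI impI)
        show "B > 0" by (simp add: B_def)
        fix a b :: real assume "ball 0 B \<subseteq> cbox a b"
        moreover have "\<beta> \<in> ball 0 B" "\<beta> + real n \<in> ball 0 B" by (auto simp: B_def)
        ultimately have "\<beta> \<in> cbox a b" "\<beta> + real n \<in> cbox a b" by blast+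
        then have ab: "a \<le> \<beta>" "\<beta> + real n \<le> b" by auto
        have "(F has_integral \<Phi> b) {\<beta>..b}"
          unfolding \<Phi>_def by (rule integrable_integral[OF iF]) simp
        then have "((\<lambda>x. if x \<in> {\<beta>..b} then F x else 0) has_integral \<Phi> b) {a..b}"
          using ab by (subst has_integral_restrict) auto
        then have "((\<lambda>x. if x \<in> {\<beta>..} then F x else 0) has_integral \<Phi> b) (cbox a b)"
          by (subst (asm) has_integral_cong[where g = "\<lambda>x. if x \<in> {\<beta>..} then F x else 0"]) auto
        moreover have "norm (\<Phi> b - I) < e"
          using \<Phi>n[OF ab(2)] n norm_triangle_ineq[of "\<Phi> b - \<Phi> (\<beta> + real n)" "\<Phi> (\<beta> + real n) - I"] by simp
        ultimately show "\<exists>z. ((\<lambda>x. if x \<in> {\<beta>..} then F x else 0) has_integral z) (cbox a b) \<and> norm (z - I) < e"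
          by blast
      qed
    qed
    then show ?thesis
      by (subst has_integral_alt) (simp only: no if_False, blast)
  qed
  ultimately show ?thesis unfolding W_def by blast
qed

section \<open>Integrals along contours\<close>

text \<open>Existence and value in one relation: \<open>contour_int\<close> carries no information
  without existence, so the linearity rules are proved for the relation.\<close>

definition has_contour_int ::
  "(real \<Rightarrow> complex) \<Rightarrow> real \<Rightarrow> (complex \<Rightarrow> 'b::complex_normed_vector) \<Rightarrow> 'b \<Rightarrow> bool" where
  "has_contour_int g \<beta> F I \<longleftrightarrow>
     (\<exists>I1 I2. has_curve_integral F I1 g \<and> ((\<lambda>\<mu>. F (complex_of_real \<mu>)) has_integral I2) {\<beta>..} \<and> I = I1 + I2)"

lemma has_contour_int_contour_int:
  "contour_integrable g \<beta> F \<Longrightarrow> has_contour_int g \<beta> F (contour_int g \<beta> F)"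
  unfolding contour_integrable_def has_contour_int_def contour_int_def
  using curve_integral_eq by blast

lemma contour_int_eq:
  "has_contour_int g \<beta> F I \<Longrightarrow> contour_int g \<beta> F = I"
  unfolding has_contour_int_def contour_int_def
  by (auto simp: curve_integral_eq integral_unique)

lemma contour_integrableI:
  "has_contour_int g \<beta> F I \<Longrightarrow> contour_integrable g \<beta> F"
  unfolding has_contour_int_def contour_integrable_def by (auto simp: integrable_on_def)

lemma curve_sum_cong:
  assumes "p tagged_division_of {0..1}" "\<And>t. t \<in> {0..1} \<Longrightarrow> f t = f' t"
  shows "curve_sum g f p = curve_sum g f' p"
  unfolding curve_sum_def
proof (rule sum.cong, simp, clarify)
  fix t k assume "(t, k) \<in> p"
  then have "t \<in> {0..1}" using tagged_division_ofD(2,3)[OF assms(1)] by blast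
  then show "(g (Sup k) - g (Inf k)) *\<^sub>C f t = (g (Sup k) - g (Inf k)) *\<^sub>C f' t"
    using assms(2) by simp
qed

lemma has_contour_int_cong:
  assumes "\<And>\<mu>. \<mu> \<in> contour_set g \<beta> \<Longrightarrow> F \<mu> = F' \<mu>" and "has_contour_int g \<beta> F I"
  shows "has_contour_int g \<beta> F' I"
proof -
  obtain I1 I2 where I: "has_curve_integral F I1 g" "((\<lambda>\<mu>. F (complex_of_real \<mu>)) has_integral I2) {\<beta>..}" "I = I1 + I2"
    using assms(2) by (auto simp: has_contour_int_def)
  have "curve_sum g (\<lambda>t. F (g t)) p = curve_sum g (\<lambda>t. F' (g t)) p" if "p tagged_division_of {0..1}" for p
    by (rule curve_sum_cong[OF that]) (auto intro!: assms(1) simp: contour_set_def path_image_def)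
  then have "has_curve_integral F' I1 g"
    using I(1) unfolding has_curve_integral_alt by simp
  moreover have "((\<lambda>\<mu>. F' (complex_of_real \<mu>)) has_integral I2) {\<beta>..}"
    using I(2) by (rule has_integral_eq[rotated]) (auto intro!: assms(1) simp: contour_set_def)
  ultimately show ?thesis using I(3) by (auto simp: has_contour_int_def)
qed

lemma contour_int_cong:
  "(\<And>\<mu>. \<mu> \<in> contour_set g \<beta> \<Longrightarrow> F \<mu> = F' \<mu>) \<Longrightarrow> contour_integrable g \<beta> F \<Longrightarrow>
     contour_int g \<beta> F' = contour_int g \<beta> F"
  by (rule contour_int_eq[OF has_contour_int_cong[OF _ has_contour_int_contour_int]])

lemma has_curve_integral_diff:
  assumes "has_curve_integral F I g" "has_curve_integral F' J g"
  shows "has_curve_integral (\<lambda>\<mu>. F \<mu> - F' \<mu>) (I - J) g"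
  unfolding has_curve_integral_alt
proof (intro allI impI)
  fix e :: real assume "e > 0"
  obtain \<gamma>1 where 1: "gauge \<gamma>1" "\<And>p. p tagged_division_of {0..1} \<Longrightarrow> \<gamma>1 fine p \<Longrightarrow>
      norm (curve_sum g (\<lambda>t. F (g t)) p - I) < e / 2"
    using assms(1) \<open>e > 0\<close> unfolding has_curve_integral_alt by (meson half_gt_zero)
  obtain \<gamma>2 where 2: "gauge \<gamma>2" "\<And>p. p tagged_division_of {0..1} \<Longrightarrow> \<gamma>2 fine p \<Longrightarrow>
      norm (curve_sum g (\<lambda>t. F' (g t)) p - J) < e / 2"
    using assms(2) \<open>e > 0\<close> unfolding has_curve_integral_alt by (meson half_gt_zero)
  show "\<exists>\<gamma>. gauge \<gamma> \<and> (\<forall>p. p tagged_division_of {0..1} \<and> \<gamma> fine p \<longrightarrow>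
      norm (curve_sum g (\<lambda>t. F (g t) - F' (g t)) p - (I - J)) < e)"
  proof (intro exI[of _ "\<lambda>x. \<gamma>1 x \<inter> \<gamma>2 x"] conjI allI impI gauge_Int 1(1) 2(1))
    fix p :: "(real \<times> real set) set" assume p: "p tagged_division_of {0..1} \<and> (\<lambda>x. \<gamma>1 x \<inter> \<gamma>2 x) fine p"
    have "curve_sum g (\<lambda>t. F (g t) - F' (g t)) p = curve_sum g (\<lambda>t. F (g t)) p - curve_sum g (\<lambda>t. F' (g t)) p"
      by (simp add: curve_sum_def scaleC_diff_right sum_subtractf split_def)
    then show "norm (curve_sum g (\<lambda>t. F (g t) - F' (g t)) p - (I - J)) < e"
      using p 1(2)[of p] 2(2)[of p]
        norm_triangle_ineq4[of "curve_sum g (\<lambda>t. F (g t)) p - I" "curve_sum g (\<lambda>t. F' (g t)) p - J"]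
      by (simp add: fine_Int diff_diff_eq2 diff_diff_eq add_diff_eq diff_add_eq add.commute)
  qed
qed

lemma has_contour_int_diff:
  assumes "has_contour_int g \<beta> F I" "has_contour_int g \<beta> F' J"
  shows "has_contour_int g \<beta> (\<lambda>\<mu>. F \<mu> - F' \<mu>) (I - J)"
proof -
  obtain I1 I2 J1 J2 where
    "has_curve_integral F I1 g" "((\<lambda>\<mu>. F (complex_of_real \<mu>)) has_integral I2) {\<beta>..}" "I = I1 + I2"
    "has_curve_integral F' J1 g" "((\<lambda>\<mu>. F' (complex_of_real \<mu>)) has_integral J2) {\<beta>..}" "J = J1 + J2"
    using assms by (auto simp: has_contour_int_def)
  then show ?thesis
    unfolding has_contour_int_def
    by (intro exI[of _ "I1 - J1"] exI[of _ "I2 - J2"])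
      (simp add: has_curve_integral_diff has_integral_diff)
qed

definition clinear_bounded :: "('a::complex_normed_vector \<Rightarrow> 'b::complex_normed_vector) \<Rightarrow> bool" where
  "clinear_bounded h \<longleftrightarrow> bounded_linear h \<and> (\<forall>c x. h (c *\<^sub>C x) = c *\<^sub>C h x)"

text \<open>The increments of \<open>g\<close> are complex, so \<open>h\<close> must commute with
  complex scalars to pass through the sums.\<close>

lemma has_contour_int_linear:
  assumes h: "clinear_bounded h" and I: "has_contour_int g \<beta> F I"
  shows "has_contour_int g \<beta> (\<lambda>\<mu>. h (F \<mu>)) (h I)"
proof -
  have bl: "bounded_linear h" and sc: "\<And>c x. h (c *\<^sub>C x) = c *\<^sub>C h x"
    using h by (auto simp: clinear_bounded_def)
  interpret bounded_linear h by (rule bl)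
  obtain I1 I2 where I: "has_curve_integral F I1 g" "((\<lambda>\<mu>. F (complex_of_real \<mu>)) has_integral I2) {\<beta>..}" "I = I1 + I2"
    using I by (auto simp: has_contour_int_def)
  obtain K where K: "K > 0" "\<And>x. norm (h x) \<le> norm x * K"
    using pos_bounded by blast
  have "has_curve_integral (\<lambda>\<mu>. h (F \<mu>)) (h I1) g"
    unfolding has_curve_integral_alt
  proof (intro allI impI)
    fix e :: real assume "e > 0"
    then have "e / K > 0" using K(1) by simp
    then obtain \<gamma> where 1: "gauge \<gamma>" "\<And>p. p tagged_division_of {0..1} \<Longrightarrow> \<gamma> fine p \<Longrightarrow>
        norm (curve_sum g (\<lambda>t. F (g t)) p - I1) < e / K"
      using I(1) unfolding has_curve_integral_alt by meson
    show "\<exists>\<gamma>. gauge \<gamma> \<and> (\<forall>p. p tagged_division_of {0..1} \<and> \<gamma> fine p \<longrightarrow>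
        norm (curve_sum g (\<lambda>t. h (F (g t))) p - h I1) < e)"
    proof (intro exI[of _ \<gamma>] conjI allI impI 1(1))
      fix p :: "(real \<times> real set) set" assume p: "p tagged_division_of {0..1} \<and> \<gamma> fine p"
      have "curve_sum g (\<lambda>t. h (F (g t))) p - h I1 = h (curve_sum g (\<lambda>t. F (g t)) p - I1)"
        by (simp add: curve_sum_def diff sum sc split_def)
      then have "norm (curve_sum g (\<lambda>t. h (F (g t))) p - h I1) \<le> norm (curve_sum g (\<lambda>t. F (g t)) p - I1) * K"
        using K(2) by simp
      also have "\<dots> < e / K * K" using 1(2)[of p] p K(1) by (intro mult_strict_right_mono) auto
      finally show "norm (curve_sum g (\<lambda>t. h (F (g t))) p - h I1) < e" using K(1) by simp
    qed
  qed
  moreover have "((\<lambda>\<mu>. h (F (complex_of_real \<mu>))) has_integral h I2) {\<beta>..}"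
    using has_integral_linear[OF I(2) bl] by (simp add: o_def)
  ultimately show ?thesis
    using I(3) add[of I1 I2] by (auto simp: has_contour_int_def)
qed

locale weighted_contour = rectifiable_path g for g +
  fixes \<beta> :: real and w :: "complex \<Rightarrow> real"
  assumes w_curve: "continuous_on {0<..<1} (\<lambda>t. w (g t))"
    and w_ray: "continuous_on {\<beta>..} (\<lambda>\<mu>. w (complex_of_real \<mu>))"
    and weight_nonneg: "\<And>\<mu>. 0 \<le> w \<mu>"
    and w_curve_finite: "(\<integral>\<^sup>+t\<in>{0..1}. ennreal (w (g t)) \<partial>arclength_measure g) < \<infinity>"
    and w_ray_finite: "(\<integral>\<^sup>+\<mu>\<in>{\<beta>..}. ennreal (w (complex_of_real \<mu>)) \<partial>lborel) < \<infinity>"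
begin

sublocale weighted_path g "\<lambda>t. w (g t)"
  by unfold_locales (fact w_curve weight_nonneg w_curve_finite)+

text \<open>Once \<open>w\<close> is the integrand of \<open>Var_K\<close>, this is the variation as
  a real number.\<close>

definition wtotal :: real where
  "wtotal = enn2real ((\<integral>\<^sup>+t\<in>{0..1}. ennreal (w (g t)) \<partial>arclength_measure g)
     + (\<integral>\<^sup>+\<mu>\<in>{\<beta>..}. ennreal (w (complex_of_real \<mu>)) \<partial>lborel))"

definition open_contour :: "complex set" where
  "open_contour = g ` {0<..<1} \<union> complex_of_real ` {\<beta>..}"

lemma contour_integrable_bound:
  fixes F :: "complex \<Rightarrow> 'b::{complex_normed_vector, banach}"
  assumes C: "0 \<le> C" and F1: "continuous_on {0<..<1} (\<lambda>t. F (g t))"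
    and F2: "continuous_on {\<beta>..} (\<lambda>\<mu>. F (complex_of_real \<mu>))"
    and bound: "\<And>\<mu>. \<mu> \<in> open_contour \<Longrightarrow> norm (F \<mu>) \<le> C * w \<mu>"
  shows "contour_integrable g \<beta> F \<and> norm (contour_int g \<beta> F) \<le> C * wtotal"
proof -
  obtain I1 where I1: "has_curve_integral F I1 g"
    using curve_integral_exists[OF C F1] bound by (auto simp: open_contour_def)
  have n1: "norm I1 \<le> C * wint"
    using curve_integral_bound[OF C I1] bound by (auto simp: open_contour_def)
  obtain I2 where I2: "((\<lambda>\<mu>. F (complex_of_real \<mu>)) has_integral I2) {\<beta>..}"
    "norm I2 \<le> C * enn2real (\<integral>\<^sup>+\<mu>\<in>{\<beta>..}. ennreal (w (complex_of_real \<mu>)) \<partial>lborel)"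
    using has_integral_ray_bound[OF C F2 w_ray _ weight_nonneg w_ray_finite] bound by (auto simp: open_contour_def)
  have h: "has_contour_int g \<beta> F (I1 + I2)"
    using I1 I2 by (auto simp: has_contour_int_def)
  have "norm (I1 + I2) \<le> C * wtotal"
    using norm_triangle_ineq[of I1 I2] n1 I2(2) w_curve_finite w_ray_finite
    by (simp add: wtotal_def wint_def enn2real_plus algebra_simps)
  then show ?thesis
    using h by (simp add: contour_integrableI contour_int_eq)
qed

end

section \<open>Bounded operators and resolvents\<close>

lemma cblinfun_eqI: "(\<And>x. cblinfun_apply S x = cblinfun_apply T x) \<Longrightarrow> S = T"
  by (simp add: cblinfun_apply_inject[symmetric] fun_eq_iff)

lemma cblinfun_apply_scaleC_right: "cblinfun_apply T (c *\<^sub>C x) = c *\<^sub>C cblinfun_apply T x"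
  using cblinfun_apply[of T] by simp

lemmas cblinfun_apply_add_right = linear_add[OF bounded_linear.linear[OF bounded_linear_cblinfun_apply]]
  and cblinfun_apply_diff_right = linear_diff[OF bounded_linear.linear[OF bounded_linear_cblinfun_apply]]
  and cblinfun_apply_scaleR_right = linear_scale[OF bounded_linear.linear[OF bounded_linear_cblinfun_apply]]

lemmas cblinfun_apply_simps = cblinfun_compose.rep_eq plus_cblinfun.rep_eq minus_cblinfun.rep_eq
  scaleC_cblinfun.rep_eq id_cblinfun.rep_eq scaleR_cblinfun.rep_eq
  cblinfun_apply_add_right cblinfun_apply_diff_right cblinfun_apply_scaleC_right

lemma norm_cblinfun_compose: "norm (S o\<^sub>C\<^sub>L T) \<le> norm S * norm T"
proof (rule norm_cblinfun_bound)
  fix x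
  have "norm (cblinfun_apply S (cblinfun_apply T x)) \<le> norm S * norm (cblinfun_apply T x)"
    by (rule norm_cblinfun_apply)
  also have "\<dots> \<le> norm S * (norm T * norm x)"
    by (intro mult_left_mono norm_cblinfun_apply) simp
  finally show "norm (cblinfun_apply (S o\<^sub>C\<^sub>L T) x) \<le> norm S * norm T * norm x"
    by (simp add: cblinfun_compose.rep_eq mult.assoc)
qed simp

lemma cblinfun_compose_assoc: "(S o\<^sub>C\<^sub>L T) o\<^sub>C\<^sub>L U = S o\<^sub>C\<^sub>L (T o\<^sub>C\<^sub>L U)"
  by (rule cblinfun_eqI) (simp add: cblinfun_compose.rep_eq)

lemma cblinfun_compose_id [simp]: "T o\<^sub>C\<^sub>L id_cblinfun = T" "id_cblinfun o\<^sub>C\<^sub>L T = T"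
  by (auto intro!: cblinfun_eqI simp: cblinfun_apply_simps)

lemma cblinfun_compose_simps:
  "(S + T) o\<^sub>C\<^sub>L U = (S o\<^sub>C\<^sub>L U) + (T o\<^sub>C\<^sub>L U)" "U' o\<^sub>C\<^sub>L (S' + T') = (U' o\<^sub>C\<^sub>L S') + (U' o\<^sub>C\<^sub>L T')"
  "(S - T) o\<^sub>C\<^sub>L U = (S o\<^sub>C\<^sub>L U) - (T o\<^sub>C\<^sub>L U)" "U' o\<^sub>C\<^sub>L (S' - T') = (U' o\<^sub>C\<^sub>L S') - (U' o\<^sub>C\<^sub>L T')"
  "(c *\<^sub>C S) o\<^sub>C\<^sub>L U = c *\<^sub>C (S o\<^sub>C\<^sub>L U)" "U' o\<^sub>C\<^sub>L (c *\<^sub>C S') = c *\<^sub>C (U' o\<^sub>C\<^sub>L S')"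
  by (auto intro!: cblinfun_eqI simp: cblinfun_apply_simps)

lemma bounded_bilinear_cblinfun_compose: "bounded_bilinear (\<lambda>S T. S o\<^sub>C\<^sub>L T)"
proof
  show "\<exists>K. \<forall>S T. norm (S o\<^sub>C\<^sub>L T) \<le> norm S * norm T * K"
    by (intro exI[of _ 1]) (simp add: norm_cblinfun_compose)
qed (simp_all add: cblinfun_compose_simps scaleR_scaleC)

lemmas continuous_on_cblinfun_compose = bounded_bilinear.continuous_on[OF bounded_bilinear_cblinfun_compose]

lemma is_cblinfun_inverse_unique:
  "is_cblinfun_inverse T S \<Longrightarrow> is_cblinfun_inverse T S' \<Longrightarrow> S = S'"
  unfolding is_cblinfun_inverse_def by (metis cblinfun_compose_assoc cblinfun_compose_id)

lemma cblinfun_inv_eq: "is_cblinfun_inverse T S \<Longrightarrow> cblinfun_inv T = S"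
  unfolding cblinfun_inv_def by (rule the_equality) (auto intro: is_cblinfun_inverse_unique)

lemma is_cblinfun_inverse_inv: "boundedly_invertible T \<Longrightarrow> is_cblinfun_inverse T (cblinfun_inv T)"
  unfolding boundedly_invertible_def using cblinfun_inv_eq by blast

lemma boundedly_invertible_compose:
  assumes "boundedly_invertible S" "boundedly_invertible T"
  shows "boundedly_invertible (S o\<^sub>C\<^sub>L T)"
proof -
  obtain S' T' where "is_cblinfun_inverse S S'" "is_cblinfun_inverse T T'"
    using assms by (auto simp: boundedly_invertible_def)
  then have "is_cblinfun_inverse (S o\<^sub>C\<^sub>L T) (T' o\<^sub>C\<^sub>L S')"
    unfolding is_cblinfun_inverse_def by (metis cblinfun_compose_assoc cblinfun_compose_id)
  then show ?thesis by (auto simp: boundedly_invertible_def)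
qed

lemma boundedly_invertible_scaleC:
  assumes "boundedly_invertible T" "c \<noteq> 0"
  shows "boundedly_invertible (c *\<^sub>C T)"
proof -
  obtain S where "is_cblinfun_inverse T S"
    using assms by (auto simp: boundedly_invertible_def)
  then have "is_cblinfun_inverse (c *\<^sub>C T) (inverse c *\<^sub>C S)"
    using assms(2) by (simp add: is_cblinfun_inverse_def cblinfun_compose_simps scaleC_scaleC)
  then show ?thesis by (auto simp: boundedly_invertible_def)
qed

lemma boundedly_invertibleI:
  assumes c: "c > 0" "\<And>x. c * norm x \<le> norm (cblinfun_apply T x)" and "surj (cblinfun_apply T)"
  shows "boundedly_invertible T"
proof -
  have inj: "x = y" if "cblinfun_apply T x = cblinfun_apply T y" for x y
    using c(2)[of "x - y"] c(1) that by (simp add: cblinfun_apply_diff_right mult_le_0_iff)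
  define S where "S = inv (cblinfun_apply T)"
  have TS: "cblinfun_apply T (S y) = y" for y
    unfolding S_def by (rule surj_f_inv_f[OF assms(3)])
  have ST: "S (cblinfun_apply T x) = x" for x
    by (rule inj) (rule TS)
  have "bounded_linear S"
  proof (rule bounded_linear_intro[where K = "inverse c"])
    show "S (x + y) = S x + S y" for x y
      by (rule inj) (simp add: TS cblinfun_apply_add_right)
    show "S (r *\<^sub>R x) = r *\<^sub>R S x" for r x
      by (rule inj) (simp add: TS cblinfun_apply_scaleR_right)
    show "norm (S x) \<le> norm x * inverse c" for x
      using c(2)[of "S x"] c(1) by (simp add: TS field_simps)
  qed
  moreover have "S (r *\<^sub>C x) = r *\<^sub>C S x" for r x
    by (rule inj) (simp add: TS cblinfun_apply_scaleC_right)
  ultimately have S: "cblinfun_apply (CBlinfun S) = S"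
    by (simp add: CBlinfun_inverse)
  have "is_cblinfun_inverse T (CBlinfun S)"
    unfolding is_cblinfun_inverse_def
    by (auto intro!: cblinfun_eqI simp: cblinfun_apply_simps S TS ST)
  then show ?thesis by (auto simp: boundedly_invertible_def)
qed

lemma norm_cblinfun_inv_le:
  assumes T: "boundedly_invertible T" and c: "c > 0" "\<And>x. c * norm x \<le> norm (cblinfun_apply T x)"
  shows "norm (cblinfun_inv T) \<le> 1 / c"
proof (rule norm_cblinfun_bound)
  fix y
  have "cblinfun_apply (T o\<^sub>C\<^sub>L cblinfun_inv T) y = y"
    using is_cblinfun_inverse_inv[OF T] by (simp add: is_cblinfun_inverse_def id_cblinfun.rep_eq)
  then have "c * norm (cblinfun_apply (cblinfun_inv T) y) \<le> norm y"
    using c(2)[of "cblinfun_apply (cblinfun_inv T) y"] by (simp add: cblinfun_compose.rep_eq)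
  then show "norm (cblinfun_apply (cblinfun_inv T) y) \<le> 1 / c * norm y"
    using c(1) by (simp add: field_simps)
qed (use c in simp)

lemma boundedly_invertible_near_id:
  fixes T :: "'a::{complex_normed_vector, banach} \<Rightarrow>\<^sub>C\<^sub>L 'a"
  assumes "norm (T - id_cblinfun) < 1"
  shows "boundedly_invertible T"
proof -
  define q where "q = norm (T - id_cblinfun)"
  have q: "0 \<le> q" "q < 1" "\<And>x. norm (cblinfun_apply T x - x) \<le> q * norm x"
    using assms norm_cblinfun_apply[of "T - id_cblinfun"] by (auto simp: q_def cblinfun_apply_simps)
  show ?thesis
  proof (rule boundedly_invertibleI)
    show "1 - q > 0" using q by simp
    show "(1 - q) * norm x \<le> norm (cblinfun_apply T x)" for x
      using q(3)[of x] norm_triangle_ineq4[of "cblinfun_apply T x" "cblinfun_apply T x - x"]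
      by (simp add: algebra_simps)
    show "surj (cblinfun_apply T)"
      unfolding surj_def
    proof
      fix y
      \<comment> \<open>The fixed point equation says T x = y, and the linear part I - T makes the
        map a contraction with factor \<open>q\<close>.\<close>
      have "\<exists>!x. x - cblinfun_apply T x + y = x"
      proof (rule banach_fix_type[OF q(1,2)], intro allI)
        fix x x' :: 'a
        have "dist (x - cblinfun_apply T x + y) (x' - cblinfun_apply T x' + y)
            = norm (cblinfun_apply T (x - x') - (x - x'))"
          by (simp add: dist_norm cblinfun_apply_diff_right norm_minus_commute algebra_simps)
        then show "dist (x - cblinfun_apply T x + y) (x' - cblinfun_apply T x' + y) \<le> q * dist x x'"
          using q(3)[of "x - x'"] by (simp add: dist_norm)
      qed
      then obtain x where "x - cblinfun_apply T x + y = x" by blast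
      then have "y = cblinfun_apply T x" by (simp add: algebra_simps)
      then show "\<exists>x. y = cblinfun_apply T x" ..
    qed
  qed
qed

text \<open>S factors as (S T^-1) T, and the first factor differs from the identity by (S - T)
  T^-1.\<close>

lemma boundedly_invertible_perturb:
  fixes S T :: "'a::{complex_normed_vector, banach} \<Rightarrow>\<^sub>C\<^sub>L 'a"
  assumes T: "boundedly_invertible T" and "norm (S - T) * norm (cblinfun_inv T) < 1"
  shows "boundedly_invertible S"
proof -
  have inv: "T o\<^sub>C\<^sub>L cblinfun_inv T = id_cblinfun" "cblinfun_inv T o\<^sub>C\<^sub>L T = id_cblinfun"
    using is_cblinfun_inverse_inv[OF T] by (auto simp: is_cblinfun_inverse_def)
  have "S o\<^sub>C\<^sub>L cblinfun_inv T - id_cblinfun = (S - T) o\<^sub>C\<^sub>L cblinfun_inv T"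
    by (simp add: cblinfun_compose_simps inv)
  then have "norm (S o\<^sub>C\<^sub>L cblinfun_inv T - id_cblinfun) < 1"
    using norm_cblinfun_compose[of "S - T" "cblinfun_inv T"] assms(2) by simp
  then have "boundedly_invertible (S o\<^sub>C\<^sub>L cblinfun_inv T)"
    by (rule boundedly_invertible_near_id)
  then have "boundedly_invertible ((S o\<^sub>C\<^sub>L cblinfun_inv T) o\<^sub>C\<^sub>L T)"
    using T by (rule boundedly_invertible_compose)
  then show ?thesis
    by (simp add: cblinfun_compose_assoc inv)
qed

lemma boundedly_invertible_far:
  fixes Z :: "'a::{complex_normed_vector, banach} \<Rightarrow>\<^sub>C\<^sub>L 'a"
  assumes "norm Z < cmod \<mu>"
  shows "boundedly_invertible (Z - \<mu> *\<^sub>C id_cblinfun)"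
proof -
  have \<mu>: "\<mu> \<noteq> 0" using assms by auto
  have "boundedly_invertible (id_cblinfun - inverse \<mu> *\<^sub>C Z)"
  proof (rule boundedly_invertible_near_id)
    have "norm (inverse \<mu> *\<^sub>C Z) = norm Z / cmod \<mu>"
      by (simp add: norm_scaleC norm_inverse divide_inverse mult.commute)
    then show "norm (id_cblinfun - inverse \<mu> *\<^sub>C Z - id_cblinfun) < 1"
      using assms \<mu> by simp
  qed
  then have "boundedly_invertible ((- \<mu>) *\<^sub>C (id_cblinfun - inverse \<mu> *\<^sub>C Z))"
    using \<mu> by (intro boundedly_invertible_scaleC) auto
  also have "(- \<mu>) *\<^sub>C (id_cblinfun - inverse \<mu> *\<^sub>C Z) = Z - \<mu> *\<^sub>C id_cblinfun"
    using \<mu> by (simp add: scaleC_diff_right scaleC_scaleC scaleC_minus_left)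
  finally show ?thesis .
qed

text \<open>The resolvent is continued from a point far away along the connected set; the lower bound
  keeps the radius of the Neumann series away from zero.\<close>

lemma boundedly_invertible_connected:
  fixes Z :: "'a::{complex_normed_vector, banach} \<Rightarrow>\<^sub>C\<^sub>L 'a"
  assumes conn: "connected \<Gamma>" and \<delta>: "\<delta> > 0"
    and below: "\<And>\<mu> x. \<mu> \<in> \<Gamma> \<Longrightarrow> \<delta> * norm x \<le> norm (cblinfun_apply (Z - \<mu> *\<^sub>C id_cblinfun) x)"
    and far: "\<mu>0 \<in> \<Gamma>" "norm Z < cmod \<mu>0" and \<mu>: "\<mu> \<in> \<Gamma>"
  shows "boundedly_invertible (Z - \<mu> *\<^sub>C id_cblinfun)"
proof (rule connected_induction_simple[OF conn far(1) \<mu>, of "\<lambda>\<mu>. boundedly_invertible (Z - \<mu> *\<^sub>C id_cblinfun)"])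
  show "boundedly_invertible (Z - \<mu>0 *\<^sub>C id_cblinfun)"
    by (rule boundedly_invertible_far[OF far(2)])
  fix a assume a: "a \<in> \<Gamma>"
  \<comment> \<open>Two points within \<open>\<delta> / 2\<close> of \<open>a\<close> differ by less
    than \<open>\<delta>\<close>, and at a point of \<open>\<Gamma>\<close> where the inverse exists
    its norm is at most \<open>1 / \<delta>\<close>. Invertibility therefore passes between any two
    points of \<open>\<Gamma>\<close> near \<open>a\<close>.\<close>
  have step: "boundedly_invertible (Z - y *\<^sub>C id_cblinfun)"
    if x: "x \<in> \<Gamma>" "dist a x < \<delta> / 2" and y: "dist a y < \<delta> / 2"
      and inv: "boundedly_invertible (Z - x *\<^sub>C id_cblinfun)" for x y
  proof (rule boundedly_invertible_perturb[OF inv])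
    have "norm (id_cblinfun :: 'a \<Rightarrow>\<^sub>C\<^sub>L 'a) \<le> 1"
      by (rule norm_cblinfun_bound) (simp_all add: id_cblinfun.rep_eq)
    then have "norm ((x - y) *\<^sub>C (id_cblinfun :: 'a \<Rightarrow>\<^sub>C\<^sub>L 'a)) \<le> cmod (x - y)"
      by (simp add: norm_scaleC mult_left_le)
    moreover have "(Z - y *\<^sub>C id_cblinfun) - (Z - x *\<^sub>C id_cblinfun) = (x - y) *\<^sub>C id_cblinfun"
      by (simp add: scaleC_diff_left)
    moreover have "cmod (x - y) < \<delta>"
      using dist_triangle_half_r[OF x(2) y] by (simp add: dist_norm)
    ultimately have 1: "norm ((Z - y *\<^sub>C id_cblinfun) - (Z - x *\<^sub>C id_cblinfun)) < \<delta>" by simp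
    have "norm (cblinfun_inv (Z - x *\<^sub>C id_cblinfun)) \<le> 1 / \<delta>"
      using below[OF x(1)] by (rule norm_cblinfun_inv_le[OF inv \<delta>])
    then have "norm ((Z - y *\<^sub>C id_cblinfun) - (Z - x *\<^sub>C id_cblinfun)) * norm (cblinfun_inv (Z - x *\<^sub>C id_cblinfun))
        \<le> norm ((Z - y *\<^sub>C id_cblinfun) - (Z - x *\<^sub>C id_cblinfun)) * (1 / \<delta>)"
      by (rule mult_left_mono) simp
    also have "\<dots> < 1" using 1 \<delta> by simp
    finally show "norm ((Z - y *\<^sub>C id_cblinfun) - (Z - x *\<^sub>C id_cblinfun)) * norm (cblinfun_inv (Z - x *\<^sub>C id_cblinfun)) < 1" .
  qed
  show "\<exists>T. openin (top_of_set \<Gamma>) T \<and> a \<in> T \<and> (\<forall>x\<in>T. \<forall>y\<in>T.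
      boundedly_invertible (Z - x *\<^sub>C id_cblinfun) \<longrightarrow> boundedly_invertible (Z - y *\<^sub>C id_cblinfun))"
  proof (intro exI[of _ "\<Gamma> \<inter> ball a (\<delta> / 2)"] conjI ballI impI)
    show "openin (top_of_set \<Gamma>) (\<Gamma> \<inter> ball a (\<delta> / 2))" by (simp add: openin_open_Int)
    show "a \<in> \<Gamma> \<inter> ball a (\<delta> / 2)" using a \<delta> by simp
    fix x y assume "x \<in> \<Gamma> \<inter> ball a (\<delta> / 2)" "y \<in> \<Gamma> \<inter> ball a (\<delta> / 2)"
      "boundedly_invertible (Z - x *\<^sub>C id_cblinfun)"
    then show "boundedly_invertible (Z - y *\<^sub>C id_cblinfun)"
      by (intro step[of x y]) simp_all
  qed
qed

text \<open>The resolvent identity R(\<mu>) - R(\<nu>) = (\<mu> - \<nu>) R(\<mu>) R(\<nu>) makes the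
  resolvent Lipschitz with constant 1/\<delta>^2.\<close>

lemma continuous_on_resolvent:
  assumes \<delta>: "\<delta> > 0"
    and below: "\<And>\<mu> x. \<mu> \<in> \<Gamma> \<Longrightarrow> \<delta> * norm x \<le> norm (cblinfun_apply (Z - \<mu> *\<^sub>C id_cblinfun) x)"
    and inv: "\<And>\<mu>. \<mu> \<in> \<Gamma> \<Longrightarrow> boundedly_invertible (Z - \<mu> *\<^sub>C id_cblinfun)"
  shows "continuous_on \<Gamma> (\<lambda>\<mu>. cblinfun_inv (Z - \<mu> *\<^sub>C id_cblinfun))"
proof -
  let ?R = "\<lambda>\<mu>. cblinfun_inv (Z - \<mu> *\<^sub>C id_cblinfun)"
  have R: "(Z - \<mu> *\<^sub>C id_cblinfun) o\<^sub>C\<^sub>L ?R \<mu> = id_cblinfun" "?R \<mu> o\<^sub>C\<^sub>L (Z - \<mu> *\<^sub>C id_cblinfun) = id_cblinfun"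
    "norm (?R \<mu>) \<le> 1 / \<delta>" if "\<mu> \<in> \<Gamma>" for \<mu>
    using is_cblinfun_inverse_inv[OF inv[OF that]] norm_cblinfun_inv_le[OF inv[OF that] \<delta> below[OF that]]
    by (auto simp: is_cblinfun_inverse_def)
  have "norm (?R \<mu> - ?R \<nu>) \<le> (1 / \<delta> * (1 / \<delta>)) * cmod (\<mu> - \<nu>)" if "\<mu> \<in> \<Gamma>" "\<nu> \<in> \<Gamma>" for \<mu> \<nu>
  proof -
    have "?R \<mu> - ?R \<nu> = ?R \<mu> o\<^sub>C\<^sub>L ((Z - \<nu> *\<^sub>C id_cblinfun) o\<^sub>C\<^sub>L ?R \<nu>) - (?R \<mu> o\<^sub>C\<^sub>L (Z - \<mu> *\<^sub>C id_cblinfun)) o\<^sub>C\<^sub>L ?R \<nu>"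
      by (simp add: R that)
    also have "\<dots> = ?R \<mu> o\<^sub>C\<^sub>L (((Z - \<nu> *\<^sub>C id_cblinfun) - (Z - \<mu> *\<^sub>C id_cblinfun)) o\<^sub>C\<^sub>L ?R \<nu>)"
      by (simp only: cblinfun_compose_assoc cblinfun_compose_simps)
    also have "(Z - \<nu> *\<^sub>C id_cblinfun) - (Z - \<mu> *\<^sub>C id_cblinfun) = (\<mu> - \<nu>) *\<^sub>C id_cblinfun"
      by (simp add: scaleC_diff_left)
    finally have "norm (?R \<mu> - ?R \<nu>) = cmod (\<mu> - \<nu>) * norm (?R \<mu> o\<^sub>C\<^sub>L ?R \<nu>)"
      by (simp add: cblinfun_compose_simps norm_scaleC)
    also have "\<dots> \<le> cmod (\<mu> - \<nu>) * (1 / \<delta> * (1 / \<delta>))"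
      using \<delta> R(3) that by (intro mult_left_mono order_trans[OF norm_cblinfun_compose] mult_mono) auto
    finally show ?thesis by (simp add: mult.commute)
  qed
  then have "(1 / \<delta> * (1 / \<delta>))-lipschitz_on \<Gamma> ?R"
    by (intro lipschitz_onI) (auto simp: dist_norm)
  then show ?thesis by (rule lipschitz_on_continuous_on)
qed

section \<open>Numerical range estimates\<close>

lemma cmod_cinner_le: "cmod (cinner x y) \<le> norm x * norm y"
proof (cases "cinner x y = 0")
  case False
  \<comment> \<open>A phase that rotates the scalar product onto the positive real axis, where it is
    a real inner product and the real Cauchy-Schwarz inequality applies.\<close>
  define c where "c = cnj (cinner x y) / cmod (cinner x y)"
  have "cmod c = 1" using False by (simp add: c_def norm_divide)
  have "c * cinner x y = complex_of_real (cmod (cinner x y))"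
    using False complex_norm_square[of "cinner x y"]
    by (simp add: c_def field_simps power2_eq_square)
  then have "cmod (cinner x y) = Re (cinner (c *\<^sub>C x) y)"
    by (simp add: cinner_scaleC_left)
  also have "\<dots> \<le> norm (c *\<^sub>C x) * norm y"
    unfolding Re_cinner by (rule norm_cauchy_schwarz)
  finally show ?thesis by (simp add: norm_scaleC \<open>cmod c = 1\<close>)
qed simp

lemma cinner_diff_left: "cinner (x - y) z = cinner x z - cinner y z"
  using cinner_add_left[of "x - y" y z] by simp

text \<open>For a unit vector u the number <Tu, u> lies in the numerical range, so the distance of
  \<mu> from that set is at most |<(T - \<mu>)u, u>| \<le> ||(T - \<mu>)u||. The perturbation
  \<open>X\<close> costs at most \<open>norm X\<close>.\<close>

lemma numerical_range_lower_bound: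
  fixes T X :: "'a::complex_inner \<Rightarrow>\<^sub>C\<^sub>L 'a"
  shows "(infdist \<mu> (numerical_range_closure T) - norm X) * norm x
    \<le> norm (cblinfun_apply (T + X - \<mu> *\<^sub>C id_cblinfun) x)"
proof (cases "x = 0")
  case False
  let ?D = "infdist \<mu> (numerical_range_closure T)"
  define u where "u = (1 / norm x) *\<^sub>R x"
  have u: "norm u = 1" "x = norm x *\<^sub>R u" using False by (auto simp: u_def)
  have "?D \<le> dist \<mu> (cinner (cblinfun_apply T u) u)"
    unfolding numerical_range_closure_def
    by (intro infdist_le set_mp[OF closure_subset]) (use u in blast)
  also have "\<dots> = cmod (cinner (cblinfun_apply T u - \<mu> *\<^sub>C u) u)"
    using u by (simp add: dist_norm cinner_diff_left cinner_scaleC_left cinner_self norm_minus_commute)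
  also have "\<dots> \<le> norm (cblinfun_apply T u - \<mu> *\<^sub>C u)"
    using cmod_cinner_le[of "cblinfun_apply T u - \<mu> *\<^sub>C u" u] u by simp
  finally have "?D * norm x \<le> norm (cblinfun_apply T u - \<mu> *\<^sub>C u) * norm x"
    by (intro mult_right_mono) auto
  also have "\<dots> = norm (norm x *\<^sub>R (cblinfun_apply T u - \<mu> *\<^sub>C u))"
    by simp
  also have "norm x *\<^sub>R (cblinfun_apply T u - \<mu> *\<^sub>C u) = cblinfun_apply T x - \<mu> *\<^sub>C x"
  proof -
    have "cblinfun_apply T (norm x *\<^sub>R u) - \<mu> *\<^sub>C (norm x *\<^sub>R u) = norm x *\<^sub>R (cblinfun_apply T u - \<mu> *\<^sub>C u)"
      by (simp add: scaleR_scaleC cblinfun_apply_scaleC_right scaleC_diff_right scaleC_scaleC mult.commute)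
    then show ?thesis using u(2) by simp
  qed
  finally have "?D * norm x \<le> norm (cblinfun_apply T x - \<mu> *\<^sub>C x)" .
  moreover have "cblinfun_apply (T + X - \<mu> *\<^sub>C id_cblinfun) x = (cblinfun_apply T x - \<mu> *\<^sub>C x) + cblinfun_apply X x"
    by (simp add: cblinfun_apply_simps)
  ultimately show ?thesis
    using norm_triangle_ineq4[of "(cblinfun_apply T x - \<mu> *\<^sub>C x) + cblinfun_apply X x" "cblinfun_apply X x"]
      norm_cblinfun_apply[of X x] by (simp add: left_diff_distrib)
qed simp

text \<open>The numerical range lies in the disc of radius \<open>norm T\<close>. For
  \<open>z\<close> near it this bounds the factor \<open>z\<close> in front of the last integral in
  W.\<close>

lemma cmod_le_infdist_numerical_range:
  fixes T :: "'a::complex_inner \<Rightarrow>\<^sub>C\<^sub>L 'a"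
  assumes "numerical_range_closure T \<noteq> {}"
  shows "cmod z \<le> norm T + infdist z (numerical_range_closure T)"
proof -
  have "numerical_range_closure T \<subseteq> cball 0 (norm T)"
    unfolding numerical_range_closure_def
  proof (rule closure_minimal)
    show "{cinner (cblinfun_apply T x) x |x. norm x = 1} \<subseteq> cball 0 (norm T)"
    proof clarsimp
      fix x :: 'a assume "norm x = 1"
      then show "cmod (cinner (cblinfun_apply T x) x) \<le> norm T"
        using cmod_cinner_le[of "cblinfun_apply T x" x] norm_cblinfun_apply[of T x] by simp
    qed
  qed simp
  then have "cmod z - norm T \<le> dist z p" if "p \<in> numerical_range_closure T" for p
    using that norm_triangle_ineq4[of "z - p" "- p"] by (force simp: dist_norm)
  then have "cmod z - norm T \<le> infdist z (numerical_range_closure T)"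
    unfolding infdist_notempty[OF assms] by (intro cINF_greatest assms)
  then show ?thesis by simp
qed

section \<open>Continuity of the derivative of a holomorphic operator function\<close>

lemma bounded_linear_cinner_apply:
  "bounded_linear (\<lambda>T::'a::complex_inner \<Rightarrow>\<^sub>C\<^sub>L 'b::complex_inner. cinner (cblinfun_apply T x) y)"
proof (rule bounded_linear_intro[where K = "norm x * norm y"])
  show "cinner (cblinfun_apply (S + T) x) y = cinner (cblinfun_apply S x) y + cinner (cblinfun_apply T x) y"
    for S T :: "'a \<Rightarrow>\<^sub>C\<^sub>L 'b"
    by (simp add: cblinfun_apply_simps cinner_add_left)
  show "cinner (cblinfun_apply (r *\<^sub>R T) x) y = r *\<^sub>R cinner (cblinfun_apply T x) y"
    for r and T :: "'a \<Rightarrow>\<^sub>C\<^sub>L 'b"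
    by (simp add: cblinfun_apply_simps scaleR_scaleC cinner_scaleC_left scaleR_conv_of_real)
  show "norm (cinner (cblinfun_apply T x) y) \<le> norm T * (norm x * norm y)" for T :: "'a \<Rightarrow>\<^sub>C\<^sub>L 'b"
    using cmod_cinner_le[of "cblinfun_apply T x" y]
      mult_right_mono[OF norm_cblinfun_apply[of T x], of "norm y"] by (simp add: mult.assoc)
qed

lemma norm_cblinfun_weak_bound:
  fixes T :: "'a::complex_inner \<Rightarrow>\<^sub>C\<^sub>L 'b::complex_inner"
  assumes "0 \<le> b" "\<And>x y. cmod (cinner (cblinfun_apply T x) y) \<le> b * norm x * norm y"
  shows "norm T \<le> b"
proof (rule norm_cblinfun_bound[OF assms(1)])
  fix x
  let ?n = "norm (cblinfun_apply T x)"
  have "?n * ?n \<le> b * norm x * ?n"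
    using assms(2)[of x "cblinfun_apply T x"] by (simp add: cinner_self power2_eq_square norm_mult)
  then show "?n \<le> b * norm x"
    using assms(1) by (cases "?n = 0") (auto simp: mult_le_cancel_right)
qed

text \<open>The Cauchy inequality, applied to the matrix elements uniformly in unit vectors, makes the
  derivative locally Lipschitz.\<close>

lemma continuous_on_cblinfun_derivative:
  fixes f df :: "complex \<Rightarrow> 'a::complex_inner \<Rightarrow>\<^sub>C\<^sub>L 'b::complex_inner"
  assumes D: "open D" and df: "\<And>\<mu>. \<mu> \<in> D \<Longrightarrow> (f has_derivative (\<lambda>h. h *\<^sub>C df \<mu>)) (at \<mu>)"
  shows "continuous_on D df"
proof (rule continuous_at_imp_continuous_on, rule ballI)
  fix \<mu> assume "\<mu> \<in> D"
  then obtain r0 where r0: "r0 > 0" "cball \<mu> r0 \<subseteq> D"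
    using D open_contains_cball by blast
  \<comment> \<open>Halving leaves room for discs of radius \<open>r\<close> around every point of
    \<open>ball \<mu> r\<close>; on all of them \<open>f\<close> is bounded by the same
    \<open>B\<close>.\<close>
  define r where "r = r0 / 2"
  have r: "r > 0" "cball \<mu> (2 * r) \<subseteq> D" using r0 by (auto simp: r_def)
  have "continuous_on (cball \<mu> (2 * r)) f"
    using df r(2) by (intro continuous_at_imp_continuous_on ballI has_derivative_continuous) blast
  then have "compact (f ` cball \<mu> (2 * r))"
    by (intro compact_continuous_image) auto
  then obtain B where B: "B > 0" "\<And>z. z \<in> cball \<mu> (2 * r) \<Longrightarrow> norm (f z) \<le> B"
    using compact_imp_bounded bounded_pos by (metis imageI)
  \<comment> \<open>Cauchy's bound 2! B / r^2 for the second derivative of a matrix element with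
    unit vectors; by the mean value inequality it is a Lipschitz constant of the first
    derivative.\<close>
  define L where "L = 2 * B / r^2"
  have "L \<ge> 0" using B(1) r(1) by (simp add: L_def)
  have lip: "norm (df z - df \<mu>) \<le> L * dist z \<mu>" if z: "z \<in> ball \<mu> r" for z
  proof (rule norm_cblinfun_weak_bound)
    show "0 \<le> L * dist z \<mu>" using \<open>L \<ge> 0\<close> by simp
    fix x y
    define \<phi> where "\<phi> \<zeta> = cinner (cblinfun_apply (f \<zeta>) x) y" for \<zeta>
    have \<phi>': "(\<phi> has_field_derivative cinner (cblinfun_apply (df \<zeta>) x) y) (at \<zeta>)" if "\<zeta> \<in> D" for \<zeta>
    proof -
      have "(\<phi> has_derivative (\<lambda>h. cinner (cblinfun_apply (h *\<^sub>C df \<zeta>) x) y)) (at \<zeta>)"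
        unfolding \<phi>_def
        by (rule bounded_linear.has_derivative[OF bounded_linear_cinner_apply df[OF that]])
      then show ?thesis
        unfolding has_field_derivative_def
        by (rule has_derivative_eq_rhs)
          (simp add: fun_eq_iff cblinfun_apply_simps cinner_scaleC_left mult.commute)
    qed
    have hol: "\<phi> holomorphic_on D"
      using \<phi>' D by (auto simp: holomorphic_on_open)
    have deriv: "deriv \<phi> \<zeta> = cinner (cblinfun_apply (df \<zeta>) x) y" if "\<zeta> \<in> D" for \<zeta>
      using \<phi>'[OF that] by (rule DERIV_imp_deriv)
    have d2: "cmod (deriv (deriv \<phi>) \<zeta>) \<le> L * norm x * norm y" if \<zeta>: "\<zeta> \<in> ball \<mu> r" for \<zeta>
    proof -
      have sub: "cball \<zeta> r \<subseteq> cball \<mu> (2 * r)"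
      proof
        fix v assume "v \<in> cball \<zeta> r"
        then show "v \<in> cball \<mu> (2 * r)"
          using \<zeta> dist_triangle[of \<mu> v \<zeta>] by simp
      qed
      then have subD: "cball \<zeta> r \<subseteq> D" using r(2) by blast
      have "norm ((deriv ^^ 2) \<phi> \<zeta>) \<le> fact 2 * (B * norm x * norm y) / r ^ 2"
      proof (rule Cauchy_inequality[OF _ _ r(1)])
        show "\<phi> holomorphic_on ball \<zeta> r"
          using subD by (intro holomorphic_on_subset[OF hol]) (meson ball_subset_cball order_trans)
        show "continuous_on (cball \<zeta> r) \<phi>"
          using subD holomorphic_on_imp_continuous_on[OF hol] continuous_on_subset by blast
        fix v assume "norm (\<zeta> - v) = r"
        then have "v \<in> cball \<mu> (2 * r)" using sub by (auto simp: dist_norm)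
        then have "norm (cblinfun_apply (f v) x) \<le> B * norm x"
          using B(2)[of v] norm_cblinfun_apply[of "f v" x] mult_right_mono[of "norm (f v)" B "norm x"] by auto
        then show "cmod (\<phi> v) \<le> B * norm x * norm y"
          unfolding \<phi>_def using cmod_cinner_le[of "cblinfun_apply (f v) x" y]
          by (meson mult_right_mono norm_ge_zero order_trans)
      qed
      then show ?thesis by (simp add: L_def numeral_2_eq_2 field_simps)
    qed
    have "cmod (deriv \<phi> z - deriv \<phi> \<mu>) \<le> L * norm x * norm y * cmod (z - \<mu>)"
    proof (rule field_differentiable_bound[of "ball \<mu> r"])
      fix \<zeta> assume \<zeta>: "\<zeta> \<in> ball \<mu> r"
      then have "\<zeta> \<in> D" using r by auto
      then show "(deriv \<phi> has_field_derivative deriv (deriv \<phi>) \<zeta>) (at \<zeta> within ball \<mu> r)"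
        using holomorphic_derivI[OF holomorphic_deriv[OF hol D] D] has_field_derivative_at_within by blast
    qed (use d2 z r in auto)
    moreover have "z \<in> D" "\<mu> \<in> D" using z r by auto
    ultimately show "cmod (cinner (cblinfun_apply (df z - df \<mu>) x) y) \<le> L * dist z \<mu> * norm x * norm y"
      by (simp add: deriv minus_cblinfun.rep_eq cinner_diff_left dist_norm mult_ac)
  qed
  have "((\<lambda>z. L * dist z \<mu>) \<longlongrightarrow> L * dist \<mu> \<mu>) (at \<mu>)"
    by (intro tendsto_intros)
  then have lim: "((\<lambda>z. L * dist z \<mu>) \<longlongrightarrow> 0) (at \<mu>)" by simp
  have "\<forall>\<^sub>F z in at \<mu>. norm (df z - df \<mu>) \<le> L * dist z \<mu>"
    unfolding eventually_at
    by (rule exI[of _ r]) (use lip r(1) in \<open>simp add: dist_commute\<close>)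
  then have "((\<lambda>z. df z - df \<mu>) \<longlongrightarrow> 0) (at \<mu>)"
    using lim by (rule Lim_null_comparison)
  then show "isCont df \<mu>"
    unfolding isCont_def by (rule LIM_zero_cancel)
qed

section \<open>The factorizations\<close>

lemma clinear_bounded_scaleC: "clinear_bounded (\<lambda>x::'a::complex_normed_vector. c *\<^sub>C x)"
  by (simp add: clinear_bounded_def bounded_linear_scaleC scaleC_scaleC mult.commute)

lemma clinear_bounded_compose_right: "clinear_bounded (\<lambda>T. T o\<^sub>C\<^sub>L Z)"
  by (simp add: clinear_bounded_def cblinfun_compose_simps
      bounded_bilinear.bounded_linear_left[OF bounded_bilinear_cblinfun_compose])

lemma clinear_bounded_compose_left: "clinear_bounded (\<lambda>T. Z o\<^sub>C\<^sub>L T)"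
  by (simp add: clinear_bounded_def cblinfun_compose_simps
      bounded_bilinear.bounded_linear_right[OF bounded_bilinear_cblinfun_compose])

text \<open>The factors satisfy d/(d - \<rho>) \<le> 2/(1 + v) and 1 + c/(d(1 + v)/2) \<le> 2(d +
  a)/(d(1 + v)). The resulting bound 4v(d + a)/(d(1 + v)^2) is below 1 exactly when 4va < d(1 -
  v)^2, because (1 + v)^2 - 4v = (1 - v)^2; this is the hypothesis on va.\<close>

lemma factor_norm_estimate:
  fixes d v \<rho> a c :: real
  assumes d: "0 < d" and v: "0 \<le> v" "v < 1" and \<rho>: "\<rho> \<le> 1/2 * d * (1 - v)" and a: "0 \<le> a"
    and va: "v * a < 1/4 * d * (1 - v)\<^sup>2" and c: "c \<le> a + 1/2 * d * (1 - v)"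
  shows "d / (d - \<rho>) * (1 + c / (1/2 * d * (1 + v))) * v < 1"
proof -
  have pos: "0 < d * (1 + v)" using d v by simp
  have "1/2 * d * (1 + v) \<le> d - \<rho>"
    using \<rho> unfolding distrib_left right_diff_distrib by linarith
  moreover from this have d\<rho>: "0 < d - \<rho>" using pos by simp
  ultimately have "d / (d - \<rho>) \<le> d / (1/2 * d * (1 + v))"
    using d pos v d\<rho> by (intro divide_left_mono[OF _ less_imp_le[OF d]] mult_pos_pos) auto
  then have 1: "d / (d - \<rho>) \<le> d / (1/2 * d * (1 + v))" "0 \<le> d / (d - \<rho>)"
    using d d\<rho> by auto
  have "1 + c / (1/2 * d * (1 + v)) \<le> 1 + (a + 1/2 * d * (1 - v)) / (1/2 * d * (1 + v))"
    using pos c by (intro add_left_mono divide_right_mono) auto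
  also have "\<dots> = (2 * d + 2 * a) / (d * (1 + v))"
    using pos d v by (simp add: field_simps)
  finally have 2: "1 + c / (1/2 * d * (1 + v)) \<le> (2 * d + 2 * a) / (d * (1 + v))" .
  have "d / (d - \<rho>) * (1 + c / (1/2 * d * (1 + v))) \<le> d / (d - \<rho>) * ((2 * d + 2 * a) / (d * (1 + v)))"
    using 2 1(2) by (rule mult_left_mono)
  also have "\<dots> \<le> d / (1/2 * d * (1 + v)) * ((2 * d + 2 * a) / (d * (1 + v)))"
    using 1(1) d a pos by (intro mult_right_mono) auto
  finally have "d / (d - \<rho>) * (1 + c / (1/2 * d * (1 + v))) * v
      \<le> d / (1/2 * d * (1 + v)) * ((2 * d + 2 * a) / (d * (1 + v))) * v"
    using v(1) by (rule mult_right_mono)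
  also have "\<dots> = (4 * v * d + 4 * (v * a)) / (d * (1 + v)\<^sup>2)"
  proof -
    have "d / (1/2 * d * s) * ((2 * d + 2 * a) / (d * s)) * v = (4 * v * d + 4 * (v * a)) / (d * s\<^sup>2)"
      if "0 < s" for s
      using d that by (simp add: field_simps power2_eq_square)
    then show ?thesis using v(1) by simp
  qed
  also have "\<dots> < 1"
  proof -
    have "4 * v * d + 4 * (v * a) < d * (1 + v)\<^sup>2"
      using va by (simp add: power2_eq_square algebra_simps)
    then show ?thesis using d v by (simp add: divide_less_eq)
  qed
  finally show ?thesis .
qed

lemma closed_contour_set:
  assumes "continuous_on {0..1} g"
  shows "closed (contour_set g \<beta>)"
proof -
  have "complex_of_real ` {\<beta>..} = {z. Im z = 0 \<and> \<beta> \<le> Re z}"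
    by (auto simp: image_iff complex_eq_iff)
  moreover have "closed {z. Im z = 0 \<and> \<beta> \<le> Re z}"
    by (intro closed_Collect_conj closed_Collect_eq closed_Collect_le continuous_intros)
  moreover have "compact (path_image g)"
    using assms by (simp add: compact_path_image path_def)
  ultimately show ?thesis
    unfolding contour_set_def by (simp add: closed_Un compact_imp_closed)
qed

context weighted_contour
begin

text \<open>The two pieces are kept apart because \<open>K'\<close> is put together from
  \<open>dKc\<close> on the curve and \<open>dK\<close> on the ray, and continuity at
  \<open>\<beta>\<close> along the curve is not assumed.\<close>

definition cont_along :: "(complex \<Rightarrow> 'b::topological_space) \<Rightarrow> bool" where
  "cont_along F \<longleftrightarrow> continuous_on {0<..<1} (\<lambda>t. F (g t)) \<and>
     continuous_on {\<beta>..} (\<lambda>\<mu>. F (complex_of_real \<mu>))"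

lemma cont_along_contour_set:
  assumes "continuous_on (contour_set g \<beta>) F"
  shows "cont_along F"
  unfolding cont_along_def
proof
  show "continuous_on {0<..<1} (\<lambda>t. F (g t))"
    by (rule continuous_on_compose2[OF assms continuous_on_subset[OF cont]])
      (auto simp: contour_set_def path_image_def)
  show "continuous_on {\<beta>..} (\<lambda>\<mu>. F (complex_of_real \<mu>))"
    by (rule continuous_on_compose2[OF assms continuous_on_of_real[OF continuous_on_id]])
      (auto simp: contour_set_def)
qed

lemma cont_along_scaleC:
  fixes F :: "complex \<Rightarrow> 'b::complex_normed_vector"
  shows "cont_along c \<Longrightarrow> cont_along F \<Longrightarrow> cont_along (\<lambda>\<mu>. c \<mu> *\<^sub>C F \<mu>)"
  unfolding cont_along_def by (auto intro: continuous_on_scaleC)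

lemma cont_along_diff:
  fixes F G :: "complex \<Rightarrow> 'b::real_normed_vector"
  shows "cont_along F \<Longrightarrow> cont_along G \<Longrightarrow> cont_along (\<lambda>\<mu>. F \<mu> - G \<mu>)"
  by (simp add: cont_along_def continuous_on_diff)

lemma open_contour_subset: "\<mu> \<in> open_contour \<Longrightarrow> \<mu> \<in> contour_set g \<beta>"
  by (auto simp: open_contour_def contour_set_def path_image_def)

lemma contour_integrable_along:
  fixes F :: "complex \<Rightarrow> 'b::{complex_normed_vector, banach}"
  assumes "0 \<le> C" "cont_along F" "\<And>\<mu>. \<mu> \<in> contour_set g \<beta> \<Longrightarrow> norm (F \<mu>) \<le> C * w \<mu>"
  shows "contour_integrable g \<beta> F" "norm (contour_int g \<beta> F) \<le> C * wtotal"
  using contour_integrable_bound[OF assms(1), of F] assms(2,3) open_contour_subset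
  by (auto simp: cont_along_def)

text \<open>Both factorizations at once: \<open>h\<close> is multiplication by \<open>Z\<close> from the right or from the left,
  and \<open>Q\<close> is the product of \<open>K'\<close> and the resolvent of \<open>Z\<close> in the corresponding order.\<close>

lemma factorization:
  fixes K' Q :: "complex \<Rightarrow> 'a::complex_hilbert \<Rightarrow>\<^sub>C\<^sub>L 'a" and N :: "complex set"
  assumes d: "0 < d" "\<forall>\<mu>\<in>contour_set g \<beta>. d \<le> infdist \<mu> N"
    and w: "\<And>\<mu>. w \<mu> = norm (K' \<mu>) / infdist \<mu> N"
    and K': "cont_along K'"
    and v: "wtotal < 1" "wtotal * a < 1/4 * d * (1 - wtotal)\<^sup>2"
    and a: "0 \<le> a" "\<forall>z. cmod z \<le> a + infdist z N"
    and \<rho>: "0 \<le> \<rho>" "\<rho> \<le> 1/2 * d * (1 - wtotal)"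
    and Q: "cont_along Q" "\<forall>\<mu>\<in>contour_set g \<beta>. norm (Q \<mu>) \<le> norm (K' \<mu>) / (infdist \<mu> N - \<rho>)"
    and h: "clinear_bounded h" "\<forall>\<mu>\<in>contour_set g \<beta>. h (Q \<mu>) - \<mu> *\<^sub>C Q \<mu> = K' \<mu>"
    and z: "z \<notin> contour_set g \<beta>"
  defines "W \<equiv> id_cblinfun - contour_int g \<beta> Q + z *\<^sub>C contour_int g \<beta> (\<lambda>\<mu>. inverse (z - \<mu>) *\<^sub>C Q \<mu>)"
  shows "contour_integrable g \<beta> (\<lambda>\<mu>. (z / (z - \<mu>)) *\<^sub>C K' \<mu>)"
    and "contour_integrable g \<beta> Q"
    and "contour_integrable g \<beta> (\<lambda>\<mu>. inverse (z - \<mu>) *\<^sub>C Q \<mu>)"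
    and "h W - z *\<^sub>C W = h id_cblinfun - z *\<^sub>C id_cblinfun - contour_int g \<beta> (\<lambda>\<mu>. h (Q \<mu>))
           + contour_int g \<beta> (\<lambda>\<mu>. (z / (z - \<mu>)) *\<^sub>C K' \<mu>)"
    and "infdist z N \<le> 1/2 * d * (1 - wtotal) \<Longrightarrow> norm (W - id_cblinfun) < 1"
proof -
  let ?G = "contour_set g \<beta>"
  note d = d(1) bspec[OF d(2)] and a = a(1) spec[OF a(2)]
    and Q = Q(1) bspec[OF Q(2)] and h = h(1) bspec[OF h(2)]
  have v0: "0 \<le> wtotal" by (simp add: wtotal_def)
  have "\<rho> \<le> 1/2 * d"
  proof -
    have "0 \<le> d * wtotal" using d(1) v0 by simp
    then show ?thesis using \<rho>(2) unfolding right_diff_distrib by linarith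
  qed
  then have d\<rho>: "0 < d - \<rho>" using d(1) by simp
  have ne: "?G \<noteq> {}" by (auto simp: contour_set_def)
  \<comment> \<open>Positive because the contour is closed.\<close>
  define r where "r = infdist z ?G"
  have r: "0 < r" "\<And>\<mu>. \<mu> \<in> ?G \<Longrightarrow> r \<le> cmod (z - \<mu>)"
    using in_closed_iff_infdist_zero[OF closed_contour_set[OF cont] ne, of z] z infdist_nonneg[of z ?G]
      infdist_le[of _ ?G z] by (auto simp: r_def dist_norm less_le)
  have nz: "z - \<mu> \<noteq> 0" if "\<mu> \<in> ?G" for \<mu> using that z by auto
  have \<delta>: "0 < infdist \<mu> N" if "\<mu> \<in> ?G" for \<mu> using d(2)[OF that] d(1) by simp
  \<comment> \<open>As dist(\<mu>, N) is at least d, replacing dist - \<rho> by dist in the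
    denominator costs at most this factor, and \<open>Q\<close> becomes dominated by the
    weight.\<close>
  define q where "q = d / (d - \<rho>)"
  have q: "0 \<le> q" using d d\<rho> by (simp add: q_def)
  have Qw: "norm (Q \<mu>) \<le> q * w \<mu>" if \<mu>: "\<mu> \<in> ?G" for \<mu>
  proof -
    have "d * (infdist \<mu> N - \<rho>) \<ge> (d - \<rho>) * infdist \<mu> N"
      using mult_left_mono[OF d(2)[OF \<mu>] \<rho>(1)] by (simp add: algebra_simps)
    then have 1: "1 / (infdist \<mu> N - \<rho>) \<le> d / ((d - \<rho>) * infdist \<mu> N)"
      using d\<rho> d(1) d(2)[OF \<mu>] by (simp add: field_simps)
    have "norm (Q \<mu>) \<le> norm (K' \<mu>) * (1 / (infdist \<mu> N - \<rho>))"
      using Q(2)[OF \<mu>] by simp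
    also have "\<dots> \<le> norm (K' \<mu>) * (d / ((d - \<rho>) * infdist \<mu> N))"
      using 1 by (rule mult_left_mono) simp
    also have "\<dots> = q * w \<mu>" by (simp add: q_def w field_simps)
    finally show ?thesis .
  qed
  have cz: "continuous_on ?G (\<lambda>\<mu>. inverse (z - \<mu>))" "continuous_on ?G (\<lambda>\<mu>. z / (z - \<mu>))"
    using nz by (auto intro!: continuous_intros)
  \<comment> \<open>\<open>K'\<close> alone need not be dominated by the weight, in which it is
    divided by a distance growing along the ray. The factor 1/(z - \<mu>) compensates, since
    dist(\<mu>, N) \<le> dist(z, N) + |z - \<mu>|.\<close>
  show iV: "contour_integrable g \<beta> (\<lambda>\<mu>. (z / (z - \<mu>)) *\<^sub>C K' \<mu>)"
  proof (rule contour_integrable_along(1))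
    show "0 \<le> cmod z * (infdist z N / r + 1)" using r(1) by (simp add: infdist_nonneg)
    show "cont_along (\<lambda>\<mu>. (z / (z - \<mu>)) *\<^sub>C K' \<mu>)"
      by (intro cont_along_scaleC cont_along_contour_set cz K')
    fix \<mu> assume \<mu>: "\<mu> \<in> ?G"
    have "infdist \<mu> N / cmod (z - \<mu>) \<le> (infdist z N + cmod (z - \<mu>)) / cmod (z - \<mu>)"
      using infdist_triangle[of \<mu> N z] by (intro divide_right_mono) (auto simp: dist_norm norm_minus_commute)
    also have "\<dots> = infdist z N / cmod (z - \<mu>) + 1"
      using nz[OF \<mu>] by (simp add: add_divide_distrib)
    also have "\<dots> \<le> infdist z N / r + 1"
      using r(1) r(2)[OF \<mu>] nz[OF \<mu>] by (intro add_right_mono divide_left_mono) (auto simp: infdist_nonneg)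
    finally have "infdist \<mu> N / cmod (z - \<mu>) \<le> infdist z N / r + 1" .
    then have "cmod z * (infdist \<mu> N / cmod (z - \<mu>)) * w \<mu> \<le> cmod z * (infdist z N / r + 1) * w \<mu>"
      by (intro mult_right_mono mult_left_mono weight_nonneg) auto
    moreover have "norm ((z / (z - \<mu>)) *\<^sub>C K' \<mu>) = cmod z * (infdist \<mu> N / cmod (z - \<mu>)) * w \<mu>"
      using \<delta>[OF \<mu>] by (simp add: norm_scaleC norm_divide w)
    ultimately show "norm ((z / (z - \<mu>)) *\<^sub>C K' \<mu>) \<le> cmod z * (infdist z N / r + 1) * w \<mu>" by simp
  qed
  show iQ: "contour_integrable g \<beta> Q"
    by (rule contour_integrable_along(1)[OF q Q(1) Qw])
  show iR: "contour_integrable g \<beta> (\<lambda>\<mu>. inverse (z - \<mu>) *\<^sub>C Q \<mu>)"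
  proof (rule contour_integrable_along(1))
    show "0 \<le> 1 / r * q" using r(1) q by simp
    show "cont_along (\<lambda>\<mu>. inverse (z - \<mu>) *\<^sub>C Q \<mu>)"
      by (intro cont_along_scaleC cont_along_contour_set cz Q)
    fix \<mu> assume \<mu>: "\<mu> \<in> ?G"
    have "1 / cmod (z - \<mu>) \<le> 1 / r"
      using r(1) r(2)[OF \<mu>] by (simp add: frac_le)
    then have "1 / cmod (z - \<mu>) * norm (Q \<mu>) \<le> 1 / r * (q * w \<mu>)"
      using r(1) Qw[OF \<mu>] by (intro mult_mono) auto
    then show "norm (inverse (z - \<mu>) *\<^sub>C Q \<mu>) \<le> 1 / r * q * w \<mu>"
      by (simp add: norm_scaleC norm_inverse divide_inverse mult.assoc)
  qed
  define P0 where "P0 = contour_int g \<beta> Q"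
  define P1 where "P1 = contour_int g \<beta> (\<lambda>\<mu>. inverse (z - \<mu>) *\<^sub>C Q \<mu>)"
  define V where "V = contour_int g \<beta> (\<lambda>\<mu>. (z / (z - \<mu>)) *\<^sub>C K' \<mu>)"
  have hQ: "has_contour_int g \<beta> Q P0" and hR: "has_contour_int g \<beta> (\<lambda>\<mu>. inverse (z - \<mu>) *\<^sub>C Q \<mu>) P1"
    and hV: "has_contour_int g \<beta> (\<lambda>\<mu>. (z / (z - \<mu>)) *\<^sub>C K' \<mu>) V"
    unfolding P0_def P1_def V_def by (intro has_contour_int_contour_int iQ iR iV)+
  have hsc: "h (c *\<^sub>C T) = c *\<^sub>C h T" for c T using h(1) by (simp add: clinear_bounded_def)
  have lin: "linear h" using h(1) by (auto simp: clinear_bounded_def bounded_linear.linear)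
  have hX: "contour_int g \<beta> (\<lambda>\<mu>. h (Q \<mu>)) = h P0"
    by (rule contour_int_eq[OF has_contour_int_linear[OF h(1) hQ]])
  note zQ = has_contour_int_linear[OF clinear_bounded_scaleC[of z] hQ]
  note zR = has_contour_int_linear[OF clinear_bounded_scaleC[of z] hR]
  \<comment> \<open>The map T \<mapsto> h T - z T is applied to the last term of W under the
    integral. Since h Q = K' + \<mu> Q, the coefficient of Q becomes z \<mu>/(z - \<mu>) - z^2/(z -
    \<mu>) = -z, which leaves the integrand of V minus z Q.\<close>
  have "has_contour_int g \<beta> (\<lambda>\<mu>. h (z *\<^sub>C inverse (z - \<mu>) *\<^sub>C Q \<mu>) - z *\<^sub>C z *\<^sub>C inverse (z - \<mu>) *\<^sub>C Q \<mu>)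
      (h (z *\<^sub>C P1) - z *\<^sub>C z *\<^sub>C P1)"
    by (intro has_contour_int_diff has_contour_int_linear[OF h(1) zR]
        has_contour_int_linear[OF clinear_bounded_scaleC[of z] zR])
  moreover have "h (z *\<^sub>C inverse (z - \<mu>) *\<^sub>C Q \<mu>) - z *\<^sub>C z *\<^sub>C inverse (z - \<mu>) *\<^sub>C Q \<mu>
      = (z / (z - \<mu>)) *\<^sub>C K' \<mu> - z *\<^sub>C Q \<mu>" if \<mu>: "\<mu> \<in> ?G" for \<mu>
  proof -
    have hK: "h (Q \<mu>) = K' \<mu> + \<mu> *\<^sub>C Q \<mu>"
      using h(2)[OF \<mu>] by (simp add: algebra_simps)
    have c: "z * (inverse (z - \<mu>) * \<mu>) - z * (z * inverse (z - \<mu>)) = - z"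
    proof -
      have "z * (inverse (z - \<mu>) * \<mu>) - z * (z * inverse (z - \<mu>)) = - z * (inverse (z - \<mu>) * (z - \<mu>))"
        unfolding right_diff_distrib by (simp add: mult_ac)
      then show ?thesis using nz[OF \<mu>] by simp
    qed
    have "h (z *\<^sub>C inverse (z - \<mu>) *\<^sub>C Q \<mu>) - z *\<^sub>C z *\<^sub>C inverse (z - \<mu>) *\<^sub>C Q \<mu>
        = (z * inverse (z - \<mu>)) *\<^sub>C K' \<mu> + (z * (inverse (z - \<mu>) * \<mu>) - z * (z * inverse (z - \<mu>))) *\<^sub>C Q \<mu>"
      by (simp add: hsc hK scaleC_scaleC scaleC_add_right scaleC_diff_left mult.assoc)
    then show ?thesis
      unfolding c by (simp add: scaleC_minus_left divide_inverse)
  qed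
  ultimately have "has_contour_int g \<beta> (\<lambda>\<mu>. (z / (z - \<mu>)) *\<^sub>C K' \<mu> - z *\<^sub>C Q \<mu>)
      (h (z *\<^sub>C P1) - z *\<^sub>C z *\<^sub>C P1)"
    by (rule has_contour_int_cong[rotated])
  from contour_int_eq[OF this] contour_int_eq[OF has_contour_int_diff[OF hV zQ]]
  have key: "h (z *\<^sub>C P1) - z *\<^sub>C z *\<^sub>C P1 = V - z *\<^sub>C P0" by simp
  have W: "W = id_cblinfun - P0 + z *\<^sub>C P1" by (simp add: W_def P0_def P1_def)
  have "h W - z *\<^sub>C W = h id_cblinfun - z *\<^sub>C id_cblinfun - h P0 + z *\<^sub>C P0 + (h (z *\<^sub>C P1) - z *\<^sub>C z *\<^sub>C P1)"
    unfolding W by (simp add: linear_add[OF lin] linear_diff[OF lin] scaleC_add_right scaleC_diff_right algebra_simps)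
  then show "h W - z *\<^sub>C W = h id_cblinfun - z *\<^sub>C id_cblinfun - contour_int g \<beta> (\<lambda>\<mu>. h (Q \<mu>))
      + contour_int g \<beta> (\<lambda>\<mu>. (z / (z - \<mu>)) *\<^sub>C K' \<mu>)"
    unfolding key hX V_def[symmetric] by (simp add: algebra_simps)
  assume near: "infdist z N \<le> 1/2 * d * (1 - wtotal)"
  \<comment> \<open>What remains of dist(\<mu>, N) \<ge> d after subtracting dist(z, N) \<le> d(1 -
    v)/2, with v = \<open>wtotal\<close>: a lower bound for |z - \<mu>| on the contour.\<close>
  have half: "0 < 1/2 * d * (1 + wtotal)" using d(1) v0 by simp
  define C where "C = q * (1 + cmod z / (1/2 * d * (1 + wtotal)))"
  have C: "0 \<le> C" using q half by (simp add: C_def)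
  \<comment> \<open>W - I is estimated as the single integral of (z/(z - \<mu>) - 1) Q.\<close>
  have "norm (contour_int g \<beta> (\<lambda>\<mu>. z *\<^sub>C inverse (z - \<mu>) *\<^sub>C Q \<mu> - Q \<mu>)) \<le> C * wtotal"
  proof (rule contour_integrable_along(2)[OF C])
    show "cont_along (\<lambda>\<mu>. z *\<^sub>C inverse (z - \<mu>) *\<^sub>C Q \<mu> - Q \<mu>)"
      by (intro cont_along_diff cont_along_scaleC cont_along_contour_set cz Q continuous_intros)
    fix \<mu> assume \<mu>: "\<mu> \<in> ?G"
    have "1/2 * d * (1 + wtotal) \<le> cmod (z - \<mu>)"
      using infdist_triangle[of \<mu> N z] d(2)[OF \<mu>] near
      by (simp add: dist_norm norm_minus_commute algebra_simps)
    then have "cmod z / cmod (z - \<mu>) \<le> cmod z / (1/2 * d * (1 + wtotal))"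
      by (intro frac_le[OF _ order_refl half]) auto
    then have "(1 + cmod z / cmod (z - \<mu>)) * norm (Q \<mu>) \<le> (1 + cmod z / (1/2 * d * (1 + wtotal))) * (q * w \<mu>)"
      using Qw[OF \<mu>] half by (intro mult_mono) auto
    moreover have "norm (z *\<^sub>C inverse (z - \<mu>) *\<^sub>C Q \<mu> - Q \<mu>) \<le> (1 + cmod z / cmod (z - \<mu>)) * norm (Q \<mu>)"
      using norm_triangle_ineq4[of "z *\<^sub>C inverse (z - \<mu>) *\<^sub>C Q \<mu>" "Q \<mu>"]
      by (simp add: norm_scaleC norm_inverse divide_inverse algebra_simps)
    ultimately show "norm (z *\<^sub>C inverse (z - \<mu>) *\<^sub>C Q \<mu> - Q \<mu>) \<le> C * w \<mu>"
      by (simp add: C_def mult_ac)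
  qed
  also have "C * wtotal < 1"
    unfolding C_def q_def using a near order_trans[OF a(2)[of z]]
    by (intro factor_norm_estimate[OF d(1) v0 v(1) \<rho>(2) a(1) v(2)]) auto
  finally show "norm (W - id_cblinfun) < 1"
    using contour_int_eq[OF has_contour_int_diff[OF zR hQ]] by (simp add: W)
qed

end

section \<open>Resolvents and factorizations along an admissible contour\<close>

lemma connected_contour_set:
  assumes "path g" "pathfinish g = complex_of_real \<beta>"
  shows "connected (contour_set g \<beta>)"
  unfolding contour_set_def
proof (rule connected_Un)
  show "connected (path_image g)"
    by (rule connected_path_image[OF assms(1)])
  show "connected (complex_of_real ` {\<beta>..})"
    by (intro connected_continuous_image continuous_intros) simp
  show "path_image g \<inter> complex_of_real ` {\<beta>..} \<noteq> {}"
    using pathfinish_in_path_image[of g] assms(2) by auto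
qed

locale transfer_contour =
  fixes At :: "'a::complex_hilbert \<Rightarrow>\<^sub>C\<^sub>L 'a" and K' :: "complex \<Rightarrow> 'a \<Rightarrow>\<^sub>C\<^sub>L 'a"
    and \<beta> :: real and g :: "real \<Rightarrow> complex"
  assumes arc: "rectifiable_arc g" and finish: "pathfinish g = complex_of_real \<beta>"
    and K'_curve: "continuous_on {0<..<1} (\<lambda>t. K' (g t))"
    and K'_ray: "continuous_on {\<beta>..} (\<lambda>\<mu>. K' (complex_of_real \<mu>))"
    and dist_pos: "contour_dist At \<beta> g > 0" and Var_less: "Var_K At K' \<beta> g < 1"
    and Var_small: "enn2real (Var_K At K' \<beta> g) * norm At
       < 1/4 * contour_dist At \<beta> g * (1 - enn2real (Var_K At K' \<beta> g))\<^sup>2"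
begin

abbreviation N :: "complex set" where "N \<equiv> numerical_range_closure At"
abbreviation d :: real where "d \<equiv> contour_dist At \<beta> g"
abbreviation v :: real where "v \<equiv> enn2real (Var_K At K' \<beta> g)"

text \<open>\<open>setdist\<close> from the empty set is \<open>0\<close> by convention, so a
  positive \<open>d\<close> excludes an empty numerical range, which is the case of the zero
  space.\<close>

lemma N_nonempty: "N \<noteq> {}"
  using dist_pos by (auto simp: contour_dist_def)

lemma d_le: "\<mu> \<in> contour_set g \<beta> \<Longrightarrow> d \<le> infdist \<mu> N" for \<mu>
  unfolding infdist_notempty[OF N_nonempty] contour_dist_def
  by (intro cINF_greatest[OF N_nonempty]) (metis dist_commute setdist_le_dist)

lemma d_le_all: "\<forall>\<mu>\<in>contour_set g \<beta>. d \<le> infdist \<mu> N"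
  using d_le by blast

lemma path_g: "path g"
  using arc by (simp add: rectifiable_arc_def arc_imp_path)

sublocale rectifiable_path g
  using arc path_g by unfold_locales (simp_all add: rectifiable_arc_def path_def)

lemma infdist_N_pos: "\<mu> \<in> contour_set g \<beta> \<Longrightarrow> infdist \<mu> N \<noteq> 0"
  using d_le[of \<mu>] dist_pos by auto

sublocale weighted_contour g \<beta> "\<lambda>\<mu>. norm (K' \<mu>) / infdist \<mu> N"
proof
  show "continuous_on {0<..<1} (\<lambda>t. norm (K' (g t)) / infdist (g t) N)"
    using infdist_N_pos
    by (intro continuous_on_divide continuous_on_norm K'_curve continuous_on_infdist continuous_on_subset[OF cont])
      (auto simp: contour_set_def path_image_def)
  show "continuous_on {\<beta>..} (\<lambda>\<mu>. norm (K' (complex_of_real \<mu>)) / infdist (complex_of_real \<mu>) N)"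
    using infdist_N_pos
    by (intro continuous_on_divide continuous_on_norm K'_ray continuous_on_infdist continuous_intros)
      (auto simp: contour_set_def)
  show "0 \<le> norm (K' \<mu>) / infdist \<mu> N" for \<mu> by (simp add: infdist_nonneg)
  have "Var_K At K' \<beta> g < \<infinity>" using Var_less by (rule less_trans) simp
  then show "(\<integral>\<^sup>+t\<in>{0..1}. ennreal (norm (K' (g t)) / infdist (g t) N) \<partial>arclength_measure g) < \<infinity>"
    "(\<integral>\<^sup>+\<mu>\<in>{\<beta>..}. ennreal (norm (K' (complex_of_real \<mu>)) / infdist (complex_of_real \<mu>) N) \<partial>lborel) < \<infinity>"
    unfolding Var_K_def by (simp_all add: less_top[symmetric])
qed

lemma wtotal_eq: "wtotal = v"
  unfolding wtotal_def Var_K_def ..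

lemma v_less: "v < 1"
  using Var_less by (cases "Var_K At K' \<beta> g") (simp_all add: ennreal_less_one_iff)

lemma half_less: "1/2 * d * (1 - v) < d"
  using dist_pos v_less enn2real_nonneg[of "Var_K At K' \<beta> g"]
    mult_nonneg_nonneg[of d v] unfolding right_diff_distrib by linarith

lemma cont_along_K': "cont_along K'"
  unfolding cont_along_def using K'_curve K'_ray ..

lemma cont_along_compose:
  fixes F :: "complex \<Rightarrow> 'b::complex_normed_vector \<Rightarrow>\<^sub>C\<^sub>L 'c::complex_normed_vector"
    and G :: "complex \<Rightarrow> 'd::complex_normed_vector \<Rightarrow>\<^sub>C\<^sub>L 'b"
  shows "cont_along F \<Longrightarrow> cont_along G \<Longrightarrow> cont_along (\<lambda>\<mu>. F \<mu> o\<^sub>C\<^sub>L G \<mu>)"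
  unfolding cont_along_def by (auto intro: continuous_on_cblinfun_compose)

lemma norm_At_bound: "cmod z \<le> norm At + infdist z N"
  by (rule cmod_le_infdist_numerical_range[OF N_nonempty])

context
  fixes X Z assumes X: "norm X \<le> 1/2 * d * (1 - v)" and Z: "Z = At + X"
begin

definition Res :: "complex \<Rightarrow> 'a \<Rightarrow>\<^sub>C\<^sub>L 'a" where
  "Res \<mu> = cblinfun_inv (Z - \<mu> *\<^sub>C id_cblinfun)"

lemma below: "(infdist \<mu> N - norm X) * norm x \<le> norm (cblinfun_apply (Z - \<mu> *\<^sub>C id_cblinfun) x)"
  unfolding Z by (rule numerical_range_lower_bound)

lemma below_uniform:
  assumes "\<mu> \<in> contour_set g \<beta>"
  shows "(d - norm X) * norm x \<le> norm (cblinfun_apply (Z - \<mu> *\<^sub>C id_cblinfun) x)"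
proof -
  have "(d - norm X) * norm x \<le> (infdist \<mu> N - norm X) * norm x"
    using d_le[OF assms] by (intro mult_right_mono) auto
  then show ?thesis using below[of \<mu> x] by linarith
qed

lemma gap: "0 < d - norm X"
  using X half_less by simp

lemma invertible:
  assumes "\<mu> \<in> contour_set g \<beta>"
  shows "boundedly_invertible (Z - \<mu> *\<^sub>C id_cblinfun)"
proof (rule boundedly_invertible_connected[OF connected_contour_set[OF path_g finish] gap below_uniform])
  \<comment> \<open>The ray reaches beyond \<open>norm Z\<close>; the continuation of the resolvent
    starts there.\<close>
  let ?x = "max \<beta> (norm Z + 1)"
  show "complex_of_real ?x \<in> contour_set g \<beta>"
    by (auto simp: contour_set_def)
  have "norm Z < \<bar>?x\<bar>" by linarith
  then show "norm Z < cmod (complex_of_real ?x)" by (simp only: norm_of_real)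
qed (use assms in auto)

lemma Res_inverse:
  assumes "\<mu> \<in> contour_set g \<beta>"
  shows "(Z - \<mu> *\<^sub>C id_cblinfun) o\<^sub>C\<^sub>L Res \<mu> = id_cblinfun" "Res \<mu> o\<^sub>C\<^sub>L (Z - \<mu> *\<^sub>C id_cblinfun) = id_cblinfun"
  using is_cblinfun_inverse_inv[OF invertible[OF assms]] by (auto simp: is_cblinfun_inverse_def Res_def)

lemma Res_eqs:
  assumes "\<mu> \<in> contour_set g \<beta>"
  shows "Z o\<^sub>C\<^sub>L Res \<mu> = id_cblinfun + \<mu> *\<^sub>C Res \<mu>" "Res \<mu> o\<^sub>C\<^sub>L Z = id_cblinfun + \<mu> *\<^sub>C Res \<mu>"
  using Res_inverse[OF assms] by (simp_all add: cblinfun_compose_simps diff_eq_eq)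

lemma norm_Res:
  assumes "\<mu> \<in> contour_set g \<beta>"
  shows "norm (Res \<mu>) \<le> 1 / (infdist \<mu> N - norm X)"
  unfolding Res_def using gap d_le[OF assms]
  by (intro norm_cblinfun_inv_le[OF invertible[OF assms]] below) simp

lemma cont_along_Res: "cont_along Res"
  unfolding Res_def
  by (intro cont_along_contour_set continuous_on_resolvent[OF gap] below_uniform invertible)

lemma norm_prod_Res:
  assumes "\<mu> \<in> contour_set g \<beta>"
  shows "norm (K' \<mu> o\<^sub>C\<^sub>L Res \<mu>) \<le> norm (K' \<mu>) / (infdist \<mu> N - norm X)"
    "norm (Res \<mu> o\<^sub>C\<^sub>L K' \<mu>) \<le> norm (K' \<mu>) / (infdist \<mu> N - norm X)"
proof -
  have "norm (K' \<mu>) * norm (Res \<mu>) \<le> norm (K' \<mu>) * (1 / (infdist \<mu> N - norm X))"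
    by (intro mult_left_mono norm_Res assms) simp
  then show "norm (K' \<mu> o\<^sub>C\<^sub>L Res \<mu>) \<le> norm (K' \<mu>) / (infdist \<mu> N - norm X)"
    "norm (Res \<mu> o\<^sub>C\<^sub>L K' \<mu>) \<le> norm (K' \<mu>) / (infdist \<mu> N - norm X)"
    using norm_cblinfun_compose[of "K' \<mu>" "Res \<mu>"] norm_cblinfun_compose[of "Res \<mu>" "K' \<mu>"]
    by (simp_all add: mult.commute)
qed

text \<open>The parameters become \<open>a = norm At\<close> and \<open>\<rho> = norm X\<close>, and
  the weight is the integrand of \<open>Var_K\<close>.\<close>

lemmas factorization' = factorization[OF dist_pos d_le_all refl cont_along_K', unfolded wtotal_eq,
    OF v_less Var_small norm_ge_zero allI[OF norm_At_bound] norm_ge_zero X]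

lemma right_factorization:
  assumes fix_X: "X = V_right K' \<beta> g Z" and z: "z \<notin> contour_set g \<beta>"
  shows "contour_integrable g \<beta> (\<lambda>\<mu>. (z / (z - \<mu>)) *\<^sub>C K' \<mu>)"
    and "contour_integrable g \<beta> (\<lambda>\<mu>. K' \<mu> o\<^sub>C\<^sub>L Res \<mu>)"
    and "contour_integrable g \<beta> (\<lambda>\<mu>. inverse (z - \<mu>) *\<^sub>C (K' \<mu> o\<^sub>C\<^sub>L Res \<mu>))"
    and "M_fun At K' \<beta> g z = W_right K' \<beta> g Z z o\<^sub>C\<^sub>L (Z - z *\<^sub>C id_cblinfun)"
    and "infdist z N \<le> 1/2 * d * (1 - v) \<Longrightarrow> norm (W_right K' \<beta> g Z z - id_cblinfun) < 1"
proof -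
  let ?Q = "\<lambda>\<mu>. K' \<mu> o\<^sub>C\<^sub>L Res \<mu>" and ?h = "\<lambda>T. T o\<^sub>C\<^sub>L Z"
  have hQ: "\<forall>\<mu>\<in>contour_set g \<beta>. ?h (?Q \<mu>) - \<mu> *\<^sub>C ?Q \<mu> = K' \<mu>"
    using Res_eqs(2) by (simp add: cblinfun_compose_assoc cblinfun_compose_simps)
  have norm_Q: "\<forall>\<mu>\<in>contour_set g \<beta>. norm (?Q \<mu>) \<le> norm (K' \<mu>) / (infdist \<mu> N - norm X)"
    using norm_prod_Res(1) by blast
  note F = factorization'[OF cont_along_compose[OF cont_along_K' cont_along_Res] norm_Q
      clinear_bounded_compose_right hQ z]
  show "contour_integrable g \<beta> (\<lambda>\<mu>. (z / (z - \<mu>)) *\<^sub>C K' \<mu>)"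
    and iQ: "contour_integrable g \<beta> ?Q"
    and "contour_integrable g \<beta> (\<lambda>\<mu>. inverse (z - \<mu>) *\<^sub>C (K' \<mu> o\<^sub>C\<^sub>L Res \<mu>))"
    using F(1-3) by blast+
  have W: "W_right K' \<beta> g Z z = id_cblinfun - contour_int g \<beta> ?Q
      + z *\<^sub>C contour_int g \<beta> (\<lambda>\<mu>. inverse (z - \<mu>) *\<^sub>C ?Q \<mu>)"
    by (simp add: W_right_def Res_def)
  show "infdist z N \<le> 1/2 * d * (1 - v) \<Longrightarrow> norm (W_right K' \<beta> g Z z - id_cblinfun) < 1"
    unfolding W by (rule F(5))
  \<comment> \<open>\<open>V_right\<close> has \<open>Z\<close> on the left of the resolvent and
    \<open>?h (?Q \<mu>)\<close> has it on the right; the two integrands agree because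
    \<open>Z\<close> commutes with its resolvent.\<close>
  have "contour_integrable g \<beta> (\<lambda>\<mu>. ?h (?Q \<mu>))"
    by (rule contour_integrableI[OF has_contour_int_linear[OF clinear_bounded_compose_right
          has_contour_int_contour_int[OF iQ]]])
  moreover have "?h (?Q \<mu>) = K' \<mu> o\<^sub>C\<^sub>L Z o\<^sub>C\<^sub>L Res \<mu>" if "\<mu> \<in> contour_set g \<beta>" for \<mu>
    using Res_eqs[OF that] by (simp add: cblinfun_compose_assoc)
  ultimately have "contour_int g \<beta> (\<lambda>\<mu>. K' \<mu> o\<^sub>C\<^sub>L Z o\<^sub>C\<^sub>L Res \<mu>) = contour_int g \<beta> (\<lambda>\<mu>. ?h (?Q \<mu>))"
    by (rule contour_int_cong[rotated])
  then have X_eq: "contour_int g \<beta> (\<lambda>\<mu>. ?h (?Q \<mu>)) = X"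
    using fix_X unfolding V_right_def Res_def[symmetric] by metis
  have "W_right K' \<beta> g Z z o\<^sub>C\<^sub>L (Z - z *\<^sub>C id_cblinfun) = ?h (W_right K' \<beta> g Z z) - z *\<^sub>C W_right K' \<beta> g Z z"
    by (simp add: cblinfun_compose_simps)
  also have "\<dots> = Z - z *\<^sub>C id_cblinfun - X + V_fun K' \<beta> g z"
    using F(4) unfolding W[symmetric] X_eq V_fun_def cblinfun_compose_id .
  also have "\<dots> = M_fun At K' \<beta> g z"
    unfolding M_fun_def Z by simp
  finally show "M_fun At K' \<beta> g z = W_right K' \<beta> g Z z o\<^sub>C\<^sub>L (Z - z *\<^sub>C id_cblinfun)" ..
qed

lemma left_factorization:
  assumes fix_X: "X = V_left K' \<beta> g Z" and z: "z \<notin> contour_set g \<beta>"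
  shows "contour_integrable g \<beta> (\<lambda>\<mu>. Res \<mu> o\<^sub>C\<^sub>L K' \<mu>)"
    and "contour_integrable g \<beta> (\<lambda>\<mu>. inverse (z - \<mu>) *\<^sub>C (Res \<mu> o\<^sub>C\<^sub>L K' \<mu>))"
    and "M_fun At K' \<beta> g z = (Z - z *\<^sub>C id_cblinfun) o\<^sub>C\<^sub>L W_left K' \<beta> g Z z"
    and "infdist z N \<le> 1/2 * d * (1 - v) \<Longrightarrow> norm (W_left K' \<beta> g Z z - id_cblinfun) < 1"
proof -
  let ?Q = "\<lambda>\<mu>. Res \<mu> o\<^sub>C\<^sub>L K' \<mu>" and ?h = "\<lambda>T. Z o\<^sub>C\<^sub>L T"
  have hQ: "\<forall>\<mu>\<in>contour_set g \<beta>. ?h (?Q \<mu>) - \<mu> *\<^sub>C ?Q \<mu> = K' \<mu>"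
    using Res_eqs(1) by (simp add: cblinfun_compose_assoc[symmetric] cblinfun_compose_simps)
  have norm_Q: "\<forall>\<mu>\<in>contour_set g \<beta>. norm (?Q \<mu>) \<le> norm (K' \<mu>) / (infdist \<mu> N - norm X)"
    using norm_prod_Res(2) by blast
  note F = factorization'[OF cont_along_compose[OF cont_along_Res cont_along_K'] norm_Q
      clinear_bounded_compose_left hQ z]
  show iQ: "contour_integrable g \<beta> ?Q"
    and "contour_integrable g \<beta> (\<lambda>\<mu>. inverse (z - \<mu>) *\<^sub>C (Res \<mu> o\<^sub>C\<^sub>L K' \<mu>))"
    using F(2,3) by blast+
  have W: "W_left K' \<beta> g Z z = id_cblinfun - contour_int g \<beta> ?Q
      + z *\<^sub>C contour_int g \<beta> (\<lambda>\<mu>. inverse (z - \<mu>) *\<^sub>C ?Q \<mu>)"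
    by (simp add: W_left_def Res_def)
  show "infdist z N \<le> 1/2 * d * (1 - v) \<Longrightarrow> norm (W_left K' \<beta> g Z z - id_cblinfun) < 1"
    unfolding W by (rule F(5))
  \<comment> \<open>Here the integrand of \<open>V_left\<close> already is
    \<open>?h (?Q \<mu>)\<close> up to associativity.\<close>
  have X_eq: "contour_int g \<beta> (\<lambda>\<mu>. ?h (?Q \<mu>)) = X"
    using fix_X unfolding V_left_def Res_def[symmetric] cblinfun_compose_assoc by (rule sym)
  have "(Z - z *\<^sub>C id_cblinfun) o\<^sub>C\<^sub>L W_left K' \<beta> g Z z = ?h (W_left K' \<beta> g Z z) - z *\<^sub>C W_left K' \<beta> g Z z"
    by (simp add: cblinfun_compose_simps)
  also have "\<dots> = Z - z *\<^sub>C id_cblinfun - X + V_fun K' \<beta> g z"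
    using F(4) unfolding W[symmetric] X_eq V_fun_def cblinfun_compose_id .
  also have "\<dots> = M_fun At K' \<beta> g z"
    unfolding M_fun_def Z by simp
  finally show "M_fun At K' \<beta> g z = (Z - z *\<^sub>C id_cblinfun) o\<^sub>C\<^sub>L W_left K' \<beta> g Z z" ..
qed

end

end

text \<open>By admissibility the discriminant lies between 0 and (d(1 - v)/2)^2, so its root is at
  most d(1 - v)/2. Nonnegativity of the radii is what makes \<open>r_zero\<close> a genuine
  infimum.\<close>

lemma r_min_bounds:
  assumes "admissible_contour At K' lamC \<beta> \<D> l g"
  shows "0 \<le> r_min At K' \<beta> g"
    "r_min At K' \<beta> g \<le> 1/2 * contour_dist At \<beta> g * (1 - enn2real (Var_K At K' \<beta> g))"
proof -
  define d v where "d = contour_dist At \<beta> g" and "v = enn2real (Var_K At K' \<beta> g)"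
  have "Var_K At K' \<beta> g < 1" and d: "0 < d" and "v * norm At < 1/4 * d * (1 - v)\<^sup>2"
    using assms by (auto simp: admissible_contour_def d_def v_def)
  then have v: "0 \<le> v" "v < 1" and va: "v * norm At < 1/4 * d * (1 - v)\<^sup>2"
    by (cases "Var_K At K' \<beta> g"; simp add: v_def ennreal_less_one_iff)+
  have "d * (v * norm At) \<le> d * (1/4 * d * (1 - v)\<^sup>2)"
    using va d by (intro mult_left_mono) auto
  then have pos: "0 \<le> 1/4 * d\<^sup>2 * (1 - v)\<^sup>2 - d * v * norm At"
    by (simp add: power2_eq_square mult_ac)
  have "1/4 * d\<^sup>2 * (1 - v)\<^sup>2 - d * v * norm At \<le> (1/2 * d * (1 - v))\<^sup>2"
    using d v by (simp add: power_mult_distrib power2_eq_square)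
  then have "sqrt (1/4 * d\<^sup>2 * (1 - v)\<^sup>2 - d * v * norm At) \<le> 1/2 * d * (1 - v)"
    using d v by (intro real_le_lsqrt) auto
  moreover have "r_min At K' \<beta> g = 1/2 * d * (1 - v) - sqrt (1/4 * d\<^sup>2 * (1 - v)\<^sup>2 - d * v * norm At)"
    by (simp add: r_min_def d_def v_def Let_def)
  ultimately show "0 \<le> r_min At K' \<beta> g"
    "r_min At K' \<beta> g \<le> 1/2 * contour_dist At \<beta> g * (1 - enn2real (Var_K At K' \<beta> g))"
    using real_sqrt_ge_zero[OF pos] by (simp_all add: d_def v_def)
qed

lemma r_zero_le:
  assumes "admissible_contour At K' lamC \<beta> \<D> l g"
  shows "r_zero At K' lamC \<beta> \<D> l \<le> 1/2 * contour_dist At \<beta> g * (1 - enn2real (Var_K At K' \<beta> g))"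
proof -
  have "r_zero At K' lamC \<beta> \<D> l \<le> r_min At K' \<beta> g"
    unfolding r_zero_def
    by (intro cInf_lower bdd_belowI[of _ 0]) (use assms r_min_bounds(1) in auto)
  also note r_min_bounds(2)[OF assms]
  finally show ?thesis .
qed

theorem theorem4p1:
  fixes C S :: "'c::complex_hilbert \<Rightarrow> 'c" and domC domS :: "'c set"
    and R :: "'c \<Rightarrow>\<^sub>C\<^sub>L 'c" and E :: "real \<Rightarrow> 'c \<Rightarrow>\<^sub>C\<^sub>L 'c"
    and A At Xr Xl Zr Zl :: "'a::complex_hilbert \<Rightarrow>\<^sub>C\<^sub>L 'a"
    and B :: "'c \<Rightarrow> 'a" and domB :: "'c set" and Bt :: "'c \<Rightarrow>\<^sub>C\<^sub>L 'a"
    and D :: "'a \<Rightarrow> 'c" and domD :: "'a set" and Dt :: "'a \<Rightarrow>\<^sub>C\<^sub>L 'c"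
    and lamC \<alpha>1 \<alpha>2 \<eta> \<beta> c \<gamma> :: real
    and K dK :: "real \<Rightarrow> 'a \<Rightarrow>\<^sub>C\<^sub>L 'a" and Kc dKc K' :: "complex \<Rightarrow> 'a \<Rightarrow>\<^sub>C\<^sub>L 'a"
    and \<D> :: "complex set" and l :: int and g :: "real \<Rightarrow> complex"
  \<comment> \<open>operators\<close>
  assumes "separable_space (euclidean :: 'a topology)" "separable_space (euclidean :: 'c topology)"
    and "self_adjoint domC C" "lamC > 0" "bounded_below_by domC C lamC"
    and "spectral_family_of E domC C" "absolutely_continuous_spectrum E"
    and "op_spectrum domC C = complex_of_real ` {lamC..}"
    and "is_sqrt_of domS S domC C" "is_bounded_inverse_of R domS S"
    and "densely_defined_closable domD D" "\<forall>x\<in>domD. cblinfun_apply Dt x = cblinfun_apply R (D x)"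
    and "densely_defined_closable domB B" "domS \<subseteq> domB"
    and "\<forall>y. cblinfun_apply Bt y = B (cblinfun_apply R y)"
    and At: "At = A - Bt o\<^sub>C\<^sub>L Dt"
  \<comment> \<open>numerical range\<close>
    and "\<eta> > 0" "\<alpha>1 < \<alpha>2" "\<alpha>1 - \<eta> > lamC" "\<beta> > \<alpha>2 + \<eta>"
    and "numerical_range_closure At
           \<subseteq> {z. infdist z (closed_segment (complex_of_real \<alpha>1) (complex_of_real \<alpha>2)) \<le> \<eta>}"
  \<comment> \<open>the function \<open>K\<close>, its derivative \<open>dK\<close> on the real line, its continuation \<open>Kc\<close> to \<open>\<D>\<close> with
      derivative \<open>dKc\<close>, and the derivative \<open>K'\<close> along the contours: \<open>dK\<close> on the ray \<open>[\<beta>, \<infinity>)\<close>, and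
      \<open>dKc\<close> elsewhere\<close>
    and K: "\<forall>\<mu>. K \<mu> = Bt o\<^sub>C\<^sub>L E \<mu> o\<^sub>C\<^sub>L Dt"
    and "\<forall>\<mu>>lamC. (K has_vector_derivative dK \<mu>) (at \<mu>)" "continuous_on {lamC<..} dK"
    and "open \<D>" "simply_connected \<D>"
    and "{z. infdist z (closed_segment (complex_of_real \<alpha>1) (complex_of_real \<alpha>2)) \<le> \<eta>} \<subseteq> \<D>"
    and "complex_of_real ` {lamC<..<\<beta>} \<subseteq> \<D>" "\<forall>\<mu>\<in>{lamC<..<\<beta>}. Kc (complex_of_real \<mu>) = K \<mu>"
    and "\<forall>\<mu>\<in>\<D>. (Kc has_derivative (\<lambda>h. h *\<^sub>C dKc \<mu>)) (at \<mu>)"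
    and "c > 0" "-1 < \<gamma>" "\<gamma> \<le> 0"
    and "\<forall>p\<in>{lamC, \<beta>}. \<forall>\<^sub>F \<mu> in at (complex_of_real p) within \<D>.
           norm (dKc \<mu>) \<le> c * cmod (\<mu> - complex_of_real p) powr \<gamma>"
    and "(\<integral>\<^sup>+\<mu>\<in>{\<beta>..}. ennreal (norm (dK \<mu>) / (1 + \<bar>\<mu>\<bar>)) \<partial>lborel) < \<infinity>"
    and K': "\<forall>\<mu>. K' \<mu> = (if \<mu> \<in> complex_of_real ` {\<beta>..} then dK (Re \<mu>) else dKc \<mu>)"
  \<comment> \<open>admissible contours and the solutions of the basic equations\<close>
    and "\<exists>h. admissible_contour At K' lamC \<beta> \<D> 1 h" "\<exists>h. admissible_contour At K' lamC \<beta> \<D> (-1) h"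
    and "l \<in> {1, -1}" "admissible_contour At K' lamC \<beta> \<D> l g"
    and "Xr = V_right K' \<beta> g (At + Xr)" "norm Xr \<le> r_zero At K' lamC \<beta> \<D> l"
    and "Xl = V_left K' \<beta> g (At + Xl)" "norm Xl \<le> r_zero At K' lamC \<beta> \<D> l"
    and "Zr = At + Xr" "Zl = At + Xl"
  \<comment> \<open>the first two items of the conclusion say that the resolvents and the integrals in the
      definitions of \<open>M\<close> and of the two factors exist\<close>
  shows "(\<forall>\<mu>\<in>contour_set g \<beta>. boundedly_invertible (Zr - \<mu> *\<^sub>C id_cblinfun)
                         \<and> boundedly_invertible (Zl - \<mu> *\<^sub>C id_cblinfun)) \<and>
     (\<forall>z. z \<notin> contour_set g \<beta> \<longrightarrow>
        (contour_integrable g \<beta> (\<lambda>\<mu>. (z / (z - \<mu>)) *\<^sub>C K' \<mu>) \<and>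
         contour_integrable g \<beta> (\<lambda>\<mu>. K' \<mu> o\<^sub>C\<^sub>L cblinfun_inv (Zr - \<mu> *\<^sub>C id_cblinfun)) \<and>
         contour_integrable g \<beta>
           (\<lambda>\<mu>. inverse (z - \<mu>) *\<^sub>C (K' \<mu> o\<^sub>C\<^sub>L cblinfun_inv (Zr - \<mu> *\<^sub>C id_cblinfun))) \<and>
         contour_integrable g \<beta> (\<lambda>\<mu>. cblinfun_inv (Zl - \<mu> *\<^sub>C id_cblinfun) o\<^sub>C\<^sub>L K' \<mu>) \<and>
         contour_integrable g \<beta>
           (\<lambda>\<mu>. inverse (z - \<mu>) *\<^sub>C (cblinfun_inv (Zl - \<mu> *\<^sub>C id_cblinfun) o\<^sub>C\<^sub>L K' \<mu>))) \<and>
        M_fun At K' \<beta> g z = W_right K' \<beta> g Zr z o\<^sub>C\<^sub>L (Zr - z *\<^sub>C id_cblinfun) \<and>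
        M_fun At K' \<beta> g z = (Zl - z *\<^sub>C id_cblinfun) o\<^sub>C\<^sub>L W_left K' \<beta> g Zl z \<and>
        (infdist z (numerical_range_closure At)
           \<le> 1/2 * contour_dist At \<beta> g * (1 - enn2real (Var_K At K' \<beta> g)) \<longrightarrow>
         norm (W_right K' \<beta> g Zr z - id_cblinfun) < 1 \<and>
         norm (W_left K' \<beta> g Zl z - id_cblinfun) < 1 \<and>
         boundedly_invertible (W_right K' \<beta> g Zr z) \<and>
         boundedly_invertible (W_left K' \<beta> g Zl z)))"
proof -
  have con: "is_contour lamC \<beta> \<D> l g" and adm: "contour_dist At \<beta> g > 0" "Var_K At K' \<beta> g < 1"
    "enn2real (Var_K At K' \<beta> g) * norm At < 1/4 * contour_dist At \<beta> g * (1 - enn2real (Var_K At K' \<beta> g))\<^sup>2"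
    using \<open>admissible_contour At K' lamC \<beta> \<D> l g\<close> by (auto simp: admissible_contour_def)
  then have arc: "rectifiable_arc g" and fin: "pathfinish g = complex_of_real \<beta>"
    and gD: "g ` {0<..<1} \<subseteq> \<D> \<inter> {z. of_int l * Im z > 0}"
    by (auto simp: is_contour_def)
  have "lamC < \<beta>"
    using \<open>\<alpha>1 < \<alpha>2\<close> \<open>\<eta> > 0\<close> \<open>\<alpha>1 - \<eta> > lamC\<close> \<open>\<beta> > \<alpha>2 + \<eta>\<close> by linarith
  \<comment> \<open>Complex differentiability of \<open>Kc\<close> on an open set already makes its
    derivative continuous in operator norm.\<close>
  have dKc: "continuous_on \<D> dKc"
    using \<open>open \<D>\<close> \<open>\<forall>\<mu>\<in>\<D>. (Kc has_derivative (\<lambda>h. h *\<^sub>C dKc \<mu>)) (at \<mu>)\<close>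
    by (intro continuous_on_cblinfun_derivative[of \<D> Kc dKc]) auto
  interpret transfer_contour At K' \<beta> g
  proof
    have g: "continuous_on {0<..<1} g"
      using arc by (auto simp: rectifiable_arc_def arc_def path_def intro: continuous_on_subset)
    have "continuous_on {0<..<1} (\<lambda>t. dKc (g t))"
      using gD by (intro continuous_on_compose2[OF dKc g]) auto
    \<comment> \<open>The interior of the curve lies in an open half-plane, hence off the ray, so
      \<open>K'\<close> is \<open>dKc\<close> there.\<close>
    moreover have "dKc (g t) = K' (g t)" if "t \<in> {0<..<1}" for t
    proof -
      have "g t \<in> \<D> \<inter> {z. of_int l * Im z > 0}" using gD that by blast
      then have "Im (g t) \<noteq> 0" by auto
      then have "g t \<notin> complex_of_real ` {\<beta>..}" by auto
      then show ?thesis using K' by simp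
    qed
    ultimately show "continuous_on {0<..<1} (\<lambda>t. K' (g t))"
      by (rule continuous_on_eq)
    have "continuous_on {\<beta>..} dK"
      by (rule continuous_on_subset[OF \<open>continuous_on {lamC<..} dK\<close>]) (use \<open>lamC < \<beta>\<close> in auto)
    moreover have "dK \<mu> = K' (complex_of_real \<mu>)" if "\<mu> \<in> {\<beta>..}" for \<mu>
      using K' that by auto
    ultimately show "continuous_on {\<beta>..} (\<lambda>\<mu>. K' (complex_of_real \<mu>))"
      by (rule continuous_on_eq)
  qed (fact arc fin adm)+
  \<comment> \<open>\<open>r_zero\<close> is at most the radius of this particular contour, and that
    is at most d(1 - v)/2.\<close>
  have Xr: "norm Xr \<le> 1/2 * d * (1 - v)" and Xl: "norm Xl \<le> 1/2 * d * (1 - v)"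
    using r_zero_le[OF \<open>admissible_contour At K' lamC \<beta> \<D> l g\<close>]
      \<open>norm Xr \<le> r_zero At K' lamC \<beta> \<D> l\<close> \<open>norm Xl \<le> r_zero At K' lamC \<beta> \<D> l\<close> by linarith+
  have fr: "Xr = V_right K' \<beta> g Zr" and fl: "Xl = V_left K' \<beta> g Zl"
    using \<open>Xr = V_right K' \<beta> g (At + Xr)\<close> \<open>Xl = V_left K' \<beta> g (At + Xl)\<close>
      \<open>Zr = At + Xr\<close> \<open>Zl = At + Xl\<close> by simp_all
  note R = right_factorization[OF Xr \<open>Zr = At + Xr\<close> fr, unfolded Res_def[OF Xr \<open>Zr = At + Xr\<close>]]
    and L = left_factorization[OF Xl \<open>Zl = At + Xl\<close> fl, unfolded Res_def[OF Xl \<open>Zl = At + Xl\<close>]]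
  show ?thesis
    using invertible[OF Xr \<open>Zr = At + Xr\<close>] invertible[OF Xl \<open>Zl = At + Xl\<close>] R L
      boundedly_invertible_near_id[OF R(5)] boundedly_invertible_near_id[OF L(4)]
    by (intro conjI allI impI ballI) simp_all
qed

end
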